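(* For each $Z_0\in B_b(S\times A)$ there exists a unique $Z\in C^1(\mathbb R_+;B_b(S\times A))$ satisfying $Z|_{t=0}=Z_0$ and $$\partial_tZ_t(s,a)=-\big(Q^{\pi_t}_\tau(s,a)+\tau Z_t(s,a)-V^{\pi_t}_\tau(s)\big),\qquad \pi_t=\boldsymbol\pi(Z_t),\qquad \text{for all } t\in\mathbb R_+.$$ Consequently, for all $\pi_0\in\Pi_\mu$ there exists a unique $\pi\in C^1(\mathbb R_+;\Pi_\mu)$ satisfying $\pi|_{t=0}=\pi_0$ and $$\partial_t\pi_t(da|s)=-\Big(Q^{\pi_t}_\tau(s,a)+\tau\ln\frac{\mathrm d\pi_t}{\mathrm d\mu}(a|s)-V^{\pi_t}_\tau(s)\Big)\pi_t(da|s)\qquad\text{for all } t\in\mathbb R_+.$$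
   Context: $\mathbb R_+=[0,\infty)$. $S,A$ are Polish spaces (with Borel $\sigma$-algebras), $P$ is a probability kernel from $S\times A$ to $S$ (written $P(ds'|s,a)$), $c:S\times A\to\mathbb R$ is bounded measurable, $\gamma\in[0,1)$, $\mu$ is a probability measure on $A$, $\tau\in(0,\infty)$. $B_b(E)$ denotes bounded measurable real functions on $E$ with the sup norm. $b\mathcal M(A|S)$ is the Banach space of bounded signed kernels $k(da|s)$ from $S$ to $A$ with norm $\sup_{s\in S}|k(\cdot|s)|(A)$ (total variation). $\mathrm{KL}(m|m')=\int\ln\frac{\mathrm dm}{\mathrm dm'}\,dm$ if $m\ll m'$, and $+\infty$ otherwise. For $f\in B_b(S\times A)$ put $\boldsymbol\pi(f)(da|s)=\frac{e^{f(s,a)}}{\int_A e^{f(s,a')}\mu(da')}\mu(da)$, and $\Pi_\mu=\{\boldsymbol\pi(f): f\in B_b(S\times A)\}\subset b\mathcal M(A|S)$. For $\pi\in\Pi_\mu$, $\frac{\mathrm d\pi}{\mathrm d\mu}(a|s)$ is the density of $\pi(\cdot|s)$ with respect to $\mu$ (for $\pi=\boldsymbol\pi(f)$ it is $e^{f(s,a)}/\int_A e^{f(s,a')}\mu(da')$). For an interval $I\subset[0,\infty)$, $\pi\in C^1(I;\Pi_\mu)$ means $\pi\in C^1(I;b\mathcal M(A|S))$ and $\pi_t\in\Pi_\mu$ for all $t\in I$. For $\pi\in\Pi_\mu$, let $\mathbb E^\pi_s$ be expectation for the controlled process with $s_0=s$, $a_n\sim\pi(\cdot|s_n)$, $s_{n+1}\sim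 P(\cdot|s_n,a_n)$. Define $V^\pi_\tau(s)=\mathbb E^\pi_s\big[\sum_{n\ge0}\gamma^n\big(c(s_n,a_n)+\tau\,\mathrm{KL}(\pi(\cdot|s_n)|\mu)\big)\big]$ and $Q^\pi_\tau(s,a)=c(s,a)+\gamma\int_S V^\pi_\tau(s')P(ds'|s,a)$. *)

theory Defs
  imports "HOL-Probability.Probability"
begin

subsection \<open>Bounded measurable functions with the supremum norm\<close>

typedef (overloaded) 'e bmeas =
  "{f :: 'e::topological_space \<Rightarrow> real. f \<in> borel_measurable borel \<and> bounded (range f)}"
  morphisms apply_bmeas Bmeas
  by (rule exI[of _ "\<lambda>_. 0"]) (auto simp: bounded_def)

setup_lifting type_definition_bmeas

lemma measurable_apply_bmeas [measurable]: "apply_bmeas f \<in> borel_measurable borel"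
  and bounded_apply_bmeas: "bounded (range (apply_bmeas f))"
  using apply_bmeas[of f] by auto

lemma bdd_above_apply_bmeas: "bdd_above (range (\<lambda>x. \<bar>apply_bmeas f x\<bar>))"
  using bounded_apply_bmeas[of f] by (auto simp: bounded_iff bdd_above_def)

instantiation bmeas :: (topological_space) real_normed_vector
begin

lift_definition zero_bmeas :: "'a bmeas" is "\<lambda>_. 0"
  by (auto simp: bounded_def)

lift_definition plus_bmeas :: "'a bmeas \<Rightarrow> 'a bmeas \<Rightarrow> 'a bmeas" is "\<lambda>f g x. f x + g x"
  by (auto intro: bounded_plus_comp)

lift_definition minus_bmeas :: "'a bmeas \<Rightarrow> 'a bmeas \<Rightarrow> 'a bmeas" is "\<lambda>f g x. f x - g x"
  by (auto intro: bounded_minus_comp)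

lift_definition uminus_bmeas :: "'a bmeas \<Rightarrow> 'a bmeas" is "\<lambda>f x. - f x"
  by auto

lift_definition scaleR_bmeas :: "real \<Rightarrow> 'a bmeas \<Rightarrow> 'a bmeas" is "\<lambda>r f x. r * f x"
  using bounded_scaleR_comp[where 'b = real] by fastforce

lift_definition norm_bmeas :: "'a bmeas \<Rightarrow> real" is "\<lambda>f. SUP x. \<bar>f x\<bar>" .

definition sgn_bmeas :: "'a bmeas \<Rightarrow> 'a bmeas" where "sgn_bmeas f = inverse (norm f) *\<^sub>R f"

definition dist_bmeas :: "'a bmeas \<Rightarrow> 'a bmeas \<Rightarrow> real" where "dist_bmeas f g = norm (f - g)"

definition uniformity_bmeas :: "('a bmeas \<times> 'a bmeas) filter" where
  "uniformity_bmeas = (INF e\<in>{0 <..}. principal {(x, y). dist x y < e})"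

definition open_bmeas :: "'a bmeas set \<Rightarrow> bool" where
  "open_bmeas U = (\<forall>x\<in>U. \<forall>\<^sub>F (x', y) in uniformity. x' = x \<longrightarrow> y \<in> U)"

lemma abs_apply_bmeas_le_norm: "\<bar>apply_bmeas f x\<bar> \<le> norm f"
  unfolding norm_bmeas.rep_eq by (rule cSUP_upper) (auto intro: bdd_above_apply_bmeas)

lemma norm_bmeas_le: "(\<And>x. \<bar>apply_bmeas f x\<bar> \<le> b) \<Longrightarrow> norm f \<le> b"
  unfolding norm_bmeas.rep_eq by (rule cSUP_least) auto

instance
proof
  fix f g :: "'a bmeas" and r :: real
  show "(norm f = 0) = (f = 0)"
  proof
    assume "norm f = 0"
    then have "apply_bmeas f x = 0" for x
      using abs_apply_bmeas_le_norm[of f x] by simp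
    then show "f = 0" by transfer auto
  next
    assume "f = 0"
    then show "norm f = 0" by transfer simp
  qed
  show "norm (f + g) \<le> norm f + norm g"
    by (rule norm_bmeas_le)
       (use abs_apply_bmeas_le_norm[of f] abs_apply_bmeas_le_norm[of g] in
         \<open>auto simp: plus_bmeas.rep_eq intro: order_trans[OF abs_triangle_ineq] add_mono\<close>)
  show "norm (r *\<^sub>R f) = \<bar>r\<bar> * norm f"
  proof (rule antisym)
    show "norm (r *\<^sub>R f) \<le> \<bar>r\<bar> * norm f"
      by (rule norm_bmeas_le)
         (auto simp: scaleR_bmeas.rep_eq abs_mult intro: mult_left_mono abs_apply_bmeas_le_norm)
    show "\<bar>r\<bar> * norm f \<le> norm (r *\<^sub>R f)"
    proof (cases "r = 0")
      case True
      have "0 \<le> \<bar>apply_bmeas (r *\<^sub>R f) undefined\<bar>" by simp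
      also have "\<dots> \<le> norm (r *\<^sub>R f)" by (rule abs_apply_bmeas_le_norm)
      finally show ?thesis using True by simp
    next
      case False
      have "norm f \<le> norm (r *\<^sub>R f) / \<bar>r\<bar>"
        by (rule norm_bmeas_le)
           (use abs_apply_bmeas_le_norm[of "r *\<^sub>R f"] False in
             \<open>auto simp: scaleR_bmeas.rep_eq abs_mult field_simps\<close>)
      then show ?thesis using False by (auto simp: field_simps)
    qed
  qed
qed (simp_all add: sgn_bmeas_def dist_bmeas_def uniformity_bmeas_def open_bmeas_def,
     (transfer; auto simp: fun_eq_iff algebra_simps)+)

end


subsection \<open>Bounded signed kernels with the uniform total variation norm\<close>

definition signed_measure :: "('a::topological_space set \<Rightarrow> real) \<Rightarrow> bool" where
  "signed_measure m \<longleftrightarrow> m {} = 0 \<and>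
     (\<forall>B :: nat \<Rightarrow> 'a set. range B \<subseteq> sets borel \<longrightarrow> disjoint_family B \<longrightarrow>
        (\<lambda>i. m (B i)) sums m (\<Union>i. B i))"

definition total_variation :: "('a::topological_space set \<Rightarrow> real) \<Rightarrow> ennreal" where
  "total_variation m =
     (SUP \<B> \<in> {\<B>. finite \<B> \<and> \<B> \<subseteq> sets borel \<and> partition_on UNIV \<B>}. \<Sum>B\<in>\<B>. ennreal \<bar>m B\<bar>)"

lemma total_variation_upper:
  "finite \<B> \<Longrightarrow> \<B> \<subseteq> sets borel \<Longrightarrow> partition_on UNIV \<B> \<Longrightarrow>
    (\<Sum>B\<in>\<B>. ennreal \<bar>m B\<bar>) \<le> total_variation m"
  unfolding total_variation_def by (rule SUP_upper) auto

lemma abs_le_total_variation: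
  assumes "B \<in> sets borel" "m {} = 0"
  shows "ennreal \<bar>m B\<bar> \<le> total_variation m"
proof (cases "B = {}")
  case False
  let ?B = "{B, - B} - {{}}"
  have "ennreal \<bar>m B\<bar> \<le> (\<Sum>B\<in>?B. ennreal \<bar>m B\<bar>)"
    by (rule member_le_sum) (use False in auto)
  also have "\<dots> \<le> total_variation m"
    using assms by (intro total_variation_upper) (auto simp: partition_on_def disjoint_def)
  finally show ?thesis .
qed (use assms in simp)

lemma total_variation_0 [simp]: "total_variation (\<lambda>_. 0) = 0"
  unfolding total_variation_def by (auto simp: SUP_eq_iff bot_ennreal intro!: antisym SUP_least)

lemma total_variation_add:
  "total_variation (\<lambda>B. m B + n B) \<le> total_variation m + total_variation n"
proof -
  have "(\<Sum>B\<in>\<B>. ennreal \<bar>m B + n B\<bar>) \<le> total_variation m + total_variation n"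
    if "finite \<B>" "\<B> \<subseteq> sets borel" "partition_on UNIV \<B>" for \<B>
  proof -
    have "(\<Sum>B\<in>\<B>. ennreal \<bar>m B + n B\<bar>) \<le> (\<Sum>B\<in>\<B>. ennreal \<bar>m B\<bar> + ennreal \<bar>n B\<bar>)"
      by (rule sum_mono) (simp flip: ennreal_plus add: ennreal_leI abs_triangle_ineq)
    also have "\<dots> \<le> total_variation m + total_variation n"
      unfolding sum.distrib by (intro add_mono total_variation_upper that)
    finally show ?thesis .
  qed
  then show ?thesis
    unfolding total_variation_def[of "\<lambda>B. m B + n B"] by (auto intro!: SUP_least)
qed

lemma total_variation_cmult:
  "total_variation (\<lambda>B. r * m B) = ennreal \<bar>r\<bar> * total_variation m"
  unfolding total_variation_def
  by (simp add: abs_mult ennreal_mult flip: sum_distrib_left SUP_mult_left_ennreal)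

text \<open>
  Kernels are set functions; the value 0 off the Borel sets makes equality of
  representatives coincide with equality of kernels.
\<close>

typedef (overloaded) ('s, 'a) bkernel =
  "{k :: 's::topological_space \<Rightarrow> 'a::topological_space set \<Rightarrow> real.
      (\<forall>s. signed_measure (k s)) \<and>
      (\<forall>B\<in>sets borel. (\<lambda>s. k s B) \<in> borel_measurable borel) \<and>
      (\<forall>s B. B \<notin> sets borel \<longrightarrow> k s B = 0) \<and>
      (SUP s. total_variation (k s)) < \<infinity>}"
  morphisms apply_bkernel Bkernel
  by (rule exI[of _ "\<lambda>_ _. 0"]) (auto simp: signed_measure_def)

setup_lifting type_definition_bkernel

lemma SUP_total_variation_add:
  "(SUP s. total_variation (\<lambda>B. k s B + l s B)) \<le>
     (SUP s. total_variation (k s)) + (SUP s. total_variation (l s))"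
  by (intro SUP_least order_trans[OF total_variation_add] add_mono SUP_upper) auto

lemma SUP_total_variation_cmult:
  "(SUP s. total_variation (\<lambda>B. r * k s B)) = ennreal \<bar>r\<bar> * (SUP s. total_variation (k s))"
  by (simp add: total_variation_cmult SUP_mult_left_ennreal)

lemma bkernel_cmult_closed:
  fixes k :: "'s::topological_space \<Rightarrow> 'a::topological_space set \<Rightarrow> real"
  assumes "(\<forall>s. signed_measure (k s)) \<and>
      (\<forall>B\<in>sets borel. (\<lambda>s. k s B) \<in> borel_measurable borel) \<and>
      (\<forall>s B. B \<notin> sets borel \<longrightarrow> k s B = 0) \<and> (SUP s. total_variation (k s)) < \<infinity>"
  shows "(\<forall>s. signed_measure (\<lambda>B. r * k s B)) \<and>
      (\<forall>B\<in>sets borel. (\<lambda>s. r * k s B) \<in> borel_measurable borel) \<and>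
      (\<forall>s B. B \<notin> sets borel \<longrightarrow> r * k s B = 0) \<and>
      (SUP s. total_variation (\<lambda>B. r * k s B)) < \<infinity>"
  using assms unfolding SUP_total_variation_cmult
  by (auto simp: signed_measure_def intro: sums_mult ennreal_mult_less_top[THEN iffD2])

lemma bkernel_add_closed:
  fixes k l :: "'s::topological_space \<Rightarrow> 'a::topological_space set \<Rightarrow> real"
  assumes "(\<forall>s. signed_measure (k s)) \<and>
      (\<forall>B\<in>sets borel. (\<lambda>s. k s B) \<in> borel_measurable borel) \<and>
      (\<forall>s B. B \<notin> sets borel \<longrightarrow> k s B = 0) \<and> (SUP s. total_variation (k s)) < \<infinity>"
    and "(\<forall>s. signed_measure (l s)) \<and>
      (\<forall>B\<in>sets borel. (\<lambda>s. l s B) \<in> borel_measurable borel) \<and>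
      (\<forall>s B. B \<notin> sets borel \<longrightarrow> l s B = 0) \<and> (SUP s. total_variation (l s)) < \<infinity>"
  shows "(\<forall>s. signed_measure (\<lambda>B. k s B + l s B)) \<and>
      (\<forall>B\<in>sets borel. (\<lambda>s. k s B + l s B) \<in> borel_measurable borel) \<and>
      (\<forall>s B. B \<notin> sets borel \<longrightarrow> k s B + l s B = 0) \<and>
      (SUP s. total_variation (\<lambda>B. k s B + l s B)) < \<infinity>"
  using assms
  by (auto simp: signed_measure_def intro: sums_add borel_measurable_add
      intro!: le_less_trans[OF SUP_total_variation_add])

instantiation bkernel :: (topological_space, topological_space) real_normed_vector
begin

lift_definition zero_bkernel :: "('a, 'b) bkernel" is "\<lambda>_ _. 0"
  by (auto simp: signed_measure_def)

lift_definition plus_bkernel :: "('a, 'b) bkernel \<Rightarrow> ('a, 'b) bkernel \<Rightarrow> ('a, 'b) bkernel"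
  is "\<lambda>k l s B. k s B + l s B"
  by (rule bkernel_add_closed)

lift_definition scaleR_bkernel :: "real \<Rightarrow> ('a, 'b) bkernel \<Rightarrow> ('a, 'b) bkernel"
  is "\<lambda>r k s B. r * k s B"
  by (rule bkernel_cmult_closed)

definition uminus_bkernel :: "('a, 'b) bkernel \<Rightarrow> ('a, 'b) bkernel" where
  "uminus_bkernel k = (-1) *\<^sub>R k"

definition minus_bkernel :: "('a, 'b) bkernel \<Rightarrow> ('a, 'b) bkernel \<Rightarrow> ('a, 'b) bkernel" where
  "minus_bkernel k l = k + - l"

lift_definition norm_bkernel :: "('a, 'b) bkernel \<Rightarrow> real"
  is "\<lambda>k. enn2real (SUP s. total_variation (k s))" .

definition sgn_bkernel :: "('a, 'b) bkernel \<Rightarrow> ('a, 'b) bkernel" where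
  "sgn_bkernel k = inverse (norm k) *\<^sub>R k"

definition dist_bkernel :: "('a, 'b) bkernel \<Rightarrow> ('a, 'b) bkernel \<Rightarrow> real" where
  "dist_bkernel k l = norm (k - l)"

definition uniformity_bkernel :: "(('a, 'b) bkernel \<times> ('a, 'b) bkernel) filter" where
  "uniformity_bkernel = (INF e\<in>{0 <..}. principal {(x, y). dist x y < e})"

definition open_bkernel :: "('a, 'b) bkernel set \<Rightarrow> bool" where
  "open_bkernel U = (\<forall>x\<in>U. \<forall>\<^sub>F (x', y) in uniformity. x' = x \<longrightarrow> y \<in> U)"

instance
proof
  fix k l :: "('a, 'b) bkernel" and r :: real
  show "(norm k = 0) = (k = 0)"
  proof (transfer, safe)
    fix k :: "'a \<Rightarrow> 'b set \<Rightarrow> real"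
    assume sm: "\<forall>s. signed_measure (k s)" and 0: "\<forall>s B. B \<notin> sets borel \<longrightarrow> k s B = 0"
      and fin: "(SUP s. total_variation (k s)) < \<infinity>"
      and "enn2real (SUP s. total_variation (k s)) = 0"
    then have *: "(SUP s. total_variation (k s)) = 0"
      unfolding enn2real_eq_0_iff by (metis infinity_ennreal_def less_irrefl)
    have "k s B = 0" for s B
    proof (cases "B \<in> sets borel")
      case True
      have "ennreal \<bar>k s B\<bar> \<le> total_variation (k s)"
        using True sm by (intro abs_le_total_variation) (auto simp: signed_measure_def)
      also have "\<dots> \<le> (SUP s. total_variation (k s))" by (rule SUP_upper) simp
      finally show ?thesis by (simp add: *)
    qed (use 0 in auto)
    then show "k = (\<lambda>_ _. 0)" by (auto simp: fun_eq_iff)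
  qed simp
  show "norm (k + l) \<le> norm k + norm l"
  proof (transfer, safe)
    fix k l :: "'a \<Rightarrow> 'b set \<Rightarrow> real"
    assume "(SUP s. total_variation (k s)) < \<infinity>" "(SUP s. total_variation (l s)) < \<infinity>"
    then show "enn2real (SUP s. total_variation (\<lambda>B. k s B + l s B)) \<le>
        enn2real (SUP s. total_variation (k s)) + enn2real (SUP s. total_variation (l s))"
      using enn2real_mono[OF SUP_total_variation_add[of k l]]
      by (simp add: enn2real_plus)
  qed
  show "norm (r *\<^sub>R k) = \<bar>r\<bar> * norm k"
    by transfer (simp add: SUP_total_variation_cmult enn2real_mult)
qed (simp_all add: sgn_bkernel_def dist_bkernel_def uniformity_bkernel_def open_bkernel_def
       minus_bkernel_def uminus_bkernel_def,
     (transfer; auto simp: fun_eq_iff algebra_simps)+)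

end

lemma signed_measure_apply_bkernel: "signed_measure (apply_bkernel k s)"
  and measurable_apply_bkernel [measurable (raw)]:
    "B \<in> sets borel \<Longrightarrow> (\<lambda>s. apply_bkernel k s B) \<in> borel_measurable borel"
  and apply_bkernel_notin: "B \<notin> sets borel \<Longrightarrow> apply_bkernel k s B = 0"
  using apply_bkernel[of k] by auto


subsection \<open>Continuously differentiable curves\<close>

text \<open>
  Derivatives are taken within \<open>I\<close>, hence one-sided at end points of an interval that
  belong to it. Curves are extensional so that \<open>C1 I X\<close> is a space of functions on \<open>I\<close>.
\<close>

definition C1 :: "real set \<Rightarrow> 'b::real_normed_vector set \<Rightarrow> (real \<Rightarrow> 'b) set" where
  "C1 I X = {f \<in> I \<rightarrow>\<^sub>E X. \<exists>f'. (\<forall>t\<in>I. (f has_vector_derivative f' t) (at t within I)) \<and>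
                                continuous_on I f'}"


subsection \<open>Policies\<close>

definition softmax :: "'a::topological_space measure \<Rightarrow> ('s::topological_space \<times> 'a) bmeas \<Rightarrow>
    ('s, 'a) bkernel" where
  "softmax \<mu> f = Bkernel (\<lambda>s B. measure (density \<mu>
     (\<lambda>a. ennreal (exp (apply_bmeas f (s, a)) / (\<integral>a'. exp (apply_bmeas f (s, a')) \<partial>\<mu>)))) B)"

definition policies :: "'a::topological_space measure \<Rightarrow> ('s::topological_space, 'a) bkernel set" where
  "policies \<mu> = range (softmax \<mu>)"

text \<open>The (nonnegative) measure \<open>k(\<cdot>|s)\<close>; only meaningful for nonnegative kernels.\<close>

definition kernel_measure :: "('s::topological_space, 'a::topological_space) bkernel \<Rightarrow> 's \<Rightarrow> 'a measure" where
  "kernel_measure k s = measure_of UNIV (sets borel) (\<lambda>B. ennreal (apply_bkernel k s B))"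

text \<open>
  \<^const>\<open>RN_deriv\<close> picks a version of the density; for a softmax policy it agrees
  \<open>\<mu>\<close>-almost everywhere with the explicit one, and it is only ever integrated
  against \<open>\<pi>(\<cdot>|s) \<lless> \<mu>\<close>.
\<close>

definition policy_density :: "'a::topological_space measure \<Rightarrow> ('s::topological_space, 'a) bkernel \<Rightarrow>
    's \<Rightarrow> 'a \<Rightarrow> real" where
  "policy_density \<mu> \<pi> s a = enn2real (RN_deriv \<mu> (kernel_measure \<pi> s) a)"

text \<open>
  \<^const>\<open>KL_divergence\<close> takes the reference measure first, and is a Bochner integral, which
  is 0 for non-integrable functions. The negative part of the log-density is always
  integrable for probability measures \<open>m \<lless> m'\<close>, so there non-integrability means that the
  integral is \<open>\<infinity>\<close>.
\<close>

definition KL :: "'a measure \<Rightarrow> 'a measure \<Rightarrow> ereal" where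
  "KL m m' = (if absolutely_continuous m' m \<and> integrable m (entropy_density (exp 1) m' m)
              then ereal (KL_divergence (exp 1) m' m) else \<infinity>)"


subsection \<open>The controlled process and the value functions\<close>

text \<open>
  The law of \<open>(s\<^sub>n, a\<^sub>n)\<^sub>n\<close> on sequences in \<open>S \<times> A\<close>, given by the Ionescu-Tulcea theorem.
\<close>

definition step_kernel :: "('s::polish_space \<times> 'a::polish_space \<Rightarrow> 's measure) \<Rightarrow>
    ('s, 'a) bkernel \<Rightarrow> 's \<Rightarrow> nat \<Rightarrow> (nat \<Rightarrow> 's \<times> 'a) \<Rightarrow> ('s \<times> 'a) measure" where
  "step_kernel P \<pi> s n \<omega> =
     (if n = 0 then return borel s else P (\<omega> (n - 1))) \<bind>
       (\<lambda>s'. distr (kernel_measure \<pi> s') borel (\<lambda>a. (s', a)))"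

definition trajectory :: "('s::polish_space \<times> 'a::polish_space \<Rightarrow> 's measure) \<Rightarrow>
    ('s, 'a) bkernel \<Rightarrow> 's \<Rightarrow> (nat \<Rightarrow> 's \<times> 'a) measure" where
  "trajectory P \<pi> s =
     projective_family.lim UNIV (Ionescu_Tulcea.CI (step_kernel P \<pi> s) (\<lambda>_. borel)) (\<lambda>_. borel)"

text \<open>\<^const>\<open>real_of_ereal\<close> is harmless: \<^const>\<open>KL\<close> is finite for policies, see
  \<open>KL_softmax_finite\<close> below.\<close>

definition V :: "('s::polish_space \<times> 'a::polish_space \<Rightarrow> 's measure) \<Rightarrow> ('s \<times> 'a \<Rightarrow> real) \<Rightarrow>
    real \<Rightarrow> 'a measure \<Rightarrow> real \<Rightarrow> ('s, 'a) bkernel \<Rightarrow> 's \<Rightarrow> real" where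
  "V P c \<gamma> \<mu> \<tau> \<pi> s =
     (\<integral>\<omega>. (\<Sum>n. \<gamma> ^ n * (c (\<omega> n) + \<tau> * real_of_ereal (KL (kernel_measure \<pi> (fst (\<omega> n))) \<mu>)))
        \<partial>trajectory P \<pi> s)"

definition Q :: "('s::polish_space \<times> 'a::polish_space \<Rightarrow> 's measure) \<Rightarrow> ('s \<times> 'a \<Rightarrow> real) \<Rightarrow>
    real \<Rightarrow> 'a measure \<Rightarrow> real \<Rightarrow> ('s, 'a) bkernel \<Rightarrow> 's \<Rightarrow> 'a \<Rightarrow> real" where
  "Q P c \<gamma> \<mu> \<tau> \<pi> s a = c (s, a) + \<gamma> * (\<integral>s'. V P c \<gamma> \<mu> \<tau> \<pi> s' \<partial>P (s, a))"


subsection \<open>Well-definedness\<close>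

lemma sets_kernel_measure: "sets (kernel_measure k s) = sets borel"
  using sets.sigma_sets_eq[of borel] by (simp add: kernel_measure_def)

lemma
  fixes f :: "('s::polish_space \<times> 'a::polish_space) bmeas"
  assumes \<mu>: "prob_space \<mu>" and [measurable_cong]: "sets \<mu> = sets borel"
  shows apply_softmax: "apply_bkernel (softmax \<mu> f) s B = measure (density \<mu>
     (\<lambda>a. ennreal (exp (apply_bmeas f (s, a)) / (\<integral>a'. exp (apply_bmeas f (s, a')) \<partial>\<mu>)))) B" (is ?A)
    and kernel_measure_softmax: "kernel_measure (softmax \<mu> f) s = density \<mu>
     (\<lambda>a. ennreal (exp (apply_bmeas f (s, a)) / (\<integral>a'. exp (apply_bmeas f (s, a')) \<partial>\<mu>)))" (is ?B)
    and prob_space_softmax: "prob_space (kernel_measure (softmax \<mu> f) s)" (is ?C)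
    and KL_softmax_finite: "\<bar>KL (kernel_measure (softmax \<mu> f) s) \<mu>\<bar> \<noteq> \<infinity>" (is ?D)
proof -
  interpret prob_space \<mu> by fact
  define z where "z s = (\<integral>a. exp (apply_bmeas f (s, a)) \<partial>\<mu>)" for s
  define N where "N s = density \<mu> (\<lambda>a. ennreal (exp (apply_bmeas f (s, a)) / z s))" for s
  have f[measurable]: "apply_bmeas f \<in> borel_measurable (borel \<Otimes>\<^sub>M borel)"
    unfolding borel_prod by simp
  have space: "space \<mu> = UNIV"
    using sets_eq_imp_space_eq[OF assms(2)] by simp
  define C where "C = norm f"
  have C: "exp (- C) \<le> exp (apply_bmeas f x)" "exp (apply_bmeas f x) \<le> exp C" for x
    using abs_apply_bmeas_le_norm[of f x] by (auto simp: C_def abs_le_iff)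
  have int: "integrable \<mu> (\<lambda>a. exp (apply_bmeas f (s, a)))" for s
    by (rule integrable_const_bound[where B="exp C"]) (use C(2) in auto)
  have z_ge: "exp (- C) \<le> z s" for s
    unfolding z_def by (rule integral_ge_const[OF int]) (use C(1) in auto)
  then have z_pos: "0 < z s" for s
    by (meson exp_gt_zero less_le_trans)
  have z_le: "z s \<le> exp C" for s
    unfolding z_def by (rule integral_le_const[OF int]) (use C(2) in auto)
  have z[measurable]: "z \<in> borel_measurable borel"
    unfolding z_def by measurable
  have pN: "prob_space (N s)" for s
  proof
    have "(\<integral>\<^sup>+ a. ennreal (exp (apply_bmeas f (s, a)) / z s) \<partial>\<mu>) = ennreal (\<integral>a. exp (apply_bmeas f (s, a)) / z s \<partial>\<mu>)"
      by (rule nn_integral_eq_integral) (use int z_pos[of s] in auto)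
    also have "\<dots> = 1" using z_pos[of s] by (simp add: z_def[symmetric])
    finally show "emeasure (N s) (space (N s)) = 1"
      unfolding N_def by (subst emeasure_density) (auto simp: space cong: nn_integral_cong)
  qed
  have sN: "sets (N s) = sets borel" for s
    unfolding N_def by (simp add: assms)
  have mem: "(\<lambda>s. measure (N s)) \<in> {k. (\<forall>s. signed_measure (k s)) \<and>
      (\<forall>B\<in>sets borel. (\<lambda>s. k s B) \<in> borel_measurable borel) \<and>
      (\<forall>s B. B \<notin> sets borel \<longrightarrow> k s B = 0) \<and> (SUP s. total_variation (k s)) < \<infinity>}"
  proof (safe)
    fix s
    interpret N: prob_space "N s" by (rule pN)
    show "signed_measure (measure (N s))"
      unfolding signed_measure_def using N.finite_measure_UNION by (auto simp: sN)
    show "measure (N s) B = 0" if "B \<notin> sets borel" for B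
      using that by (simp add: measure_notin_sets sN)
  next
    fix B :: "'a set" assume B[measurable]: "B \<in> sets borel"
    have "measure (N s) B = enn2real (\<integral>\<^sup>+ a. ennreal (exp (apply_bmeas f (s, a)) / z s) * indicator B a \<partial>\<mu>)" for s
      unfolding N_def measure_def by (subst emeasure_density) (auto simp: assms)
    then show "(\<lambda>s. measure (N s) B) \<in> borel_measurable borel" by simp
  next
    have "total_variation (measure (N s)) \<le> 1" for s
      unfolding total_variation_def
    proof (rule SUP_least, safe)
      interpret N: prob_space "N s" by (rule pN)
      fix \<B> :: "'a set set" assume "finite \<B>" "\<B> \<subseteq> sets borel" "partition_on UNIV \<B>"
      then have "(\<Sum>B\<in>\<B>. measure (N s) B) = measure (N s) (\<Union>B\<in>\<B>. B)"
        by (intro N.finite_measure_finite_Union[symmetric])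
           (auto simp: sN partition_on_def disjoint_def disjoint_family_on_def)
      also have "\<dots> \<le> 1" by simp
      finally show "(\<Sum>B\<in>\<B>. ennreal \<bar>measure (N s) B\<bar>) \<le> 1" by simp
    qed
    then show "(SUP s. total_variation (measure (N s))) < \<infinity>"
      by (auto intro!: le_less_trans[OF SUP_least, of _ _ 1])
  qed
  have A: "apply_bkernel (softmax \<mu> f) = (\<lambda>s. measure (N s))"
    using Bkernel_inverse[OF mem] unfolding softmax_def N_def z_def by simp
  then show ?A by (simp add: N_def z_def)
  have K: "kernel_measure (softmax \<mu> f) s = N s" for s
  proof -
    interpret N: prob_space "N s" by (rule pN)
    have "kernel_measure (softmax \<mu> f) s = measure_of UNIV (sets borel) (\<lambda>B. ennreal (measure (N s) B))"
      by (simp add: kernel_measure_def A)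
    also have "\<dots> = measure_of UNIV (sets borel) (emeasure (N s))"
      by (simp add: N.emeasure_eq_measure[abs_def])
    also have "\<dots> = N s"
      using measure_of_of_measure[of "N s"] sets_eq_imp_space_eq[OF sN[of s]] by (simp add: sN)
    finally show ?thesis .
  qed
  then show ?B by (simp add: N_def z_def)
  show ?C unfolding K by (rule pN)
  interpret N: prob_space "N s" by (rule pN)
  have "absolutely_continuous \<mu> (N s)"
    unfolding N_def by (rule absolutely_continuousI_density) simp
  moreover have "integrable (N s) (entropy_density (exp 1) \<mu> (N s))"
  proof (rule N.integrable_const_bound[where B="2 * C"])
    have "AE a in \<mu>. ennreal (exp (apply_bmeas f (s, a)) / z s) = RN_deriv \<mu> (N s) a"
      by (rule RN_deriv_unique) (auto simp: N_def)
    then have "AE a in N s. ennreal (exp (apply_bmeas f (s, a)) / z s) = RN_deriv \<mu> (N s) a"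
      by (rule absolutely_continuous_AE[OF _ \<open>absolutely_continuous \<mu> (N s)\<close>, rotated]) (simp add: sN assms)
    then show "AE a in N s. norm (entropy_density (exp 1) \<mu> (N s) a) \<le> 2 * C"
    proof eventually_elim
      case (elim a)
      have "- C \<le> apply_bmeas f (s, a)" "apply_bmeas f (s, a) \<le> C"
        using C(1)[of "(s, a)"] C(2)[of "(s, a)"] by auto
      moreover have "- C \<le> ln (z s)" "ln (z s) \<le> C"
        using z_ge[of s] z_le[of s] z_pos[of s] ln_le_cancel_iff[of "z s" "exp C"] by (simp_all add: ln_ge_iff)
      ultimately show ?case
        using z_pos[of s]
        by (simp add: entropy_density_def elim[symmetric] log_def ln_div)
    qed
    show "entropy_density (exp 1) \<mu> (N s) \<in> borel_measurable (N s)"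
      using measurable_entropy_density[of "exp 1" \<mu> "N s"] by (simp add: N_def)
  qed
  ultimately show ?D unfolding K KL_def by simp
qed

lemma measurable_kernel_measure:
  fixes k :: "('s::topological_space, 'a::topological_space) bkernel"
  assumes "\<And>s. prob_space (kernel_measure k s)"
    and "\<And>s B. B \<in> sets borel \<Longrightarrow> emeasure (kernel_measure k s) B = ennreal (apply_bkernel k s B)"
  shows "kernel_measure k \<in> borel \<rightarrow>\<^sub>M prob_algebra borel"
proof (intro measurable_prob_algebraI measurable_subprob_algebra)
  show "(\<lambda>s. emeasure (kernel_measure k s) B) \<in> borel_measurable borel" if "B \<in> sets borel" for B
    unfolding assms(2)[OF that] using that by measurable
qed (auto simp: sets_kernel_measure assms(1) prob_space_imp_subprob_space)

lemma Ionescu_Tulcea_step_kernel: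
  fixes P :: "'s::polish_space \<times> 'a::polish_space \<Rightarrow> 's measure"
  assumes P: "P \<in> borel \<rightarrow>\<^sub>M prob_algebra borel"
    and \<mu>: "prob_space \<mu>" "sets \<mu> = sets borel" and \<pi>: "\<pi> \<in> policies \<mu>"
  shows "Ionescu_Tulcea (step_kernel P \<pi> s) (\<lambda>_. borel)"
proof -
  obtain f where f: "\<pi> = softmax \<mu> f" using \<pi> by (auto simp: policies_def)
  have K[measurable]: "kernel_measure \<pi> \<in> borel \<rightarrow>\<^sub>M prob_algebra borel"
  proof (rule measurable_kernel_measure)
    fix s show "prob_space (kernel_measure \<pi> s)" unfolding f by (rule prob_space_softmax[OF \<mu>])
    then interpret prob_space "kernel_measure \<pi> s" .
    show "emeasure (kernel_measure \<pi> s) B = ennreal (apply_bkernel \<pi> s B)" for B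
      unfolding emeasure_eq_measure by (simp add: f apply_softmax[OF \<mu>] kernel_measure_softmax[OF \<mu>])
  qed
  have D: "(\<lambda>s'. distr (kernel_measure \<pi> s') borel (\<lambda>a. (s', a))) \<in> borel \<rightarrow>\<^sub>M prob_algebra borel"
    by (rule measurable_distr_prob_space2[OF K]) (simp add: borel_prod[symmetric])
  have S: "step_kernel P \<pi> s n \<in> PiM {0..<n} (\<lambda>_. borel) \<rightarrow>\<^sub>M prob_algebra borel" for n
  proof (cases n)
    case 0
    have "(\<lambda>\<omega>. return borel s) \<in> PiM {0..<n} (\<lambda>_. borel) \<rightarrow>\<^sub>M prob_algebra borel"
      by (rule measurable_const) (simp add: space_prob_algebra prob_space_return)
    from measurable_bind_prob_space[OF this D] show ?thesis
      by (subst step_kernel_def[abs_def]) (simp only: 0 if_True HOL.simp_thms)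
  next
    case (Suc m)
    have "(\<lambda>\<omega>. P (\<omega> m)) \<in> PiM {0..<n} (\<lambda>_. borel) \<rightarrow>\<^sub>M prob_algebra borel"
      by (rule measurable_compose[OF _ P], rule measurable_component_singleton) (simp add: Suc)
    from measurable_bind_prob_space[OF this D] show ?thesis
      by (subst step_kernel_def[abs_def]) (simp only: Suc nat.distinct if_False diff_Suc_1)
  qed
  show ?thesis
  proof (rule Ionescu_Tulcea.intro)
    show "step_kernel P \<pi> s i \<in> PiM {0..<i} (\<lambda>_. borel) \<rightarrow>\<^sub>M subprob_algebra borel" for i
      by (rule measurable_prob_algebraD[OF S])
    show "prob_space (step_kernel P \<pi> s i x)" if "x \<in> space (PiM {0..<i} (\<lambda>_. borel))" for i x
      using measurable_space[OF S that] by (simp add: space_prob_algebra)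
  qed
qed

end

theory Submission
  imports Defs
begin

text \<open>
  Parametrise a policy by its log-density \<open>W\<close>, normalised so that \<open>\<integral> e\<^sup>W d\<mu> = 1\<close>. Its value function is
  the fixed point of a Bellman operator, by telescoping along the trajectory, and depends on \<open>W\<close>, for
  \<open>W\<close> in a bounded set, in a Lipschitz way with respect to the total variation distance of the
  policies. Hence the right-hand side of the equation for \<open>Z\<close> is locally Lipschitz with linear growth
  on the Banach space of bounded measurable functions, and Picard iteration gives the first claim.

  For existence of \<open>\<pi>\<close>, solve \<open>W' = - (Q + \<tau> W - V)\<close> from a normalised \<open>W\<close>. The Bellman equation says
  that the right-hand side has mean zero under the policy, so normalisation is preserved and
  \<open>\<pi> = e\<^sup>W \<mu>\<close> solves the equation.

  For uniqueness, a solution \<open>\<pi>\<close> is only known to be \<open>C\<^sup>1\<close> in total variation, which does not control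
  its log-density locally uniformly in time. This control is recovered in two steps: boundedness
  of \<open>\<pi>'\<close> in total variation bounds the value function, and then scalar differential inequalities
  for \<open>\<pi>\<^sub>t(B|s)\<close> bound the density from both sides. With such bounds the flow is Lipschitz in
  total variation, and Gronwall's argument applies.
\<close>

subsection \<open>Ordinary differential equations in Banach spaces\<close>

text \<open>What obstructs uniqueness is the entropy term: the flow contains -\<tau> x ln x for the
  density x, and the slope of x ln x is unbounded both at 0 and at infinity, so a Lipschitz estimate
  in total variation needs bounds on x from both sides. At each time a solution provides some
  log-density, but these choices carry no regularity in time; hence the a priori estimates run
  through the numbers \<pi>_t(B|s), which are continuously differentiable in t. The value is bounded
  on intervals so short that the policy moves by at most 1/4 in total variation. If the initial
  density is at most K, more than half of the later mass still sits where the density is at most 4K,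
  and there the entropy cannot compensate a large value. The admissible length depends only on a
  bound M for the derivative of \<pi>, not on the density bounds, which may deteriorate from one
  interval to the next; so finitely many intervals cover [0,T].\<close>

lemma has_vector_derivative_zeroI:
  fixes f :: "real \<Rightarrow> 'b::real_normed_vector"
  assumes f': "\<And>t. t \<in> {a..b} \<Longrightarrow> (f has_vector_derivative f' t) (at t within {a..b})"
    and le: "\<And>t. t \<in> {a..b} \<Longrightarrow> norm (f' t) \<le> L * norm (f t)"
    and init: "f a = 0" and t: "t \<in> {a..b}"
  shows "f t = 0"
proof -
  define L' where "L' = max L 1"
  have L': "0 < L'" and le': "norm (f' t) \<le> L' * norm (f t)" if "t \<in> {a..b}" for t
    using order_trans[OF le[OF that] mult_right_mono[of L L' "norm (f t)"]] by (auto simp: L'_def)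
  have cont: "continuous_on {a..b} f"
    using f' by (rule continuous_on_vector_derivative)
  \<comment> \<open>On an interval of this length starting at a zero of \<open>f\<close>, the mean
    value inequality bounds the maximum of the norm of \<open>f\<close> by half of itself, so
    \<open>f\<close> vanishes there. Finitely many such intervals cover {a..b}.\<close>
  define h where "h = 1 / (2 * L')"
  have h: "0 < h" "h * L' = 1/2" using L'[OF t] by (auto simp: h_def)
  have step: "\<forall>t\<in>{x..min b (x + h)}. f t = 0" if x: "a \<le> x" "x \<le> b" "f x = 0" for x
  proof -
    define J where "J = {x..min b (x + h)}"
    have J: "J \<subseteq> {a..b}" "compact J" "J \<noteq> {}" "convex J" "x \<in> J"
      using x h by (auto simp: J_def)
    obtain m where m: "m \<in> J" "\<And>y. y \<in> J \<Longrightarrow> norm (f y) \<le> norm (f m)"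
      using continuous_attains_sup[OF J(2,3), of "\<lambda>y. norm (f y)"]
        continuous_on_subset[OF cont J(1)] by (auto intro: continuous_on_norm)
    have "norm (f m - f x) \<le> (L' * norm (f m)) * norm (m - x)"
    proof (rule differentiable_bound[OF J(4)])
      show "(f has_derivative (\<lambda>k. k *\<^sub>R f' y)) (at y within J)" if "y \<in> J" for y
        using f'[of y] that J(1) has_vector_derivative_within_subset
        unfolding has_vector_derivative_def by (meson has_derivative_subset subsetD)
      show "onorm (\<lambda>k. k *\<^sub>R f' y) \<le> L' * norm (f m)" if "y \<in> J" for y
      proof (rule onorm_bound)
        have "norm (f' y) \<le> L' * norm (f y)"
          using le'[of y] that J(1) by blast
        also have "\<dots> \<le> L' * norm (f m)"
          using m(2)[OF that] L'[OF t] by (intro mult_left_mono) auto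
        finally have "norm (f' y) \<le> L' * norm (f m)" .
        then show "norm (k *\<^sub>R f' y) \<le> L' * norm (f m) * norm k" for k
          by (simp add: mult.commute mult_left_mono)
      qed (use L'[OF t] in auto)
    qed (use m J in auto)
    also have "\<dots> \<le> (L' * norm (f m)) * h"
      using m(1) L'[OF t] by (intro mult_left_mono) (auto simp: J_def)
    also have "\<dots> = norm (f m) / 2" using h by (simp add: mult_ac)
    finally have "norm (f m) = 0" using x(3) by simp
    then show ?thesis using m(2) by (auto simp: J_def[symmetric])
  qed
  have "\<forall>t\<in>{a..min b (a + real n * h)}. f t = 0" for n
  proof (induction n)
    case 0 then show ?case using init by auto
  next
    case (Suc n)
    show ?case
    proof
      fix t assume t': "t \<in> {a..min b (a + real (Suc n) * h)}"
      show "f t = 0"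
      proof (cases "t \<le> a + real n * h")
        case True then show ?thesis using Suc t' by auto
      next
        case False
        have "f (a + real n * h) = 0" using Suc False t' h by auto
        from step[OF _ _ this] show ?thesis using False t' h by (auto simp: algebra_simps)
      qed
    qed
  qed
  moreover obtain n where "(b - a) / h < real n" using reals_Archimedean2 by blast
  then have "b \<le> a + real n * h" using h by (auto simp: field_simps)
  ultimately show ?thesis using t by (metis min.absorb1)
qed

lemma has_integral_exp_mult:
  fixes k :: real
  assumes "0 \<le> t"
  shows "((\<lambda>s. k * exp (k * s)) has_integral (exp (k * t) - 1)) {0..t}"
proof -
  have "((\<lambda>s. exp (k * s)) has_vector_derivative k * exp (k * s)) (at s within {0..t})" for s
    by (auto simp flip: has_real_derivative_iff_has_vector_derivative intro!: derivative_eq_intros)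
  then show ?thesis
    using fundamental_theorem_of_calculus[OF assms, of "\<lambda>s. exp (k * s)" "\<lambda>s. k * exp (k * s)"] by simp
qed

lemma locally_lipschitz_imp_continuous_on:
  fixes F :: "'b::real_normed_vector \<Rightarrow> 'c::real_normed_vector"
  assumes lip: "\<And>R. \<exists>L. \<forall>x y. norm x \<le> R \<longrightarrow> norm y \<le> R \<longrightarrow> norm (F x - F y) \<le> L * norm (x - y)"
  shows "continuous_on X F"
proof (rule continuous_on_subset[of UNIV], rule continuous_at_imp_continuous_on, rule ballI)
  fix x
  obtain L where L: "\<And>y. norm y \<le> norm x + 1 \<Longrightarrow> norm (F y - F x) \<le> L * norm (y - x)"
    using lip[of "norm x + 1"] by (metis less_add_one less_imp_le)
  have ev: "\<forall>\<^sub>F y in at x. norm (F y - F x) \<le> L * norm (y - x)"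
    unfolding eventually_at
  proof (intro exI[of _ 1] conjI ballI impI)
    fix y assume "y \<noteq> x \<and> dist y x < 1"
    then have "norm y \<le> norm x + 1"
      using norm_triangle_ineq[of x "y - x"] by (simp add: dist_norm)
    then show "norm (F y - F x) \<le> L * norm (y - x)" by (rule L)
  qed simp
  have "((\<lambda>y. L * norm (y - x)) \<longlongrightarrow> L * norm (x - x)) (at x)"
    by (intro tendsto_intros)
  then have "((\<lambda>y. F y - F x) \<longlongrightarrow> 0) (at x)"
    by (intro Lim_null_comparison[OF ev]) simp
  then show "isCont F x" unfolding isCont_def by (rule Lim_null[THEN iffD2])
qed simp

text \<open>Linear growth confines all Picard iterates on [0,T] to one ball, where a single
  Lipschitz constant is valid; a weighted estimate then gives convergence on all of [0,T] at once,
  without continuing local solutions.\<close>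

theorem ode_global_existence:
  fixes F :: "'b::banach \<Rightarrow> 'b"
  assumes lip: "\<And>R. \<exists>L. \<forall>x y. norm x \<le> R \<longrightarrow> norm y \<le> R \<longrightarrow> norm (F x - F y) \<le> L * norm (x - y)"
    and growth: "\<And>x. norm (F x) \<le> C * (1 + norm x)" and C: "0 < C"
  obtains z where "z 0 = z0" "\<And>t. 0 \<le> t \<Longrightarrow> (z has_vector_derivative F (z t)) (at t within {0..})"
proof -
  have contF: "continuous_on X F" for X
    by (rule locally_lipschitz_imp_continuous_on[OF lip])
  define Z where "Z = rec_nat (\<lambda>t. z0) (\<lambda>n Zn (t::real). z0 + integral {0..t} (\<lambda>s. F (Zn s)))"
  have Z0: "Z 0 t = z0" and ZS: "Z (Suc n) t = z0 + integral {0..t} (\<lambda>s. F (Z n s))" for n t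
    by (auto simp: Z_def)
  have contZ: "continuous_on {0..T} (Z n)" for n T
  proof (induction n)
    case 0 then show ?case by (simp add: Z0[abs_def])
  next
    case (Suc n)
    have "continuous_on {0..T} (\<lambda>s. F (Z n s))"
      by (rule continuous_on_compose2[OF contF[of UNIV] Suc]) auto
    then show ?case unfolding ZS[abs_def]
      by (intro continuous_intros indefinite_integral_continuous_1 integrable_continuous_real)
  qed
  have contFZ: "continuous_on {0..T} (\<lambda>s. F (Z n s))" for n T
    by (rule continuous_on_compose2[OF contF[of UNIV] contZ]) auto
  note int = integrable_continuous_real[OF contFZ]
  \<comment> \<open>The solution of w' = C w with w(0) = 1 + norm z0. It reproduces itself under the
    Picard step with the growth bound, so it dominates every iterate.\<close>
  define w where "w t = (1 + norm z0) * exp (C * t)" for t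
  have bound: "1 + norm (Z n t) \<le> w t" if "0 \<le> t" for n t
    using that
  proof (induction n arbitrary: t)
    case 0
    have "1 \<le> exp (C * t)" using C 0 by simp
    then have "(1 + norm z0) * 1 \<le> (1 + norm z0) * exp (C * t)"
      by (intro mult_left_mono) auto
    then show ?case by (simp add: w_def Z0)
  next
    case (Suc n)
    have "norm (integral {0..t} (\<lambda>s. F (Z n s))) \<le> integral {0..t} (\<lambda>s. (1 + norm z0) * (C * exp (C * s)))"
    proof (rule integral_norm_bound_integral[OF int])
      show "norm (F (Z n s)) \<le> (1 + norm z0) * (C * exp (C * s))" if "s \<in> {0..t}" for s
        using order_trans[OF growth mult_left_mono[OF Suc.IH[of s], of C]] that C
        by (simp add: w_def mult_ac)
    qed (intro integrable_continuous_real continuous_intros)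
    also have "\<dots> = (1 + norm z0) * (exp (C * t) - 1)"
      by (rule integral_unique) (intro has_integral_mult_right has_integral_exp_mult Suc.prems)
    finally show ?case
      unfolding ZS w_def using norm_triangle_ineq[of z0 "integral {0..t} (\<lambda>s. F (Z n s))"]
      by (simp add: algebra_simps)
  qed
  define z where "z t = z0 + (\<Sum>n. Z (Suc n) t - Z n t)" for t
  have local: "uniform_limit {0..T} Z z sequentially" if T: "0 \<le> T" for T
  proof -
    obtain L0 where L0: "\<And>x y. norm x \<le> w T \<Longrightarrow> norm y \<le> w T \<Longrightarrow> norm (F x - F y) \<le> L0 * norm (x - y)"
      using lip by blast
    define L where "L = max L0 1"
    have L: "0 < L" by (simp add: L_def)
    have LF: "norm (F x - F y) \<le> L * norm (x - y)" if "norm x \<le> w T" "norm y \<le> w T" for x y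
      using order_trans[OF L0[OF that] mult_right_mono[of L0 L "norm (x - y)"]] by (auto simp: L_def)
    have wmono: "w s \<le> w T" if "s \<le> T" for s using that C by (auto simp: w_def intro!: mult_left_mono)
    have ZR: "norm (Z n s) \<le> w T" if "s \<in> {0..T}" for n s
      using bound[of s n] wmono[of s] that by auto
    define D where "D = T * (C * w T)"
    have w0: "0 \<le> w T" by (simp add: w_def)
    have D: "0 \<le> D" using T C w0 by (auto simp: D_def)
    \<comment> \<open>The weight exp (2 L t) turns each Picard step into a contraction by 1/2, since
      L exp (2 L s) integrates to less than exp (2 L t) / 2. \<open>D\<close> bounds the first
      increment, whose norm is t times that of F z0.\<close>
    have diff: "norm (Z (Suc n) t - Z n t) \<le> D * (1/2)^n * exp (2 * L * t)" if "t \<in> {0..T}" for n t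
      using that
    proof (induction n arbitrary: t)
      case 0
      have "norm (Z (Suc 0) t - Z 0 t) = norm (integral {0..t} (\<lambda>s. F z0))"
        by (simp add: ZS Z0)
      also have "\<dots> = t * norm (F z0)" using 0 by simp
      also have "\<dots> \<le> T * (C * w T)"
        using 0 growth[of z0] C order_trans[OF bound[of 0 0] wmono[of 0]] T
        by (intro mult_mono) (auto simp: Z0 intro: order_trans mult_left_mono)
      also have "\<dots> \<le> D * exp (2 * L * t)"
        using D L 0 mult_left_mono[of 1 "exp (2 * L * t)" D] by (simp add: D_def)
      finally show ?case by simp
    next
      case (Suc n)
      have "Z (Suc (Suc n)) t - Z (Suc n) t = integral {0..t} (\<lambda>s. F (Z (Suc n) s) - F (Z n s))"
        unfolding ZS[of _ t] by (simp add: integral_diff[OF int int])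
      also have "norm \<dots> \<le> integral {0..t} (\<lambda>s. D * (1/2)^Suc n * (2 * L * exp (2 * L * s)))"
      proof (rule integral_norm_bound_integral)
        show "norm (F (Z (Suc n) s) - F (Z n s)) \<le> D * (1/2)^Suc n * (2 * L * exp (2 * L * s))"
          if "s \<in> {0..t}" for s
        proof -
          have s: "s \<in> {0..T}" using that Suc.prems by auto
          show ?thesis
            using order_trans[OF LF[OF ZR[OF s] ZR[OF s]] mult_left_mono[OF Suc.IH[OF s], of L]] L
            by (simp add: mult_ac)
        qed
      qed (intro integrable_diff int integrable_continuous_real continuous_intros)+
      also have "\<dots> = D * (1/2)^Suc n * (exp (2 * L * t) - 1)"
        by (rule integral_unique) (intro has_integral_mult_right has_integral_exp_mult, use Suc.prems in auto)
      also have "\<dots> \<le> D * (1/2)^Suc n * exp (2 * L * t)"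
        using D by (intro mult_left_mono) auto
      finally show ?case .
    qed
    have "uniform_limit {0..T} (\<lambda>n t. \<Sum>i<n. Z (Suc i) t - Z i t) (\<lambda>t. \<Sum>n. Z (Suc n) t - Z n t) sequentially"
    proof (rule Weierstrass_m_test)
      show "norm (Z (Suc n) t - Z n t) \<le> D * (1/2)^n * exp (2 * L * T)" if "t \<in> {0..T}" for n t
        using order_trans[OF diff[OF that]] that D L by (simp add: mult_left_mono)
      show "summable (\<lambda>n. D * (1/2)^n * exp (2 * L * T))"
        by (intro summable_mult summable_mult2 summable_geometric) simp
    qed
    then have "uniform_limit {0..T} (\<lambda>n t. z0 + (\<Sum>i<n. Z (Suc i) t - Z i t)) z sequentially"
      unfolding z_def by (intro uniform_limit_intros)
    moreover have "z0 + (\<Sum>i<n. Z (Suc i) t - Z i t) = Z n t" for n t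
      using sum_lessThan_telescope[of "\<lambda>i. Z i t" n] by (simp add: Z0)
    ultimately show ?thesis by simp
  qed
  have lim: "(\<lambda>n. Z n t) \<longlonglongrightarrow> z t" if "0 \<le> t" for t
    using tendsto_uniform_limitI[OF local[OF that], of t] that by simp
  have contz: "continuous_on {0..T} z" for T
  proof (cases "0 \<le> T")
    case True
    show ?thesis
      by (rule uniform_limit_theorem[OF _ local[OF True]]) (auto simp: contZ)
  qed auto
  have contFz: "continuous_on {0..T} (\<lambda>s. F (z s))" for T
    by (rule continuous_on_compose2[OF contF[of UNIV] contz]) auto
  have eq: "z t = z0 + integral {0..t} (\<lambda>s. F (z s))" if t: "0 \<le> t" for t
  proof -
    obtain L where L: "\<And>x y. norm x \<le> w t \<Longrightarrow> norm y \<le> w t \<Longrightarrow> norm (F x - F y) \<le> L * norm (x - y)"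
      using lip by blast
    have ZR: "norm (Z n s) \<le> w t" if "s \<in> {0..t}" for n s
    proof -
      have "w s \<le> w t" using that C by (auto simp: w_def intro!: mult_left_mono)
      then show ?thesis using bound[of s n] that by auto
    qed
    have zR: "norm (z s) \<le> w t" if "s \<in> {0..t}" for s
      by (rule Lim_bounded[OF tendsto_norm[OF lim]]) (use ZR that in auto)
    have "uniform_limit {0..t} (\<lambda>n s. F (Z n s)) (\<lambda>s. F (z s)) sequentially"
    proof (rule uniform_limitI)
      fix e :: real assume e: "0 < e"
      have "\<forall>\<^sub>F n in sequentially. \<forall>s\<in>{0..t}. dist (Z n s) (z s) < e / (\<bar>L\<bar> + 1)"
        by (rule uniform_limitD[OF local[OF t]]) (use e in auto)
      then show "\<forall>\<^sub>F n in sequentially. \<forall>s\<in>{0..t}. dist (F (Z n s)) (F (z s)) < e"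
      proof (rule eventually_mono, intro ballI)
        fix n s assume n: "\<forall>s\<in>{0..t}. dist (Z n s) (z s) < e / (\<bar>L\<bar> + 1)" and s: "s \<in> {0..t}"
        have "dist (F (Z n s)) (F (z s)) \<le> (\<bar>L\<bar> + 1) * dist (Z n s) (z s)"
          unfolding dist_norm using order_trans[OF L[OF ZR[OF s] zR[OF s]] mult_right_mono[of L "\<bar>L\<bar> + 1"]] by auto
        also have "\<dots> < e" using n s by (auto simp: field_simps add_pos_nonneg)
        finally show "dist (F (Z n s)) (F (z s)) < e" .
      qed
    qed
    then obtain I J where I: "\<And>n. ((\<lambda>s. F (Z n s)) has_integral I n) {0..t}"
      and J: "((\<lambda>s. F (z s)) has_integral J) {0..t}" and IJ: "I \<longlonglongrightarrow> J"
      by (rule uniform_limit_integral[OF _ contFZ]) auto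
    have "(\<lambda>n. z0 + I n) \<longlonglongrightarrow> z0 + J" by (intro tendsto_intros IJ)
    moreover have "z0 + I n = Z (Suc n) t" for n using integral_unique[OF I[of n]] by (simp add: ZS)
    ultimately have "(\<lambda>n. Z (Suc n) t) \<longlonglongrightarrow> z0 + integral {0..t} (\<lambda>s. F (z s))"
      using J by (simp add: integral_unique)
    then show ?thesis using LIMSEQ_unique LIMSEQ_Suc[OF lim[OF t]] by blast
  qed
  show ?thesis
  proof
    show "z 0 = z0" using eq[of 0] by simp
    fix t :: real assume t: "0 \<le> t"
    \<comment> \<open>The indefinite integral is differentiated within a compact interval; near t
      the sets {0..t+1} and {0..} coincide.\<close>
    have "((\<lambda>u. z0 + integral {0..u} (\<lambda>s. F (z s))) has_vector_derivative 0 + F (z t)) (at t within {0..t+1})"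
      by (intro derivative_intros integral_has_vector_derivative[OF contFz]) (use t in auto)
    then have "((\<lambda>u. z0 + integral {0..u} (\<lambda>s. F (z s))) has_vector_derivative F (z t)) (at t within {0..})"
      using at_within_nhd[of t "{..<t+1}" "{0..t+1}" "{0..}"] t by (force simp: set_eq_iff)
    then show "(z has_vector_derivative F (z t)) (at t within {0..})"
      by (rule has_vector_derivative_transform[rotated 2]) (use t eq in auto)
  qed
qed

text \<open>\<open>vector_derivative\<close> is a choice, determined because t is a limit point of
  {0..}; at t = 0 the points to the right suffice.\<close>

lemma vector_derivative_within_Ici:
  fixes f :: "real \<Rightarrow> 'b::real_normed_vector"
  assumes "(f has_vector_derivative D) (at t within {0..})" "0 \<le> t"
  shows "vector_derivative f (at t within {0..}) = D"
proof (rule vector_derivative_within[OF _ assms(1)])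
  have "t islimpt {t..t + 1}" by (simp add: islimpt_Icc)
  then have "t islimpt {0..}" by (rule islimpt_subset) (use assms(2) in auto)
  then show "at t within {0..} \<noteq> bot" by (simp add: trivial_limit_within)
qed

text \<open>One-sided derivatives are unique, so the derivative quantified in \<open>C1\<close> may
  be taken to be \<open>vector_derivative\<close>, the form in which the equations are
  stated.\<close>

lemma C1_Ici_iff:
  fixes f :: "real \<Rightarrow> 'b::real_normed_vector"
  shows "f \<in> C1 {0..} X \<longleftrightarrow> f \<in> {0..} \<rightarrow>\<^sub>E X \<and>
    (\<forall>t\<ge>0. (f has_vector_derivative vector_derivative f (at t within {0..})) (at t within {0..})) \<and>
    continuous_on {0..} (\<lambda>t. vector_derivative f (at t within {0..}))" (is "?l \<longleftrightarrow> ?r")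
proof
  assume ?l
  then obtain f' where f: "f \<in> {0..} \<rightarrow>\<^sub>E X" and f': "\<And>t. t \<ge> 0 \<Longrightarrow> (f has_vector_derivative f' t) (at t within {0..})"
    "continuous_on {0..} f'" unfolding C1_def by auto
  have eq: "vector_derivative f (at t within {0..}) = f' t" if "t \<ge> 0" for t
    by (rule vector_derivative_within_Ici[OF f'(1)]) (use that in auto)
  have "continuous_on {0..} (\<lambda>t. vector_derivative f (at t within {0..}))"
    using f'(2) by (rule continuous_on_eq) (simp add: eq)
  then show ?r using f f' by (auto simp: eq)
qed (auto simp: C1_def)

theorem ode_ex1_C1:
  fixes F :: "'b::banach \<Rightarrow> 'b"
  assumes lip: "\<And>R. \<exists>L. \<forall>x y. norm x \<le> R \<longrightarrow> norm y \<le> R \<longrightarrow> norm (F x - F y) \<le> L * norm (x - y)"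
    and growth: "\<And>x. norm (F x) \<le> C * (1 + norm x)" and C: "0 < C"
  shows "\<exists>!Z. Z \<in> C1 {0..} UNIV \<and> Z 0 = z0 \<and>
    (\<forall>t\<ge>0. vector_derivative Z (at t within {0..}) = F (Z t))"
proof (rule ex_ex1I)
  obtain z where z0: "z 0 = z0" and z: "\<And>t. 0 \<le> t \<Longrightarrow> (z has_vector_derivative F (z t)) (at t within {0..})"
    using ode_global_existence[OF assms] by blast
  define Z where "Z = restrict z {0..}"
  have Z: "(Z has_vector_derivative F (Z t)) (at t within {0..})" if "0 \<le> t" for t
    using has_vector_derivative_transform[of t "{0..}" Z z "F (z t)"] z[OF that] that by (simp add: Z_def)
  have "continuous_on {0..} Z" by (rule continuous_on_vector_derivative) (use Z in auto)
  then have "continuous_on {0..} (\<lambda>t. F (Z t))"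
    by (rule continuous_on_compose2[OF locally_lipschitz_imp_continuous_on[OF lip, of UNIV]]) auto
  then have "Z \<in> C1 {0..} UNIV"
    using Z by (auto simp: C1_def Z_def intro!: exI[of _ "\<lambda>t. F (Z t)"])
  then show "\<exists>Z. Z \<in> C1 {0..} UNIV \<and> Z 0 = z0 \<and> (\<forall>t\<ge>0. vector_derivative Z (at t within {0..}) = F (Z t))"
    using vector_derivative_within_Ici[OF Z] z0 by (intro exI[of _ Z]) (auto simp: Z_def)
next
  fix Z Y
  assume Z: "Z \<in> C1 {0..} UNIV \<and> Z 0 = z0 \<and> (\<forall>t\<ge>0. vector_derivative Z (at t within {0..}) = F (Z t))"
    and Y: "Y \<in> C1 {0..} UNIV \<and> Y 0 = z0 \<and> (\<forall>t\<ge>0. vector_derivative Y (at t within {0..}) = F (Y t))"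
  have "Z T = Y T" if T: "0 \<le> T" for T
  proof -
    have der: "(z has_vector_derivative F (z t)) (at t within {0..T})"
      if "z \<in> {Z, Y}" "t \<in> {0..T}" for z t
    proof -
      have "(z has_vector_derivative F (z t)) (at t within {0..})"
        using that Z Y by (fastforce simp: C1_Ici_iff)
      then show ?thesis by (rule has_vector_derivative_within_subset) auto
    qed
    have "continuous_on {0..T} z" if "z \<in> {Z, Y}" for z
      by (rule continuous_on_vector_derivative) (use der[OF that] in blast)
    then have "compact (Z ` {0..T})" "compact (Y ` {0..T})"
      by (auto intro: compact_continuous_image)
    then have "bounded (Z ` {0..T} \<union> Y ` {0..T})" by (simp add: compact_imp_bounded)
    then obtain R where R: "\<And>t. t \<in> {0..T} \<Longrightarrow> norm (Z t) \<le> R \<and> norm (Y t) \<le> R"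
      unfolding bounded_iff by blast
    obtain L where L: "\<And>x y. norm x \<le> R \<Longrightarrow> norm y \<le> R \<Longrightarrow> norm (F x - F y) \<le> L * norm (x - y)"
      using lip by blast
    have "Z T - Y T = 0"
      by (rule has_vector_derivative_zeroI[where f="\<lambda>t. Z t - Y t" and f'="\<lambda>t. F (Z t) - F (Y t)" and L=L and a=0 and b=T])
         (use der L R Z Y T in \<open>auto intro!: has_vector_derivative_diff\<close>)
    then show ?thesis by simp
  qed
  \<comment> \<open>Curves in \<open>C1\<close> are extensional, so both are
    \<open>undefined\<close> at negative times.\<close>
  moreover have "Z T = Y T" if "\<not> 0 \<le> T" for T
    using that Z Y PiE_arb[of Z "{0..}" "\<lambda>_. UNIV" T] PiE_arb[of Y "{0..}" "\<lambda>_. UNIV" T]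
    by (simp add: C1_def)
  ultimately show "Z = Y" by blast
qed

subsection \<open>The Banach algebra of bounded measurable functions\<close>

lemma apply_Bmeas:
  assumes "f \<in> borel_measurable borel" "\<And>x. \<bar>f x\<bar> \<le> b"
  shows "apply_bmeas (Bmeas f) = f"
  using assms by (intro Bmeas_inverse) (auto simp: bounded_iff intro!: exI[of _ b])

lemma bmeas_eqI: "(\<And>x. apply_bmeas f x = apply_bmeas g x) \<Longrightarrow> f = g"
  by (simp add: apply_bmeas_inject[symmetric] fun_eq_iff)

lemmas apply_bmeas_simps [simp] =
  zero_bmeas.rep_eq plus_bmeas.rep_eq minus_bmeas.rep_eq uminus_bmeas.rep_eq scaleR_bmeas.rep_eq

instance bmeas :: (topological_space) banach
proof
  fix X :: "nat \<Rightarrow> 'a bmeas" assume X: "Cauchy X"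
  have pt: "Cauchy (\<lambda>n. apply_bmeas (X n) x)" for x
  proof (rule metric_CauchyI)
    fix e :: real assume "0 < e"
    then obtain M where M: "\<And>m n. m \<ge> M \<Longrightarrow> n \<ge> M \<Longrightarrow> dist (X m) (X n) < e"
      using metric_CauchyD[OF X] by blast
    have "dist (apply_bmeas (X m) x) (apply_bmeas (X n) x) < e" if "m \<ge> M" "n \<ge> M" for m n
      using le_less_trans[OF abs_apply_bmeas_le_norm[of "X m - X n" x]] M[OF that]
      by (simp add: dist_norm)
    then show "\<exists>M. \<forall>m\<ge>M. \<forall>n\<ge>M. dist (apply_bmeas (X m) x) (apply_bmeas (X n) x) < e" by blast
  qed
  define f where "f x = lim (\<lambda>n. apply_bmeas (X n) x)" for x
  have lim: "(\<lambda>n. apply_bmeas (X n) x) \<longlonglongrightarrow> f x" for x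
    unfolding f_def using Cauchy_convergent[OF pt] by (simp add: convergent_LIMSEQ_iff)
  obtain b where b: "\<And>n. norm (X n) \<le> b"
    using Cauchy_Bseq[OF X] by (auto simp: Bseq_def)
  have "f \<in> borel_measurable borel"
    by (rule borel_measurable_LIMSEQ_real[OF lim]) auto
  moreover have "\<bar>f x\<bar> \<le> b" for x
    by (rule Lim_bounded[OF tendsto_rabs[OF lim]])
       (use order_trans[OF abs_apply_bmeas_le_norm b] in auto)
  ultimately have f: "apply_bmeas (Bmeas f) = f" by (rule apply_Bmeas)
  have "X \<longlonglongrightarrow> Bmeas f"
  proof (rule metric_LIMSEQ_I)
    fix e :: real assume "0 < e"
    then obtain M where M: "\<And>m n. m \<ge> M \<Longrightarrow> n \<ge> M \<Longrightarrow> dist (X m) (X n) < e / 2"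
      using metric_CauchyD[OF X, of "e / 2"] by auto
    have "norm (X n - Bmeas f) \<le> e / 2" if n: "n \<ge> M" for n
    proof (rule norm_bmeas_le)
      fix x
      have "(\<lambda>m. \<bar>apply_bmeas (X n) x - apply_bmeas (X m) x\<bar>) \<longlonglongrightarrow> \<bar>apply_bmeas (X n) x - f x\<bar>"
        by (intro tendsto_intros lim)
      then have "\<bar>apply_bmeas (X n) x - f x\<bar> \<le> e / 2"
      proof (rule Lim_bounded)
        have "\<bar>apply_bmeas (X n) x - apply_bmeas (X m) x\<bar> \<le> e / 2" if "m \<ge> M" for m
          using abs_apply_bmeas_le_norm[of "X n - X m" x] M[OF n that]
          by (simp add: dist_norm)
        then show "\<forall>m\<ge>M. \<bar>apply_bmeas (X n) x - apply_bmeas (X m) x\<bar> \<le> e / 2" by blast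
      qed
      then show "\<bar>apply_bmeas (X n - Bmeas f) x\<bar> \<le> e / 2" by (simp add: f)
    qed
    then have "dist (X n) (Bmeas f) < e" if "n \<ge> M" for n
      using le_less_trans[of "dist (X n) (Bmeas f)" "e / 2" e] \<open>0 < e\<close> that by (simp add: dist_norm)
    then show "\<exists>M. \<forall>n\<ge>M. dist (X n) (Bmeas f) < e" by blast
  qed
  then show "convergent X" by (auto simp: convergent_def)
qed

definition bmult :: "'e::topological_space bmeas \<Rightarrow> 'e bmeas \<Rightarrow> 'e bmeas" where
  "bmult f g = Bmeas (\<lambda>x. apply_bmeas f x * apply_bmeas g x)"

lemma apply_bmult [simp]: "apply_bmeas (bmult f g) x = apply_bmeas f x * apply_bmeas g x"
  unfolding bmult_def
  by (subst apply_Bmeas[of _ "norm f * norm g"])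
     (auto simp: abs_mult intro!: mult_mono abs_apply_bmeas_le_norm)

lemma norm_bmult_le: "norm (bmult f g) \<le> norm f * norm g"
  by (rule norm_bmeas_le) (auto simp: abs_mult intro!: mult_mono abs_apply_bmeas_le_norm)

lemma bounded_bilinear_bmult: "bounded_bilinear bmult"
  by standard
     (auto intro!: bmeas_eqI exI[of _ 1] simp: algebra_simps norm_bmult_le)

definition bexp :: "'e::topological_space bmeas \<Rightarrow> 'e bmeas" where
  "bexp f = Bmeas (\<lambda>x. exp (apply_bmeas f x))"

lemma apply_bexp [simp]: "apply_bmeas (bexp f) x = exp (apply_bmeas f x)"
  unfolding bexp_def
  using abs_apply_bmeas_le_norm[of f] by (subst apply_Bmeas[of _ "exp (norm f)"]) (auto simp: abs_le_iff)

lemma abs_exp_remainder_le: "\<bar>exp h - 1 - h\<bar> \<le> exp \<bar>h\<bar> * h\<^sup>2" for h :: real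
proof -
  obtain t where t: "\<bar>t\<bar> \<le> \<bar>h\<bar>" "exp h = (\<Sum>m<2. h ^ m / fact m) + exp t / fact 2 * h ^ 2"
    using Maclaurin_exp_le[of h 2] by blast
  have "\<bar>exp h - 1 - h\<bar> = exp t / 2 * h\<^sup>2"
    unfolding t(2) by (simp add: numeral_2_eq_2)
  also have "\<dots> \<le> exp \<bar>h\<bar> * h\<^sup>2"
  proof (rule mult_right_mono)
    have "exp t \<le> exp \<bar>h\<bar>" using t(1) by simp
    then show "exp t / 2 \<le> exp \<bar>h\<bar>" using exp_gt_zero[of t] by linarith
  qed simp
  finally show ?thesis .
qed

text \<open>Serves to differentiate densities e^W along a sup-norm curve W. The remainder is
  pointwise e^f (e^h - 1 - h), which is quadratic in the norm of h, uniformly in the point.\<close>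

lemma has_derivative_bexp: "(bexp has_derivative bmult (bexp f)) (at f)"
  unfolding has_derivative_at
proof
  show "bounded_linear (bmult (bexp f))"
    by (rule bounded_bilinear.bounded_linear_right[OF bounded_bilinear_bmult])
  have *: "norm (bexp (f + h) - bexp f - bmult (bexp f) h) \<le> exp (norm f + norm h) * (norm h)\<^sup>2" for h
  proof (rule norm_bmeas_le)
    fix x
    let ?f = "apply_bmeas f x" and ?h = "apply_bmeas h x"
    have fh: "\<bar>?f\<bar> \<le> norm f" "\<bar>?h\<bar> \<le> norm h" by (rule abs_apply_bmeas_le_norm)+
    have "apply_bmeas (bexp (f + h) - bexp f - bmult (bexp f) h) x = exp ?f * (exp ?h - 1 - ?h)"
      by (simp add: exp_add right_diff_distrib)
    then have "\<bar>apply_bmeas (bexp (f + h) - bexp f - bmult (bexp f) h) x\<bar> = exp ?f * \<bar>exp ?h - 1 - ?h\<bar>"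
      by (simp only: abs_mult) simp
    also have "\<dots> \<le> exp ?f * (exp \<bar>?h\<bar> * ?h\<^sup>2)"
      by (intro mult_left_mono abs_exp_remainder_le) simp
    also have "\<dots> = exp (?f + \<bar>?h\<bar>) * \<bar>?h\<bar>\<^sup>2" by (simp add: exp_add)
    also have "\<dots> \<le> exp (norm f + norm h) * (norm h)\<^sup>2"
      using fh by (intro mult_mono power_mono) auto
    finally show "\<bar>apply_bmeas (bexp (f + h) - bexp f - bmult (bexp f) h) x\<bar>
        \<le> exp (norm f + norm h) * (norm h)\<^sup>2" .
  qed
  show "(\<lambda>h. norm (bexp (f + h) - bexp f - bmult (bexp f) h) / norm h) \<midarrow>0\<rightarrow> 0"
  proof (rule Lim_null_comparison)
    show "\<forall>\<^sub>F h in at 0. norm (norm (bexp (f + h) - bexp f - bmult (bexp f) h) / norm h)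
        \<le> exp (norm f + norm h) * norm h"
      using * by (intro always_eventually) (auto simp: divide_simps power2_eq_square mult_ac)
    have "((\<lambda>h::'a bmeas. exp (norm f + norm h) * norm h) \<longlongrightarrow> exp (norm f + norm (0::'a bmeas)) * norm (0::'a bmeas)) (at 0)"
      by (intro tendsto_intros)
    then show "((\<lambda>h::'a bmeas. exp (norm f + norm h) * norm h) \<longlongrightarrow> 0) (at 0)" by simp
  qed
qed

lemma has_vector_derivative_bexp:
  assumes "(Z has_vector_derivative D) (at t within S)"
  shows "((\<lambda>t. bexp (Z t)) has_vector_derivative bmult (bexp (Z t)) D) (at t within S)"
proof -
  have "((\<lambda>t. bexp (Z t)) has_derivative (\<lambda>h. bmult (bexp (Z t)) (h *\<^sub>R D))) (at t within S)"
    by (rule has_derivative_compose[OF assms[unfolded has_vector_derivative_def] has_derivative_bexp])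
  then show ?thesis
    by (simp add: has_vector_derivative_def bounded_bilinear.scaleR_right[OF bounded_bilinear_bmult])
qed

lemma continuous_on_bexp: "continuous_on S Z \<Longrightarrow> continuous_on S (\<lambda>t. bexp (Z t))"
  by (rule continuous_on_compose2[of UNIV bexp])
     (auto intro!: continuous_at_imp_continuous_on has_derivative_continuous has_derivative_bexp)

subsection \<open>Kernels with a bounded density\<close>

lemma apply_bkernel_simps [simp]:
  "apply_bkernel (k + l) s B = apply_bkernel k s B + apply_bkernel l s B"
  "apply_bkernel (r *\<^sub>R k) s B = r * apply_bkernel k s B"
  "apply_bkernel (- k) s B = - apply_bkernel k s B"
  "apply_bkernel (k - l) s B = apply_bkernel k s B - apply_bkernel l s B"
  "apply_bkernel 0 s B = 0"
  by (simp_all only: plus_bkernel.rep_eq scaleR_bkernel.rep_eq uminus_bkernel_def minus_bkernel_def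
      zero_bkernel.rep_eq mult_minus1 diff_conv_add_uminus)

lemma apply_bkernel_notin: "B \<notin> sets borel \<Longrightarrow> apply_bkernel k s B = 0"
  using apply_bkernel[of k] by auto

lemma bkernel_eqI:
  assumes "\<And>s B. B \<in> sets borel \<Longrightarrow> apply_bkernel k s B = apply_bkernel l s B"
  shows "k = l"
  unfolding apply_bkernel_inject[symmetric]
proof (intro ext)
  show "apply_bkernel k s B = apply_bkernel l s B" for s B
    by (cases "B \<in> sets borel") (auto simp: assms apply_bkernel_notin)
qed

lemma total_variation_le_norm: "total_variation (apply_bkernel k s) \<le> ennreal (norm k)"
proof -
  have "(SUP s. total_variation (apply_bkernel k s)) < \<infinity>" using apply_bkernel[of k] by auto
  then have "ennreal (norm k) = (SUP s. total_variation (apply_bkernel k s))"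
    by (simp add: norm_bkernel.rep_eq)
  then show ?thesis by (auto intro: SUP_upper)
qed

lemma norm_bkernel_le:
  assumes "\<And>s. total_variation (apply_bkernel k s) \<le> ennreal C" "0 \<le> C"
  shows "norm k \<le> C"
proof -
  have "(SUP s. total_variation (apply_bkernel k s)) \<le> ennreal C" using assms by (auto intro: SUP_least)
  then show ?thesis unfolding norm_bkernel.rep_eq
    by (intro enn2real_leI assms)
qed

lemma abs_apply_bkernel_le_norm: "\<bar>apply_bkernel k s B\<bar> \<le> norm k"
proof (cases "B \<in> sets borel")
  case True
  have "ennreal \<bar>apply_bkernel k s B\<bar> \<le> total_variation (apply_bkernel k s)"
    using True apply_bkernel[of k] by (intro abs_le_total_variation) (auto simp: signed_measure_def)
  then have "ennreal \<bar>apply_bkernel k s B\<bar> \<le> ennreal (norm k)"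
    using total_variation_le_norm order_trans by blast
  then show ?thesis by (subst (asm) ennreal_le_iff) auto
qed (simp add: apply_bkernel_notin)

lemma bounded_linear_apply_bkernel: "bounded_linear (\<lambda>k. apply_bkernel k s B)"
  by (rule bounded_linear_intro[where K=1]) (auto simp: abs_apply_bkernel_le_norm)

locale action_space = prob_space \<mu> for \<mu> :: "'a::polish_space measure" +
  assumes sets_mu [measurable_cong]: "sets \<mu> = sets borel"
begin

lemma space_mu [simp]: "space \<mu> = UNIV"
  using sets_eq_imp_space_eq[OF sets_mu] by simp

lemma measurable_section [measurable]:
  fixes g :: "('s::polish_space \<times> 'a) bmeas"
  shows "(\<lambda>a. apply_bmeas g (s, a)) \<in> borel_measurable \<mu>"
proof -
  have [measurable]: "apply_bmeas g \<in> borel_measurable (borel \<Otimes>\<^sub>M borel)"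
    unfolding borel_prod by simp
  show ?thesis by measurable
qed

lemma integrable_section [simp, intro]:
  fixes g :: "('s::polish_space \<times> 'a) bmeas"
  shows "integrable \<mu> (\<lambda>a. apply_bmeas g (s, a))"
  by (rule integrable_const_bound[where B="norm g"]) (auto simp: abs_apply_bmeas_le_norm)

lemma integrable_section_indicator [simp, intro]:
  fixes g :: "('s::polish_space \<times> 'a) bmeas"
  shows "B \<in> sets borel \<Longrightarrow> integrable \<mu> (\<lambda>a. indicator B a * apply_bmeas g (s, a))"
  by (rule integrable_const_bound[where B="norm g"])
     (auto simp: abs_apply_bmeas_le_norm indicator_def)

lemma measurable_integral_section:
  fixes g :: "'s::polish_space \<times> 'a \<Rightarrow> real"
  assumes "g \<in> borel_measurable borel"
  shows "(\<lambda>s. \<integral>a. g (s, a) \<partial>\<mu>) \<in> borel_measurable borel"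
proof -
  have [measurable]: "g \<in> borel_measurable (borel \<Otimes>\<^sub>M borel)"
    unfolding borel_prod by fact
  show ?thesis by measurable
qed

lemma abs_integral_section_le:
  fixes g :: "('s::polish_space \<times> 'a) bmeas"
  shows "\<bar>\<integral>a. apply_bmeas g (s, a) \<partial>\<mu>\<bar> \<le> norm g"
proof -
  have "\<bar>\<integral>a. apply_bmeas g (s, a) \<partial>\<mu>\<bar> \<le> (\<integral>a. \<bar>apply_bmeas g (s, a)\<bar> \<partial>\<mu>)"
    by (rule integral_abs_bound)
  also have "\<dots> \<le> norm g"
    by (rule integral_le_const) (auto intro: integrable_abs abs_apply_bmeas_le_norm)
  finally show ?thesis .
qed

text \<open>The value 0 off the Borel sets is what the type of kernels demands. The map is linear
  and continuous, so derivatives of densities pass to kernels; the kernel norm only sees L1 norms of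
  the sections, uniformly in the state.\<close>

definition kernel_of :: "('s::polish_space \<times> 'a) bmeas \<Rightarrow> ('s, 'a) bkernel" where
  "kernel_of g = Bkernel (\<lambda>s B. if B \<in> sets borel then \<integral>a. indicator B a * apply_bmeas g (s, a) \<partial>\<mu> else 0)"

lemma sum_abs_integral_le:
  fixes g :: "'a \<Rightarrow> real"
  assumes g: "integrable \<mu> g" and \<B>: "finite \<B>" "\<B> \<subseteq> sets borel" "partition_on UNIV \<B>"
  shows "(\<Sum>B\<in>\<B>. \<bar>\<integral>a. indicator B a * g a \<partial>\<mu>\<bar>) \<le> (\<integral>a. \<bar>g a\<bar> \<partial>\<mu>)"
proof -
  have int: "integrable \<mu> (\<lambda>a. indicator B a * \<bar>g a\<bar>)" if "B \<in> \<B>" for B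
    using integrable_mult_indicator[of B \<mu> "\<lambda>a. \<bar>g a\<bar>"] g that \<B> by (auto simp: sets_mu intro: integrable_abs)
  have "(\<Sum>B\<in>\<B>. \<bar>\<integral>a. indicator B a * g a \<partial>\<mu>\<bar>) \<le> (\<Sum>B\<in>\<B>. \<integral>a. indicator B a * \<bar>g a\<bar> \<partial>\<mu>)"
  proof (rule sum_mono)
    fix B
    show "\<bar>\<integral>a. indicator B a * g a \<partial>\<mu>\<bar> \<le> (\<integral>a. indicator B a * \<bar>g a\<bar> \<partial>\<mu>)"
      using integral_abs_bound[of \<mu> "\<lambda>a. indicator B a * g a"] by (simp add: abs_mult)
  qed
  also have "\<dots> = (\<integral>a. (\<Sum>B\<in>\<B>. indicator B a * \<bar>g a\<bar>) \<partial>\<mu>)"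
    by (rule Bochner_Integration.integral_sum[symmetric]) (rule int)
  also have "\<dots> = (\<integral>a. \<bar>g a\<bar> \<partial>\<mu>)"
  proof (rule Bochner_Integration.integral_cong[OF refl])
    fix a
    obtain B where B: "B \<in> \<B>" "a \<in> B" using \<B>(3) by (auto simp: partition_on_def)
    have "(\<Sum>B\<in>\<B>. indicator B a * \<bar>g a\<bar>) = (\<Sum>B\<in>{B}. indicator B a * \<bar>g a\<bar>)"
    proof (rule sum.mono_neutral_right[OF \<B>(1)])
      show "\<forall>B'\<in>\<B> - {B}. indicator B' a * \<bar>g a\<bar> = 0"
        using \<B>(3) B by (auto simp: partition_on_def disjoint_def indicator_def)
    qed (use B in auto)
    then show "(\<Sum>B\<in>\<B>. indicator B a * \<bar>g a\<bar>) = \<bar>g a\<bar>" using B by simp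
  qed
  finally show ?thesis .
qed

lemma total_variation_integral_le:
  assumes "integrable \<mu> g" and "\<And>B. B \<in> sets borel \<Longrightarrow> m B = (\<integral>a. indicator B a * g a \<partial>\<mu>)"
  shows "total_variation m \<le> ennreal (\<integral>a. \<bar>g a\<bar> \<partial>\<mu>)"
  unfolding total_variation_def
proof (rule SUP_least, safe)
  fix \<B> :: "'a set set" assume \<B>: "finite \<B>" "\<B> \<subseteq> sets borel" "partition_on UNIV \<B>"
  have "(\<Sum>B\<in>\<B>. ennreal \<bar>m B\<bar>) = ennreal (\<Sum>B\<in>\<B>. \<bar>\<integral>a. indicator B a * g a \<partial>\<mu>\<bar>)"
    using assms(2) \<B>(2) by (subst sum_ennreal[symmetric]) (auto intro!: sum.cong)
  also have "\<dots> \<le> ennreal (\<integral>a. \<bar>g a\<bar> \<partial>\<mu>)"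
    by (intro ennreal_leI sum_abs_integral_le assms \<B>)
  finally show "(\<Sum>B\<in>\<B>. ennreal \<bar>m B\<bar>) \<le> ennreal (\<integral>a. \<bar>g a\<bar> \<partial>\<mu>)" .
qed

lemma signed_measure_integral:
  assumes g: "integrable \<mu> g" and m: "\<And>B. B \<in> sets borel \<Longrightarrow> m B = (\<integral>a. indicator B a * g a \<partial>\<mu>)"
  shows "signed_measure m"
  unfolding signed_measure_def
proof (intro conjI allI impI)
  show "m {} = 0" by (simp add: m)
  fix B :: "nat \<Rightarrow> 'a set" assume B: "range B \<subseteq> sets borel" "disjoint_family B"
  have [measurable]: "B i \<in> sets borel" "g \<in> borel_measurable \<mu>" for i using B g by auto
  have int: "integrable \<mu> (\<lambda>a. indicator (B i) a * g a)" for i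
    using integrable_mult_indicator[of "B i" \<mu> g] g by (simp add: sets_mu)
  have s: "(\<lambda>i. indicator (B i) a * g a) sums (indicator (\<Union>i. B i) a * g a)" for a
    by (intro sums_mult2 indicator_sums) (use B in \<open>auto simp: disjoint_family_on_def\<close>)
  have "(\<lambda>n. \<integral>a. (\<Sum>i<n. indicator (B i) a * g a) \<partial>\<mu>) \<longlonglongrightarrow> (\<integral>a. indicator (\<Union>i. B i) a * g a \<partial>\<mu>)"
  proof (rule integral_dominated_convergence[where w="\<lambda>a. \<bar>g a\<bar>"])
    show "AE a in \<mu>. (\<lambda>n. \<Sum>i<n. indicator (B i) a * g a) \<longlonglongrightarrow> indicator (\<Union>i. B i) a * g a"
      using s by (simp add: sums_def)
    show "AE a in \<mu>. norm (\<Sum>i<n. indicator (B i) a * g a) \<le> \<bar>g a\<bar>" for n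
    proof (rule AE_I2)
      fix a
      have s1: "(\<lambda>i. indicator (B i) a :: real) sums indicator (\<Union>i. B i) a"
        by (rule indicator_sums) (use B in \<open>auto simp: disjoint_family_on_def\<close>)
      have "(\<Sum>i<n. indicator (B i) a :: real) \<le> indicator (\<Union>i. B i) a"
        using sum_le_suminf[OF sums_summable[OF s1], of "{..<n}"] sums_unique[OF s1] by simp
      also have "\<dots> \<le> 1" by (simp add: indicator_def)
      finally have "\<bar>g a\<bar> * (\<Sum>i<n. indicator (B i) a) \<le> \<bar>g a\<bar> * 1"
        by (intro mult_left_mono) auto
      moreover have "norm (\<Sum>i<n. indicator (B i) a * g a) = \<bar>\<Sum>i<n. indicator (B i) a\<bar> * \<bar>g a\<bar>"
        unfolding sum_distrib_right[symmetric] by (simp only: real_norm_def abs_mult)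
      moreover have "\<bar>\<Sum>i<n. indicator (B i) a :: real\<bar> = (\<Sum>i<n. indicator (B i) a)"
        by (intro abs_of_nonneg sum_nonneg) simp
      ultimately show "norm (\<Sum>i<n. indicator (B i) a * g a) \<le> \<bar>g a\<bar>"
        by (simp only: mult.commute mult_1_right)
    qed
  qed (use g in \<open>auto intro: integrable_abs\<close>)
  then show "(\<lambda>i. m (B i)) sums m (\<Union>i. B i)"
    unfolding sums_def Bochner_Integration.integral_sum[OF int] by (simp add: m)
qed

lemma apply_kernel_of:
  fixes g :: "('s::polish_space \<times> 'a) bmeas"
  assumes "B \<in> sets borel"
  shows "apply_bkernel (kernel_of g) s B = (\<integral>a. indicator B a * apply_bmeas g (s, a) \<partial>\<mu>)"
proof -
  let ?k = "\<lambda>s B. if B \<in> sets borel then \<integral>a. indicator B a * apply_bmeas g (s, a) \<partial>\<mu> else 0"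
  have "signed_measure (?k s)" for s
    by (rule signed_measure_integral[OF integrable_section]) simp
  moreover have "(\<lambda>s. ?k s B) \<in> borel_measurable borel" if B: "B \<in> sets borel" for B
  proof -
    have [measurable]: "apply_bmeas g \<in> borel_measurable (borel \<Otimes>\<^sub>M borel)"
      unfolding borel_prod by simp
    have "(\<lambda>x. indicator B (snd x) * apply_bmeas g x :: real) \<in> borel_measurable (borel \<Otimes>\<^sub>M borel)"
      using B by measurable
    from measurable_integral_section[OF this[unfolded borel_prod]] B show ?thesis by simp
  qed
  moreover
  have "(SUP s. total_variation (?k s)) \<le> ennreal (norm g)"
  proof (rule SUP_least)
    fix s
    have "(\<integral>a. \<bar>apply_bmeas g (s, a)\<bar> \<partial>\<mu>) \<le> norm g"
      by (rule integral_le_const) (auto intro: integrable_abs abs_apply_bmeas_le_norm)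
    then show "total_variation (?k s) \<le> ennreal (norm g)"
      by (intro order_trans[OF total_variation_integral_le[OF integrable_section[of g s]]] ennreal_leI) auto
  qed
  from le_less_trans[OF this] have "(SUP s. total_variation (?k s)) < \<infinity>"
    by simp
  ultimately have "apply_bkernel (kernel_of g) = ?k"
    unfolding kernel_of_def by (intro Bkernel_inverse) auto
  then show ?thesis using assms by simp
qed

lemma norm_kernel_of_le:
  fixes g :: "('s::polish_space \<times> 'a) bmeas"
  assumes "\<And>s. (\<integral>a. \<bar>apply_bmeas g (s, a)\<bar> \<partial>\<mu>) \<le> C" "0 \<le> C"
  shows "norm (kernel_of g) \<le> C"
  by (rule norm_bkernel_le[OF order_trans[OF total_variation_integral_le[OF integrable_section apply_kernel_of]]])
     (use assms in \<open>auto intro: ennreal_leI\<close>)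

text \<open>The Hahn decomposition is explicit here: the partition into {g \<ge> 0} and its
  complement already attains the L1 norm. With \<open>norm_kernel_of_le\<close> this identifies the
  kernel norm as a supremum of L1 norms.\<close>

lemma integral_abs_le_norm_kernel_of:
  fixes g :: "('s::polish_space \<times> 'a) bmeas"
  shows "(\<integral>a. \<bar>apply_bmeas g (s, a)\<bar> \<partial>\<mu>) \<le> norm (kernel_of g)"
proof -
  define B where "B = {a. 0 \<le> apply_bmeas g (s, a)}"
  have "B = {a \<in> space \<mu>. 0 \<le> apply_bmeas g (s, a)}" by (simp add: B_def)
  also have "\<dots> \<in> sets \<mu>" by measurable
  finally have B: "B \<in> sets borel" by (simp add: sets_mu)
  let ?k = "apply_bkernel (kernel_of g) s"
  have "(\<integral>a. \<bar>apply_bmeas g (s, a)\<bar> \<partial>\<mu>) =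
      (\<integral>a. indicator B a * apply_bmeas g (s, a) - indicator (- B) a * apply_bmeas g (s, a) \<partial>\<mu>)"
    by (rule Bochner_Integration.integral_cong) (auto simp: B_def indicator_def)
  also have "\<dots> = ?k B - ?k (- B)"
    using B by (simp add: apply_kernel_of)
  finally have eq: "(\<integral>a. \<bar>apply_bmeas g (s, a)\<bar> \<partial>\<mu>) = ?k B - ?k (- B)" .
  have "ennreal (\<bar>?k B\<bar> + \<bar>?k (- B)\<bar>) \<le> ennreal (norm (kernel_of g))"
  proof -
    \<comment> \<open>\<open>partition_on\<close> forbids empty blocks, so {} is removed in case
      \<open>B\<close> or its complement is empty; its contribution is 0 anyway.\<close>
    let ?P = "{B, - B} - {{}}"
    have k0: "?k {} = 0" by (simp add: apply_kernel_of)
    have "(\<Sum>B\<in>?P. ennreal \<bar>?k B\<bar>) = (\<Sum>B\<in>{B, - B}. ennreal \<bar>?k B\<bar>)"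
      by (rule sum.mono_neutral_left) (auto simp: k0)
    also have "\<dots> = ennreal (\<bar>?k B\<bar> + \<bar>?k (- B)\<bar>)"
      by (subst sum.insert) (auto simp: ennreal_plus)
    finally have "ennreal (\<bar>?k B\<bar> + \<bar>?k (- B)\<bar>) = (\<Sum>B\<in>?P. ennreal \<bar>?k B\<bar>)" ..
    also have "\<dots> \<le> total_variation ?k"
      using B by (intro total_variation_upper) (auto simp: partition_on_def disjoint_def)
    also note total_variation_le_norm
    finally show ?thesis .
  qed
  then have "\<bar>?k B\<bar> + \<bar>?k (- B)\<bar> \<le> norm (kernel_of g)"
    by (subst (asm) ennreal_le_iff) auto
  then show ?thesis unfolding eq by linarith
qed

lemma kernel_of_diff: "kernel_of (g - h) = kernel_of g - kernel_of h"
  by (rule bkernel_eqI) (simp add: apply_kernel_of right_diff_distrib)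

lemma norm_kernel_of_le_norm: "norm (kernel_of g) \<le> norm g"
  by (rule norm_kernel_of_le)
     (auto intro!: integral_le_const integrable_abs abs_apply_bmeas_le_norm)

lemma bounded_linear_kernel_of: "bounded_linear kernel_of"
  by (rule bounded_linear_intro[where K=1])
     (auto intro!: bkernel_eqI simp: apply_kernel_of distrib_left mult.left_commute norm_kernel_of_le_norm)

end

subsection \<open>Normalised log-densities\<close>

lemma measurable_comp_fst_borel:
  fixes f :: "'s::polish_space \<Rightarrow> real"
  assumes "f \<in> borel_measurable borel"
  shows "(\<lambda>x :: 's \<times> 'a::polish_space. f (fst x)) \<in> borel_measurable borel"
  unfolding borel_prod[symmetric] using assms by measurable

definition lift_fst :: "'s::polish_space bmeas \<Rightarrow> ('s \<times> 'a::polish_space) bmeas" where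
  "lift_fst v = Bmeas (\<lambda>x. apply_bmeas v (fst x))"

lemma apply_lift_fst [simp]: "apply_bmeas (lift_fst v) x = apply_bmeas v (fst x)"
  unfolding lift_fst_def
  by (subst apply_Bmeas[of _ "norm v"]) (auto intro: measurable_comp_fst_borel abs_apply_bmeas_le_norm)

lemma norm_lift_fst_le: "norm (lift_fst v) \<le> norm v"
  by (rule norm_bmeas_le) (auto intro: abs_apply_bmeas_le_norm)

lemma lift_fst_diff: "lift_fst (v - w) = lift_fst v - lift_fst w"
  by (rule bmeas_eqI) simp

context action_space
begin

lemma prob_UNIV [simp]: "prob UNIV = 1"
  using prob_space by simp

text \<open>For such W the function e^W is itself the policy density, so partition functions
  disappear from the formulas.\<close>

definition normalised :: "('s::polish_space \<times> 'a) bmeas \<Rightarrow> bool" where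
  "normalised W \<longleftrightarrow> (\<forall>s. (\<integral>a. exp (apply_bmeas W (s, a)) \<partial>\<mu>) = 1)"

lemma integrable_exp_section [simp, intro]:
  fixes Z :: "('s::polish_space \<times> 'a) bmeas"
  shows "integrable \<mu> (\<lambda>a. exp (apply_bmeas Z (s, a)))"
  using integrable_section[of "bexp Z" s] by simp

lemma integral_exp_section_mono:
  fixes Z Y :: "('s::polish_space \<times> 'a) bmeas"
  assumes "\<And>a. apply_bmeas Z (s, a) \<le> apply_bmeas Y (s, a) + d"
  shows "(\<integral>a. exp (apply_bmeas Z (s, a)) \<partial>\<mu>) \<le> exp d * (\<integral>a. exp (apply_bmeas Y (s, a)) \<partial>\<mu>)"
proof -
  have "(\<integral>a. exp (apply_bmeas Z (s, a)) \<partial>\<mu>) \<le> (\<integral>a. exp d * exp (apply_bmeas Y (s, a)) \<partial>\<mu>)"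
  proof (rule integral_mono)
    show "exp (apply_bmeas Z (s, a)) \<le> exp d * exp (apply_bmeas Y (s, a))" for a
      using assms[of a] by (simp add: exp_add[symmetric] add.commute)
  qed simp_all
  then show ?thesis by simp
qed

lemma integral_exp_section_pos:
  fixes Z :: "('s::polish_space \<times> 'a) bmeas"
  shows "0 < (\<integral>a. exp (apply_bmeas Z (s, a)) \<partial>\<mu>)"
proof -
  have "0 \<le> apply_bmeas Z (s, a) + norm Z" for a
    using abs_apply_bmeas_le_norm[of Z "(s, a)"] by linarith
  then have "1 \<le> exp (norm Z) * (\<integral>a. exp (apply_bmeas Z (s, a)) \<partial>\<mu>)"
    using integral_exp_section_mono[of 0 s Z "norm Z"] by simp
  then show ?thesis
    by (smt (verit) exp_gt_zero mult_nonneg_nonpos)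
qed

text \<open>From Z \<le> Y + d it follows that the integral of e^Z is at most e^d times that of e^Y;
  take logarithms with d = norm (Z - Y), and exchange the roles of Z and Y.\<close>

lemma ln_integral_exp_section_diff_le:
  fixes Z Y :: "('s::polish_space \<times> 'a) bmeas"
  shows "\<bar>ln (\<integral>a. exp (apply_bmeas Z (s, a)) \<partial>\<mu>) - ln (\<integral>a. exp (apply_bmeas Y (s, a)) \<partial>\<mu>)\<bar> \<le> norm (Z - Y)"
proof -
  have le: "ln (\<integral>a. exp (apply_bmeas Z (s, a)) \<partial>\<mu>) \<le> norm (Z - Y) + ln (\<integral>a. exp (apply_bmeas Y (s, a)) \<partial>\<mu>)"
    for Z Y :: "('s \<times> 'a) bmeas"
  proof -
    have "(\<integral>a. exp (apply_bmeas Z (s, a)) \<partial>\<mu>) \<le> exp (norm (Z - Y)) * (\<integral>a. exp (apply_bmeas Y (s, a)) \<partial>\<mu>)"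
    proof (rule integral_exp_section_mono)
      show "apply_bmeas Z (s, a) \<le> apply_bmeas Y (s, a) + norm (Z - Y)" for a
        using abs_apply_bmeas_le_norm[of "Z - Y" "(s, a)"] by simp
    qed
    then have "ln (\<integral>a. exp (apply_bmeas Z (s, a)) \<partial>\<mu>) \<le> ln (exp (norm (Z - Y)) * (\<integral>a. exp (apply_bmeas Y (s, a)) \<partial>\<mu>))"
      using integral_exp_section_pos[of Z s] by (subst ln_le_cancel_iff) (auto simp: integral_exp_section_pos)
    also have "\<dots> = norm (Z - Y) + ln (\<integral>a. exp (apply_bmeas Y (s, a)) \<partial>\<mu>)"
      using integral_exp_section_pos[of Y s] by (subst ln_mult) auto
    finally show ?thesis .
  qed
  show ?thesis
    using le[of Z Y] le[of Y Z] by (auto simp: abs_le_iff norm_minus_commute)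
qed

text \<open>Constant in the action, but kept as a function of state and action so that normalising
  is a subtraction within one Banach space.\<close>

definition log_partition :: "('s::polish_space \<times> 'a) bmeas \<Rightarrow> ('s \<times> 'a) bmeas" where
  "log_partition Z = Bmeas (\<lambda>x. ln (\<integral>a. exp (apply_bmeas Z (fst x, a)) \<partial>\<mu>))"

lemma apply_log_partition [simp]:
  fixes Z :: "('s::polish_space \<times> 'a) bmeas"
  shows "apply_bmeas (log_partition Z) x = ln (\<integral>a. exp (apply_bmeas Z (fst x, a)) \<partial>\<mu>)"
  unfolding log_partition_def
proof (subst apply_Bmeas[where b="norm Z"])
  show "(\<lambda>x :: 's \<times> 'a. ln (\<integral>a. exp (apply_bmeas Z (fst x, a)) \<partial>\<mu>)) \<in> borel_measurable borel"
    by (rule measurable_comp_fst_borel)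
       (intro borel_measurable_ln measurable_integral_section, measurable)
  show "\<bar>ln (\<integral>a. exp (apply_bmeas Z (fst x, a)) \<partial>\<mu>)\<bar> \<le> norm Z" for x
    using ln_integral_exp_section_diff_le[of Z "fst x" 0] by simp
qed simp

definition normalise :: "('s::polish_space \<times> 'a) bmeas \<Rightarrow> ('s \<times> 'a) bmeas" where
  "normalise Z = Z - log_partition Z"

lemma norm_log_partition_diff_le: "norm (log_partition Z - log_partition Y) \<le> norm (Z - Y)"
  by (rule norm_bmeas_le) (simp add: ln_integral_exp_section_diff_le)

lemma log_partition_0 [simp]: "log_partition 0 = 0"
  by (rule bmeas_eqI) simp

lemma norm_log_partition_le: "norm (log_partition Z) \<le> norm Z"
  using norm_log_partition_diff_le[of Z 0] by simp

lemma norm_normalise_le: "norm (normalise Z) \<le> 2 * norm Z"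
  unfolding normalise_def using norm_triangle_ineq4[of Z "log_partition Z"] norm_log_partition_le[of Z] by linarith

lemma norm_normalise_diff_le: "norm (normalise Z - normalise Y) \<le> 2 * norm (Z - Y)"
proof -
  have "normalise Z - normalise Y = (Z - Y) - (log_partition Z - log_partition Y)"
    by (simp add: normalise_def)
  then show ?thesis
    using norm_triangle_ineq4[of "Z - Y" "log_partition Z - log_partition Y"] norm_log_partition_diff_le[of Z Y]
    by simp
qed

lemma exp_normalise: "exp (apply_bmeas (normalise Z) (s, a)) =
    exp (apply_bmeas Z (s, a)) / (\<integral>a. exp (apply_bmeas Z (s, a)) \<partial>\<mu>)"
  using integral_exp_section_pos[of Z s] by (simp add: normalise_def exp_diff)

lemma normalised_normalise [simp]: "normalised (normalise Z)"
  unfolding normalised_def exp_normalise using integral_exp_section_pos[of Z] by (simp add: less_imp_neq[symmetric])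

lemma softmax_normalise: "softmax \<mu> (normalise Z) = softmax \<mu> Z"
proof -
  have "(\<integral>a. exp (apply_bmeas (normalise Z) (s, a)) \<partial>\<mu>) = 1" for s
    using normalised_normalise[of Z] by (simp add: normalised_def)
  then show ?thesis unfolding softmax_def by (simp add: exp_normalise)
qed

lemma policiesE:
  assumes "\<pi> \<in> policies \<mu>"
  obtains W where "normalised W" "\<pi> = softmax \<mu> W"
proof -
  obtain f where "\<pi> = softmax \<mu> f" using assms by (auto simp: policies_def)
  then show ?thesis using that[of "normalise f"] by (simp add: softmax_normalise)
qed

lemma kernel_measure_normalised:
  assumes "normalised W"
  shows "kernel_measure (softmax \<mu> W) s = density \<mu> (\<lambda>a. ennreal (exp (apply_bmeas W (s, a))))"
  using assms by (simp add: kernel_measure_softmax[OF prob_space_axioms sets_mu] normalised_def)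

lemma softmax_normalised:
  assumes "normalised W"
  shows "softmax \<mu> W = kernel_of (bexp W)"
proof (rule bkernel_eqI)
  fix s and B :: "'a set" assume B [measurable]: "B \<in> sets borel"
  have "apply_bkernel (softmax \<mu> W) s B = measure (density \<mu> (\<lambda>a. ennreal (exp (apply_bmeas W (s, a))))) B"
    using assms by (simp add: apply_softmax[OF prob_space_axioms sets_mu] normalised_def)
  also have "\<dots> = enn2real (\<integral>\<^sup>+a. ennreal (exp (apply_bmeas W (s, a))) * indicator B a \<partial>\<mu>)"
    unfolding measure_def by (subst emeasure_density) auto
  also have "(\<integral>\<^sup>+a. ennreal (exp (apply_bmeas W (s, a))) * indicator B a \<partial>\<mu>) =
      (\<integral>\<^sup>+a. ennreal (indicator B a * apply_bmeas (bexp W) (s, a)) \<partial>\<mu>)"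
    by (intro nn_integral_cong) (auto simp: indicator_def)
  also have "\<dots> = ennreal (\<integral>a. indicator B a * apply_bmeas (bexp W) (s, a) \<partial>\<mu>)"
    by (rule nn_integral_eq_integral) (use integrable_section_indicator[OF B, of "bexp W" s] in auto)
  finally show "apply_bkernel (softmax \<mu> W) s B = apply_bkernel (kernel_of (bexp W)) s B"
    by (simp add: apply_kernel_of)
qed

lemma softmax_in_policies [simp]: "softmax \<mu> W \<in> policies \<mu>"
  by (simp add: policies_def)

lemma KL_normalised:
  assumes "normalised W"
  shows "KL (kernel_measure (softmax \<mu> W) s) \<mu> =
    ereal (\<integral>a. apply_bmeas W (s, a) * exp (apply_bmeas W (s, a)) \<partial>\<mu>)"
proof -
  let ?N = "kernel_measure (softmax \<mu> W) s"
  have "KL ?N \<mu> = ereal (KL_divergence (exp 1) \<mu> ?N)"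
    using KL_softmax_finite[OF prob_space_axioms sets_mu, of W s] by (auto simp: KL_def split: if_splits)
  also have "KL_divergence (exp 1) \<mu> ?N =
      (\<integral>a. exp (apply_bmeas W (s, a)) * log (exp 1) (exp (apply_bmeas W (s, a))) \<partial>\<mu>)"
    unfolding kernel_measure_normalised[OF assms] by (rule KL_density) auto
  finally show ?thesis by (simp add: log_def mult.commute)
qed

lemma policy_density_normalised:
  assumes "normalised W"
  shows "AE a in \<mu>. policy_density \<mu> (softmax \<mu> W) s a = exp (apply_bmeas W (s, a))"
proof -
  have "AE a in \<mu>. ennreal (exp (apply_bmeas W (s, a))) = RN_deriv \<mu> (kernel_measure (softmax \<mu> W) s) a"
    by (rule RN_deriv_unique) (simp_all add: kernel_measure_normalised[OF assms])
  then show ?thesis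
  proof eventually_elim
    case (elim a)
    show ?case unfolding policy_density_def elim[symmetric] by simp
  qed
qed

lemma prob_space_kernel_measure_softmax:
  fixes W :: "('s::polish_space \<times> 'a) bmeas"
  shows "prob_space (kernel_measure (softmax \<mu> W) s)"
  by (rule prob_space_softmax[OF prob_space_axioms sets_mu])

lemma integral_kernel_measure_normalised:
  fixes f :: "'a \<Rightarrow> real"
  assumes "normalised W" "f \<in> borel_measurable borel"
  shows "(\<integral>a. f a \<partial>kernel_measure (softmax \<mu> W) s) = (\<integral>a. exp (apply_bmeas W (s, a)) * f a \<partial>\<mu>)"
  unfolding kernel_measure_normalised[OF assms(1)]
  by (subst integral_density) (use assms(2) in auto)

lemma kernel_of_bexp_nonneg: "0 \<le> apply_bkernel (kernel_of (bexp W)) s B"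
  by (cases "B \<in> sets borel") (auto simp: apply_kernel_of apply_bkernel_notin intro!: integral_nonneg_AE)

end

text \<open>Adding the bound \<open>b\<close> makes \<open>f\<close> nonnegative, so that
  \<open>nn_integral_bind\<close> applies; as all measures involved are probabilities, the shift
  comes out as the same constant \<open>b\<close> on both sides.\<close>

lemma integral_bind_bounded:
  fixes f :: "'b \<Rightarrow> real"
  assumes M: "prob_space M" and N: "N \<in> M \<rightarrow>\<^sub>M prob_algebra B"
    and f [measurable]: "f \<in> borel_measurable B" and b: "\<And>x. \<bar>f x\<bar> \<le> b"
  shows "(\<integral>x. f x \<partial>(M \<bind> N)) = (\<integral>x. \<integral>y. f y \<partial>N x \<partial>M)"
proof -
  have shift: "(\<integral>\<^sup>+x. ennreal (g x + b) \<partial>K) = ennreal ((\<integral>x. g x \<partial>K) + b)"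
    and bnd: "\<bar>\<integral>x. g x \<partial>K\<bar> \<le> b"
    if K: "prob_space K" and g: "g \<in> borel_measurable K" "\<And>x. x \<in> space K \<Longrightarrow> \<bar>g x\<bar> \<le> b"
    for K :: "'c measure" and g :: "'c \<Rightarrow> real"
  proof -
    interpret K: prob_space K by fact
    have int: "integrable K g" by (rule K.integrable_const_bound[where B=b]) (use g in \<open>auto intro: AE_I2\<close>)
    have ge: "0 \<le> g x + b" if "x \<in> space K" for x using g(2)[OF that] by linarith
    have "(\<integral>\<^sup>+x. ennreal (g x + b) \<partial>K) = ennreal (\<integral>x. g x + b \<partial>K)"
      by (rule nn_integral_eq_integral) (use int ge in \<open>auto intro: AE_I2\<close>)
    also have "(\<integral>x. g x + b \<partial>K) = (\<integral>x. g x \<partial>K) + b"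
      using int by (simp add: K.prob_space)
    finally show "(\<integral>\<^sup>+x. ennreal (g x + b) \<partial>K) = ennreal ((\<integral>x. g x \<partial>K) + b)" .
    have "\<bar>\<integral>x. g x \<partial>K\<bar> \<le> (\<integral>x. \<bar>g x\<bar> \<partial>K)" by (rule integral_abs_bound)
    also have "\<dots> \<le> b" by (rule K.integral_le_const) (use int g(2) in \<open>auto intro: AE_I2\<close>)
    finally show "\<bar>\<integral>x. g x \<partial>K\<bar> \<le> b" .
  qed
  have N': "N \<in> M \<rightarrow>\<^sub>M subprob_algebra B" by (rule measurable_prob_algebraD[OF N])
  have sN: "sets (N x) = sets B" "prob_space (N x)" if "x \<in> space M" for x
    using measurable_space[OF N that] by (auto simp: space_prob_algebra)
  have MN: "prob_space (M \<bind> N)"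
    by (rule prob_space.prob_space_bind[OF M _ N']) (use sN(2) in \<open>auto intro: AE_I2\<close>)
  have sMN: "sets (M \<bind> N) = sets B"
    by (rule sets_bind[OF sN(1)]) (use prob_space.not_empty[OF M] in auto)
  have "ennreal ((\<integral>x. f x \<partial>(M \<bind> N)) + b) = (\<integral>\<^sup>+x. ennreal (f x + b) \<partial>(M \<bind> N))"
    by (rule shift(1)[OF MN, symmetric]) (use b in \<open>auto simp: measurable_cong_sets[OF sMN refl]\<close>)
  also have "\<dots> = (\<integral>\<^sup>+x. \<integral>\<^sup>+y. ennreal (f y + b) \<partial>N x \<partial>M)"
    by (rule nn_integral_bind[OF _ N']) simp
  also have "\<dots> = (\<integral>\<^sup>+x. ennreal ((\<integral>y. f y \<partial>N x) + b) \<partial>M)"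
    by (intro nn_integral_cong shift(1) sN(2)) (use b in \<open>auto simp: measurable_cong_sets[OF sN(1) refl]\<close>)
  also have "\<dots> = ennreal ((\<integral>x. \<integral>y. f y \<partial>N x \<partial>M) + b)"
  proof (rule shift(1)[OF M])
    show "(\<lambda>x. \<integral>y. f y \<partial>N x) \<in> borel_measurable M"
      by (rule measurable_compose[OF N' integral_measurable_subprob_algebra[OF f]])
    show "\<bar>\<integral>y. f y \<partial>N x\<bar> \<le> b" if "x \<in> space M" for x
      by (rule bnd[OF sN(2)[OF that]]) (use b in \<open>auto simp: measurable_cong_sets[OF sN(1)[OF that] refl]\<close>)
  qed
  finally have "ennreal ((\<integral>x. f x \<partial>(M \<bind> N)) + b) = ennreal ((\<integral>x. \<integral>y. f y \<partial>N x \<partial>M) + b)" .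
  moreover have "0 \<le> (\<integral>x. f x \<partial>(M \<bind> N)) + b"
    using bnd[OF MN, of f] b by (auto simp: measurable_cong_sets[OF sMN refl] abs_le_iff)
  moreover have "0 \<le> (\<integral>x. \<integral>y. f y \<partial>N x \<partial>M) + b"
  proof -
    have "\<bar>\<integral>x. \<integral>y. f y \<partial>N x \<partial>M\<bar> \<le> b"
    proof (rule bnd[OF M])
      show "(\<lambda>x. \<integral>y. f y \<partial>N x) \<in> borel_measurable M"
        by (rule measurable_compose[OF N' integral_measurable_subprob_algebra[OF f]])
      show "\<bar>\<integral>y. f y \<partial>N x\<bar> \<le> b" if "x \<in> space M" for x
        by (rule bnd[OF sN(2)[OF that]]) (use b in \<open>auto simp: measurable_cong_sets[OF sN(1)[OF that] refl]\<close>)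
    qed
    then show ?thesis by linarith
  qed
  ultimately show ?thesis by simp
qed

subsection \<open>The Bellman equation\<close>

locale mdp = action_space \<mu> for \<mu> :: "'a::polish_space measure" +
  fixes P :: "'s::polish_space \<times> 'a \<Rightarrow> 's measure"
    and c :: "'s \<times> 'a \<Rightarrow> real" and \<gamma> \<tau> :: real
  assumes P_kernel: "P \<in> borel \<rightarrow>\<^sub>M prob_algebra borel"
    and c_borel: "c \<in> borel_measurable borel" and c_bounded: "bounded (range c)"
    and gamma_nonneg: "0 \<le> \<gamma>" and gamma_less_1: "\<gamma> < 1" and tau_pos: "0 < \<tau>"
begin

definition cost :: "('s \<times> 'a) bmeas" where "cost = Bmeas c"

lemma apply_cost [simp]: "apply_bmeas cost x = c x"
proof -
  obtain b where "\<And>x. \<bar>c x\<bar> \<le> b" using c_bounded by (auto simp: bounded_iff)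
  then show ?thesis unfolding cost_def by (subst apply_Bmeas[OF c_borel]) auto
qed

lemma sets_P: "sets (P x) = sets borel" and prob_space_P: "prob_space (P x)"
  using measurable_space[OF P_kernel, of x] by (auto simp: space_prob_algebra)

definition transition :: "'s bmeas \<Rightarrow> ('s \<times> 'a) bmeas" where
  "transition v = Bmeas (\<lambda>x. \<integral>s'. apply_bmeas v s' \<partial>P x)"

lemma integrable_P: "integrable (P x) (apply_bmeas v)"
proof -
  interpret P: prob_space "P x" by (rule prob_space_P)
  show ?thesis
    by (rule P.integrable_const_bound[where B="norm v"])
       (auto simp: abs_apply_bmeas_le_norm measurable_cong_sets[OF sets_P refl])
qed

lemma abs_integral_P_le: "\<bar>\<integral>s'. apply_bmeas v s' \<partial>P x\<bar> \<le> norm v"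
proof -
  interpret P: prob_space "P x" by (rule prob_space_P)
  have "\<bar>\<integral>s'. apply_bmeas v s' \<partial>P x\<bar> \<le> (\<integral>s'. \<bar>apply_bmeas v s'\<bar> \<partial>P x)"
    by (rule integral_abs_bound)
  also have "\<dots> \<le> norm v"
    by (rule P.integral_le_const) (auto intro: integrable_abs integrable_P abs_apply_bmeas_le_norm)
  finally show ?thesis .
qed

lemma apply_transition [simp]: "apply_bmeas (transition v) x = (\<integral>s'. apply_bmeas v s' \<partial>P x)"
proof -
  have "(\<lambda>x. \<integral>s'. apply_bmeas v s' \<partial>P x) \<in> borel_measurable borel"
    by (rule measurable_compose[OF measurable_prob_algebraD[OF P_kernel] integral_measurable_subprob_algebra]) simp
  then show ?thesis unfolding transition_def
    by (subst apply_Bmeas[of _ "norm v"]) (auto intro: abs_integral_P_le)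
qed

lemma norm_transition_le: "norm (transition v) \<le> norm v"
  by (rule norm_bmeas_le) (simp add: abs_integral_P_le)

lemma transition_diff: "transition (v - w) = transition v - transition w"
  by (rule bmeas_eqI) (simp add: Bochner_Integration.integral_diff[OF integrable_P integrable_P])

lemma transition_scaleR: "transition (r *\<^sub>R v) = r *\<^sub>R transition v"
  by (rule bmeas_eqI) simp

lemma transition_le:
  assumes "\<And>s. apply_bmeas v s \<le> u"
  shows "apply_bmeas (transition v) x \<le> u"
proof -
  interpret P: prob_space "P x" by (rule prob_space_P)
  show ?thesis using P.integral_le_const[OF integrable_P] assms by auto
qed

lemma transition_ge:
  assumes "\<And>s. u \<le> apply_bmeas v s"
  shows "u \<le> apply_bmeas (transition v) x"
proof -
  interpret P: prob_space "P x" by (rule prob_space_P)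
  show ?thesis using P.integral_ge_const[OF integrable_P] assms by auto
qed

text \<open>For normalised \<open>W\<close> this is the expectation of f(s, a) over actions drawn
  from the policy with log-density \<open>W\<close>.\<close>

definition avg :: "('s \<times> 'a) bmeas \<Rightarrow> ('s \<times> 'a) bmeas \<Rightarrow> 's bmeas" where
  "avg W f = Bmeas (\<lambda>s. \<integral>a. exp (apply_bmeas W (s, a)) * apply_bmeas f (s, a) \<partial>\<mu>)"

lemma apply_avg [simp]:
  "apply_bmeas (avg W f) s = (\<integral>a. exp (apply_bmeas W (s, a)) * apply_bmeas f (s, a) \<partial>\<mu>)"
proof -
  have "(\<lambda>s. \<integral>a. exp (apply_bmeas W (s, a)) * apply_bmeas f (s, a) \<partial>\<mu>) \<in> borel_measurable borel"
    using measurable_integral_section[OF measurable_apply_bmeas[of "bmult (bexp W) f"]] by simp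
  then show ?thesis unfolding avg_def
    using abs_integral_section_le[of "bmult (bexp W) f"]
    by (subst apply_Bmeas[of _ "norm (bmult (bexp W) f)"]) auto
qed

lemma integrable_exp_mult [simp, intro]:
  "integrable \<mu> (\<lambda>a. exp (apply_bmeas W (s, a)) * apply_bmeas f (s, a))"
  for W f :: "('s \<times> 'a) bmeas"
  using integrable_section[of "bmult (bexp W) f" s] by simp

lemma avg_diff: "avg W (f - g) = avg W f - avg W g"
  by (rule bmeas_eqI) (simp add: right_diff_distrib)

lemma avg_add: "avg W (f + g) = avg W f + avg W g"
  by (rule bmeas_eqI) (simp add: distrib_left)

lemma avg_scaleR: "avg W (r *\<^sub>R f) = r *\<^sub>R avg W f"
  by (rule bmeas_eqI) (simp add: mult.left_commute)

lemma avg_lift_fst: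
  assumes "normalised W"
  shows "avg W (lift_fst v) = v"
  by (rule bmeas_eqI) (use assms in \<open>simp add: normalised_def\<close>)

lemma avg_mono:
  assumes "normalised W" "\<And>a. apply_bmeas f (s, a) \<le> apply_bmeas g (s, a)"
  shows "apply_bmeas (avg W f) s \<le> apply_bmeas (avg W g) s"
  unfolding apply_avg by (rule integral_mono) (use assms in auto)

lemma norm_avg_le:
  assumes "normalised W"
  shows "norm (avg W f) \<le> norm f"
proof (rule norm_bmeas_le)
  fix s
  have "\<bar>apply_bmeas (avg W f) s\<bar> \<le> (\<integral>a. \<bar>exp (apply_bmeas W (s, a)) * apply_bmeas f (s, a)\<bar> \<partial>\<mu>)"
    unfolding apply_avg by (rule integral_abs_bound)
  also have "\<dots> \<le> (\<integral>a. exp (apply_bmeas W (s, a)) * norm f \<partial>\<mu>)"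
  proof (rule integral_mono)
    show "integrable \<mu> (\<lambda>a. \<bar>exp (apply_bmeas W (s, a)) * apply_bmeas f (s, a)\<bar>)"
      by (rule integrable_abs) simp
  qed (auto simp: abs_mult abs_apply_bmeas_le_norm)
  also have "\<dots> = norm f" using assms by (simp add: normalised_def)
  finally show "\<bar>apply_bmeas (avg W f) s\<bar> \<le> norm f" .
qed

text \<open>The relative entropy of e^W \<mu> with respect to \<mu> is the integral of W e^W, hence
  the average of W; this is why the entropy cost appears as \<tau> W under
  \<open>avg\<close>.\<close>

definition bellman :: "('s \<times> 'a) bmeas \<Rightarrow> 's bmeas \<Rightarrow> 's bmeas" where
  "bellman W v = avg W (cost + \<tau> *\<^sub>R W + \<gamma> *\<^sub>R transition v)"

lemma bellman_contraction:
  assumes "normalised W"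
  shows "norm (bellman W v - bellman W w) \<le> \<gamma> * norm (v - w)"
proof -
  have "bellman W v - bellman W w = avg W (\<gamma> *\<^sub>R transition (v - w))"
    by (simp add: bellman_def avg_diff[symmetric] transition_diff scaleR_diff_right)
  also have "norm \<dots> \<le> norm (\<gamma> *\<^sub>R transition (v - w))" by (rule norm_avg_le[OF assms])
  also have "\<dots> \<le> \<gamma> * norm (v - w)"
    using gamma_nonneg norm_transition_le[of "v - w"] by (simp add: mult_left_mono)
  finally show ?thesis .
qed

text \<open>Meaningful for normalised \<open>W\<close>, where the Bellman operator is a
  \<gamma>-contraction and the fixed point is unique.\<close>

definition val :: "('s \<times> 'a) bmeas \<Rightarrow> 's bmeas" where
  "val W = (THE v. bellman W v = v)"

lemma bellman_val:
  assumes "normalised W"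
  shows "bellman W (val W) = val W"
proof -
  have "\<exists>!v. bellman W v = v"
    by (rule banach_fix_type[OF gamma_nonneg gamma_less_1])
       (use bellman_contraction[OF assms] in \<open>simp add: dist_norm\<close>)
  then show ?thesis unfolding val_def by (rule theI')
qed

section \<open>The law of the trajectory and its marginals\<close>

lemma kernel_measure_prob_algebra:
  fixes W :: "('s \<times> 'a) bmeas"
  assumes W: "normalised W"
  shows "kernel_measure (softmax \<mu> W) \<in> borel \<rightarrow>\<^sub>M prob_algebra borel"
proof (rule measurable_kernel_measure)
  show "prob_space (kernel_measure (softmax \<mu> W) s)" for s
    by (rule prob_space_kernel_measure_softmax)
  fix s B
  interpret K: prob_space "kernel_measure (softmax \<mu> W) s" by (rule prob_space_kernel_measure_softmax)
  show "emeasure (kernel_measure (softmax \<mu> W) s) B = ennreal (apply_bkernel (softmax \<mu> W) s B)"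
    unfolding K.emeasure_eq_measure
    by (simp add: apply_softmax[OF prob_space_axioms sets_mu] kernel_measure_softmax[OF prob_space_axioms sets_mu])
qed

definition action_step :: "('s \<times> 'a) bmeas \<Rightarrow> 's \<Rightarrow> ('s \<times> 'a) measure" where
  "action_step W s' = distr (kernel_measure (softmax \<mu> W) s') borel (\<lambda>a. (s', a))"

lemma action_step_prob_algebra:
  assumes "normalised W"
  shows "action_step W \<in> borel \<rightarrow>\<^sub>M prob_algebra borel"
  unfolding action_step_def[abs_def]
  by (rule measurable_distr_prob_space2[OF kernel_measure_prob_algebra[OF assms]]) (simp add: borel_prod[symmetric])

lemma integral_action_step:
  assumes "normalised W"
  shows "(\<integral>x. apply_bmeas g x \<partial>action_step W s) = apply_bmeas (avg W g) s"
proof -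
  have m: "Pair s \<in> borel \<rightarrow>\<^sub>M (borel :: ('s \<times> 'a) measure)" by (simp add: borel_prod[symmetric])
  have "(\<lambda>a. apply_bmeas g (s, a)) \<in> borel_measurable borel"
    by (rule measurable_compose[OF m]) simp
  then show ?thesis
    unfolding action_step_def
    by (subst integral_distr)
       (auto simp: integral_kernel_measure_normalised[OF assms] m measurable_cong_sets[OF sets_kernel_measure refl])
qed

lemma integral_step_kernel_0:
  assumes "normalised W"
  shows "(\<integral>x. apply_bmeas g x \<partial>step_kernel P (softmax \<mu> W) s 0 \<omega>) = apply_bmeas (avg W g) s"
proof -
  have "step_kernel P (softmax \<mu> W) s 0 \<omega> = return borel s \<bind> action_step W"
    by (simp add: step_kernel_def action_step_def[abs_def])
  then show ?thesis
    using integral_bind_bounded[of "return borel s" "action_step W" borel "apply_bmeas g" "norm g"]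
      action_step_prob_algebra[OF assms]
    by (simp add: prob_space_return abs_apply_bmeas_le_norm integral_action_step[OF assms]
        integral_return measurable_cong_sets[OF sets_return refl] del: apply_avg)
qed

lemma integral_step_kernel_Suc:
  assumes "normalised W"
  shows "(\<integral>x. apply_bmeas g x \<partial>step_kernel P (softmax \<mu> W) s (Suc n) \<omega>) =
    apply_bmeas (transition (avg W g)) (\<omega> n)"
proof -
  have "step_kernel P (softmax \<mu> W) s (Suc n) \<omega> = P (\<omega> n) \<bind> action_step W"
    by (simp add: step_kernel_def action_step_def[abs_def])
  then show ?thesis
    using integral_bind_bounded[of "P (\<omega> n)" "action_step W" borel "apply_bmeas g" "norm g"]
      action_step_prob_algebra[OF assms]
    by (simp add: prob_space_P abs_apply_bmeas_le_norm integral_action_step[OF assms]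
        measurable_cong_sets[OF sets_P refl] del: apply_avg)
qed

text \<open>The law of the first n coordinates is the finite composition \<open>IT.C 0 n\<close> of
  the step kernels, and its last factor can be integrated out explicitly. The final identity is the
  Markov property for functions of a single coordinate.\<close>

lemma
  fixes s :: 's
  assumes W: "normalised W"
  defines "T \<equiv> trajectory P (softmax \<mu> W) s"
  shows prob_space_trajectory: "prob_space T"
    and sets_trajectory: "sets T = sets (PiM UNIV (\<lambda>_. borel))"
    and integral_trajectory_0: "(\<integral>\<omega>. apply_bmeas g (\<omega> 0) \<partial>T) = apply_bmeas (avg W g) s"
    and integral_trajectory_Suc: "(\<integral>\<omega>. apply_bmeas g (\<omega> (Suc n)) \<partial>T) =
      (\<integral>\<omega>. apply_bmeas (transition (avg W g)) (\<omega> n) \<partial>T)"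
proof -
  let ?M = "\<lambda>n::nat. borel :: ('s \<times> 'a) measure" and ?S = "step_kernel P (softmax \<mu> W) s"
  interpret IT: Ionescu_Tulcea ?S ?M
    by (rule Ionescu_Tulcea_step_kernel[OF P_kernel prob_space_axioms sets_mu softmax_in_policies])
  let ?u = "\<lambda>_::nat. undefined :: 's \<times> 'a"
  have T: "T = IT.PF.lim" by (simp add: T_def trajectory_def)
  show sets: "sets T = sets (PiM UNIV ?M)" unfolding T by (rule IT.PF.sets_lim)
  have C: "distr T (PiM {0..<n} ?M) (\<lambda>\<omega>. restrict \<omega> {0..<n}) = IT.C 0 n ?u" for n
  proof -
    \<comment> \<open>\<open>IT.up_to\<close> of {0..<n} is n, so the projection inside
      \<open>IT.CI\<close> onto these coordinates changes nothing and the marginal is the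
      composition itself.\<close>
    have le: "IT.up_to {0..<n} \<le> m \<longleftrightarrow> n \<le> m" for m
      by (subst IT.up_to_iff_Ico) auto
    have "IT.up_to {0..<n} = n" using le[of n] le[of "IT.up_to {0..<n}"] by simp
    then have "IT.CI {0..<n} = IT.C 0 n ?u"
      unfolding IT.CI_def using IT.distr_C[of n n ?u 0] by simp
    then show ?thesis unfolding T using IT.distr_lim[of "{0..<n}"] by simp
  qed
  have res: "(\<lambda>\<omega>. restrict \<omega> {0..<n}) \<in> T \<rightarrow>\<^sub>M PiM {0..<n} ?M" for n
    unfolding measurable_cong_sets[OF sets refl] by (intro measurable_restrict_subset) auto
  have "prob_space (distr T (PiM {0..<0} ?M) (\<lambda>\<omega>. restrict \<omega> {0..<0}))"
    unfolding C by (rule IT.prob_space_C) simp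
  then show "prob_space T" by (rule prob_space_distrD[OF res])
  have u: "?u \<in> space (PiM {0..<0} ?M)" by simp
  have comp: "(\<lambda>x. apply_bmeas f (x n)) \<in> borel_measurable (PiM {0..<Suc n} ?M)" for f n
    by (rule measurable_compose[OF measurable_component_singleton]) auto
  have TC: "(\<integral>\<omega>. apply_bmeas f (\<omega> n) \<partial>T) = (\<integral>x. apply_bmeas f (x n) \<partial>IT.C 0 (Suc n) ?u)" for f n
    unfolding C[symmetric] by (subst integral_distr[OF res comp]) simp
  have eP: "IT.eP n \<in> PiM {0..<n} ?M \<rightarrow>\<^sub>M prob_algebra (PiM {0..<Suc n} ?M)" for n
    by (intro measurable_prob_algebraI IT.prob_space_eP IT.measurable_eP)
  \<comment> \<open>\<open>IT.eP\<close> appends coordinate n, drawn from the step kernel given the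
    past, so a function of that coordinate alone is integrated against the step kernel.\<close>
  have CS: "(\<integral>x. apply_bmeas f (x n) \<partial>IT.C 0 (Suc n) ?u) =
      (\<integral>y. \<integral>z. apply_bmeas f z \<partial>?S n y \<partial>IT.C 0 n ?u)" for f n
  proof -
    have sC: "sets (IT.C 0 n ?u) = sets (PiM {0..<n} ?M)" using IT.sets_C[OF u, of n] by simp
    have "(\<integral>x. apply_bmeas f (x n) \<partial>IT.C 0 (Suc n) ?u) =
        (\<integral>y. \<integral>x. apply_bmeas f (x n) \<partial>IT.eP n y \<partial>IT.C 0 n ?u)"
      unfolding IT.C.simps(2) add_0
      by (rule integral_bind_bounded[OF IT.prob_space_C[OF u] _ comp abs_apply_bmeas_le_norm])
         (unfold measurable_cong_sets[OF sC refl], rule eP)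
    also have "\<dots> = (\<integral>y. \<integral>z. apply_bmeas f z \<partial>?S n y \<partial>IT.C 0 n ?u)"
    proof (rule Bochner_Integration.integral_cong[OF refl])
      fix y assume "y \<in> space (IT.C 0 n ?u)"
      then have y: "y \<in> space (PiM {0..<n} ?M)" using sets_eq_imp_space_eq[OF sC] by simp
      have "fun_upd y n \<in> ?S n y \<rightarrow>\<^sub>M PiM {0..<Suc n} ?M"
        unfolding measurable_cong_sets[OF IT.sets_P[OF y] refl]
        by (rule measurable_fun_upd[where J="{0..<n}"]) (use y in auto)
      then show "(\<integral>x. apply_bmeas f (x n) \<partial>IT.eP n y) = (\<integral>z. apply_bmeas f z \<partial>?S n y)"
        unfolding IT.eP_def by (subst integral_distr[OF _ comp]) auto
    qed
    finally show ?thesis .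
  qed
  show "(\<integral>\<omega>. apply_bmeas g (\<omega> 0) \<partial>T) = apply_bmeas (avg W g) s"
    unfolding TC CS integral_step_kernel_0[OF W]
    using prob_space.prob_space[OF IT.prob_space_C[OF u, of 0]] by (simp del: IT.C.simps apply_avg)
  show "(\<integral>\<omega>. apply_bmeas g (\<omega> (Suc n)) \<partial>T) = (\<integral>\<omega>. apply_bmeas (transition (avg W g)) (\<omega> n) \<partial>T)"
    unfolding TC CS[of _ g] integral_step_kernel_Suc[OF W] ..
qed

text \<open>The running cost c + \<tau> KL from the definition of \<open>V\<close>, with the entropy
  as a function of the state alone. Its average under the policy equals that of cost + \<tau> W, the
  integrand in \<open>bellman\<close>.\<close>

definition stage_cost :: "('s \<times> 'a) bmeas \<Rightarrow> ('s \<times> 'a) bmeas" where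
  "stage_cost W = cost + \<tau> *\<^sub>R lift_fst (avg W W)"

text \<open>For the Bellman fixed point v, the expected cost at time n is E[v(s_n)] - \<gamma>
  E[v(s_(n+1))]. The discounted sum telescopes to v(s), the remainder vanishing because v is bounded
  and \<gamma> < 1.\<close>

theorem V_eq_val:
  assumes W: "normalised W"
  shows "V P c \<gamma> \<mu> \<tau> (softmax \<mu> W) s = apply_bmeas (val W) s"
proof -
  let ?T = "trajectory P (softmax \<mu> W) s" and ?r = "stage_cost W" and ?v = "val W"
  interpret T: prob_space ?T by (rule prob_space_trajectory[OF W])
  have meas: "(\<lambda>\<omega>. apply_bmeas f (\<omega> n)) \<in> borel_measurable ?T" for f :: "('s \<times> 'a) bmeas" and n
    unfolding measurable_cong_sets[OF sets_trajectory[OF W] refl]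
    by (rule measurable_compose[OF measurable_component_singleton]) auto
  have int: "integrable ?T (\<lambda>\<omega>. apply_bmeas f (\<omega> n))" for f :: "('s \<times> 'a) bmeas" and n
    by (rule T.integrable_const_bound[where B="norm f"]) (auto simp: meas abs_apply_bmeas_le_norm)
  define E where "E n f = (\<integral>\<omega>. apply_bmeas f (\<omega> n) \<partial>?T)" for n and f :: "('s \<times> 'a) bmeas"
  have abs_E: "\<bar>E n f\<bar> \<le> norm f" for n f
    unfolding E_def
    by (rule order_trans[OF integral_abs_bound T.integral_le_const])
       (auto intro: integrable_abs int abs_apply_bmeas_le_norm)
  have E_diff: "E n (f - g) = E n f - E n g" and E_scaleR: "E n (r *\<^sub>R f) = r * E n f" for n f g r
    by (simp_all add: E_def int)
  have avg_r: "avg W ?r = ?v - \<gamma> *\<^sub>R avg W (transition ?v)"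
  proof -
    have "?v = avg W (cost + \<tau> *\<^sub>R W + \<gamma> *\<^sub>R transition ?v)"
      using bellman_val[OF W] by (simp add: bellman_def)
    then show ?thesis
      by (simp add: stage_cost_def avg_add avg_scaleR avg_lift_fst[OF W] algebra_simps)
  qed
  \<comment> \<open>The expectation of v at the n-th state. \<open>E\<close> evaluates functions of
    state-action pairs, so the state at time m + 1 enters through the transition from the pair at
    time m, and time 0 is the deterministic start.\<close>
  define f where "f n = (case n of 0 \<Rightarrow> apply_bmeas ?v s | Suc m \<Rightarrow> E m (transition ?v))" for n
  have f_bound: "\<bar>f n\<bar> \<le> norm ?v" for n
    using order_trans[OF abs_E norm_transition_le] by (auto simp: f_def abs_apply_bmeas_le_norm split: nat.split)
  have E_r: "E n ?r = f n - \<gamma> * f (Suc n)" for n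
  proof (cases n)
    case 0
    then show ?thesis
      using integral_trajectory_0[OF W, where g="?r" and s=s] integral_trajectory_0[OF W, where g="transition ?v" and s=s]
      by (simp add: E_def f_def avg_r del: apply_avg apply_transition)
  next
    case (Suc m)
    have "E n ?r = E m (transition (avg W ?r))"
      unfolding E_def Suc by (rule integral_trajectory_Suc[OF W])
    also have "\<dots> = E m (transition ?v) - \<gamma> * E m (transition (avg W (transition ?v)))"
      unfolding avg_r by (simp add: transition_diff transition_scaleR E_diff E_scaleR del: apply_avg)
    also have "E m (transition (avg W (transition ?v))) = E n (transition ?v)"
      unfolding E_def Suc by (rule integral_trajectory_Suc[OF W, symmetric])
    finally show ?thesis by (simp add: f_def Suc)
  qed
  have geo: "summable (\<lambda>n. \<gamma> ^ n * b)" for b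
    by (intro summable_mult2 summable_geometric) (use gamma_nonneg gamma_less_1 in auto)
  have "V P c \<gamma> \<mu> \<tau> (softmax \<mu> W) s = (\<integral>\<omega>. (\<Sum>n. \<gamma> ^ n * apply_bmeas ?r (\<omega> n)) \<partial>?T)"
    unfolding V_def KL_normalised[OF W] by (simp add: stage_cost_def mult.commute[of "exp _"])
  also have "\<dots> = (\<Sum>n. \<integral>\<omega>. \<gamma> ^ n * apply_bmeas ?r (\<omega> n) \<partial>?T)"
  proof (rule integral_suminf)
    show "integrable ?T (\<lambda>\<omega>. \<gamma> ^ n * apply_bmeas ?r (\<omega> n))" for n by (simp add: int)
    have nb: "norm (\<gamma> ^ n * apply_bmeas ?r x) \<le> \<gamma> ^ n * norm ?r" for n x
      using gamma_nonneg by (auto simp: abs_mult intro!: mult_left_mono abs_apply_bmeas_le_norm)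
    show "AE \<omega> in ?T. summable (\<lambda>n. norm (\<gamma> ^ n * apply_bmeas ?r (\<omega> n)))"
      by (rule AE_I2, rule summable_comparison_test[OF _ geo[of "norm ?r"]]) (use nb in auto)
    have "\<bar>\<integral>\<omega>. norm (\<gamma> ^ n * apply_bmeas ?r (\<omega> n)) \<partial>?T\<bar> \<le> \<gamma> ^ n * norm ?r" for n
    proof -
      have "(\<integral>\<omega>. norm (\<gamma> ^ n * apply_bmeas ?r (\<omega> n)) \<partial>?T) \<le> \<gamma> ^ n * norm ?r"
        by (rule T.integral_le_const) (use nb int in \<open>auto intro!: integrable_norm\<close>)
      then show ?thesis by (simp add: abs_of_nonneg integral_nonneg_AE)
    qed
    then show "summable (\<lambda>n. \<integral>\<omega>. norm (\<gamma> ^ n * apply_bmeas ?r (\<omega> n)) \<partial>?T)"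
      by (intro summable_comparison_test[OF _ geo[of "norm ?r"]]) auto
  qed
  also have "\<dots> = (\<Sum>n. \<gamma> ^ n * E n ?r)"
    by (simp add: E_def)
  also have "\<dots> = (\<Sum>n. \<gamma> ^ n * f n - \<gamma> ^ Suc n * f (Suc n))"
    unfolding E_r by (simp add: algebra_simps)
  also have "\<dots> = \<gamma> ^ 0 * f 0 - 0"
  proof (rule sums_unique[symmetric], rule telescope_sums')
    show "(\<lambda>n. \<gamma> ^ n * f n) \<longlonglongrightarrow> 0"
    proof (rule Lim_null_comparison)
      show "\<forall>\<^sub>F n in sequentially. norm (\<gamma> ^ n * f n) \<le> \<gamma> ^ n * norm ?v"
        using gamma_nonneg f_bound by (intro always_eventually) (auto simp: abs_mult intro!: mult_left_mono)
      show "(\<lambda>n. \<gamma> ^ n * norm ?v) \<longlonglongrightarrow> 0" by (rule summable_LIMSEQ_zero[OF geo])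
    qed
  qed
  finally show ?thesis by (simp add: f_def)
qed

lemma Q_eq:
  assumes "normalised W"
  shows "Q P c \<gamma> \<mu> \<tau> (softmax \<mu> W) s a = c (s, a) + \<gamma> * apply_bmeas (transition (val W)) (s, a)"
  by (simp add: Q_def V_eq_val[OF assms])

end

subsection \<open>Local Lipschitz estimates\<close>

lemma abs_exp_diff_le:
  fixes x y :: real
  assumes "\<bar>x\<bar> \<le> R" "\<bar>y\<bar> \<le> R"
  shows "\<bar>exp x - exp y\<bar> \<le> exp R * \<bar>x - y\<bar>"
proof -
  have "exp x - exp y \<le> exp R * (x - y)" if "y \<le> x" "\<bar>x\<bar> \<le> R" for x y :: real
  proof -
    have "1 - exp (y - x) \<le> x - y" using exp_ge_add_one_self[of "y - x"] by linarith
    then have "exp x * (1 - exp (y - x)) \<le> exp R * (x - y)"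
      using that by (intro mult_mono) auto
    then show ?thesis by (simp add: right_diff_distrib exp_diff)
  qed
  from this[of y x] this[of x y] show ?thesis using assms by (cases "y \<le> x") (auto simp: abs_if)
qed

text \<open>The converse of \<open>abs_exp_diff_le\<close>. For log-densities within [-R, R] it
  makes total variation control their L1 distance, which is what handles the entropy term.\<close>

lemma abs_diff_le_exp:
  fixes x y :: real
  assumes "\<bar>x\<bar> \<le> R" "\<bar>y\<bar> \<le> R"
  shows "\<bar>x - y\<bar> \<le> exp R * \<bar>exp x - exp y\<bar>"
proof -
  have "x - y \<le> exp R * (exp x - exp y)" if "y \<le> x" "\<bar>y\<bar> \<le> R" for x y :: real
  proof -
    have "x - y \<le> exp (x - y) - 1" using exp_ge_add_one_self[of "x - y"] by linarith
    also have "\<dots> = exp (- y) * (exp x - exp y)" by (simp add: exp_diff exp_minus field_simps)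
    also have "\<dots> \<le> exp R * (exp x - exp y)" using that by (intro mult_right_mono) auto
    finally show ?thesis .
  qed
  from this[of y x] this[of x y] show ?thesis using assms by (cases "y \<le> x") (auto simp: abs_if)
qed

context mdp
begin

definition tv_dist :: "('s \<times> 'a) bmeas \<Rightarrow> ('s \<times> 'a) bmeas \<Rightarrow> real" where
  "tv_dist W Y = norm (kernel_of (bexp W) - kernel_of (bexp Y))"

lemma integral_abs_exp_diff_le: "(\<integral>a. \<bar>exp (apply_bmeas W (s, a)) - exp (apply_bmeas Y (s, a))\<bar> \<partial>\<mu>) \<le> tv_dist W Y"
  for W Y :: "('s \<times> 'a) bmeas"
  using integral_abs_le_norm_kernel_of[of "bexp W - bexp Y" s] by (simp add: tv_dist_def kernel_of_diff)

lemma tv_dist_le: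
  assumes "norm W \<le> R" "norm Y \<le> R"
  shows "tv_dist W Y \<le> exp R * norm (W - Y)"
proof -
  have "norm (bexp W - bexp Y) \<le> exp R * norm (W - Y)"
  proof (rule norm_bmeas_le)
    fix x
    have "\<bar>apply_bmeas W x\<bar> \<le> R" "\<bar>apply_bmeas Y x\<bar> \<le> R"
      using abs_apply_bmeas_le_norm[of W x] abs_apply_bmeas_le_norm[of Y x] assms by linarith+
    then have "\<bar>apply_bmeas (bexp W - bexp Y) x\<bar> \<le> exp R * \<bar>apply_bmeas (W - Y) x\<bar>"
      using abs_exp_diff_le by simp
    also have "\<dots> \<le> exp R * norm (W - Y)" by (intro mult_left_mono abs_apply_bmeas_le_norm) simp
    finally show "\<bar>apply_bmeas (bexp W - bexp Y) x\<bar> \<le> exp R * norm (W - Y)" .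
  qed
  then show ?thesis
    unfolding tv_dist_def kernel_of_diff[symmetric] using norm_kernel_of_le_norm order_trans by blast
qed

lemma norm_val_le:
  assumes "normalised W"
  shows "norm (val W) \<le> (norm cost + \<tau> * norm W) / (1 - \<gamma>)"
proof -
  have "norm (val W) = norm (bellman W (val W))" by (simp add: bellman_val[OF assms])
  also have "\<dots> \<le> norm (cost + \<tau> *\<^sub>R W + \<gamma> *\<^sub>R transition (val W))"
    unfolding bellman_def by (rule norm_avg_le[OF assms])
  also have "\<dots> \<le> norm cost + \<tau> * norm W + \<gamma> * norm (transition (val W))"
    using norm_triangle_ineq[of "cost + \<tau> *\<^sub>R W" "\<gamma> *\<^sub>R transition (val W)"]
      norm_triangle_ineq[of cost "\<tau> *\<^sub>R W"] tau_pos gamma_nonneg by simp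
  also have "\<dots> \<le> norm cost + \<tau> * norm W + \<gamma> * norm (val W)"
    using gamma_nonneg norm_transition_le[of "val W"] by (simp add: mult_left_mono)
  finally show ?thesis using gamma_less_1 by (simp add: field_simps)
qed

text \<open>The first summand bounds cost + \<tau> W + \<gamma> P v, against which the change of
  density is integrated. In the second, one factor exp R bounds the density and the other comes from
  \<open>abs_diff_le_exp\<close>. The outer division by 1 - \<gamma> absorbs the contraction
  term.\<close>

definition val_lip :: "real \<Rightarrow> real" where
  "val_lip R = ((norm cost + \<tau> * R) / (1 - \<gamma>) + \<tau> * exp (2 * R)) / (1 - \<gamma>)"

lemma integral_abs_diff_le:
  fixes W Y :: "('s \<times> 'a) bmeas"
  assumes "norm W \<le> R" "norm Y \<le> R"
  shows "(\<integral>a. \<bar>apply_bmeas W (s, a) - apply_bmeas Y (s, a)\<bar> \<partial>\<mu>) \<le> exp R * tv_dist W Y"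
proof -
  have "(\<integral>a. \<bar>apply_bmeas W (s, a) - apply_bmeas Y (s, a)\<bar> \<partial>\<mu>)
      \<le> (\<integral>a. exp R * \<bar>exp (apply_bmeas W (s, a)) - exp (apply_bmeas Y (s, a))\<bar> \<partial>\<mu>)"
  proof (rule integral_mono)
    fix a
    have "\<bar>apply_bmeas W (s, a)\<bar> \<le> R" "\<bar>apply_bmeas Y (s, a)\<bar> \<le> R"
      using abs_apply_bmeas_le_norm[of W "(s, a)"] abs_apply_bmeas_le_norm[of Y "(s, a)"] assms by linarith+
    then show "\<bar>apply_bmeas W (s, a) - apply_bmeas Y (s, a)\<bar>
        \<le> exp R * \<bar>exp (apply_bmeas W (s, a)) - exp (apply_bmeas Y (s, a))\<bar>" by (rule abs_diff_le_exp)
  qed (auto intro!: integrable_abs integrable_mult_right)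
  also have "\<dots> \<le> exp R * tv_dist W Y"
    using integral_abs_exp_diff_le[where W=W and Y=Y and s=s] by simp
  finally show ?thesis .
qed

text \<open>Insert \<open>bellman W (val Y)\<close>: one difference contracts by \<gamma>, the other
  compares two operators at the same argument. The latter is an integral over actions, so L1
  distances suffice and total variation appears on the right.\<close>

lemma norm_val_diff_le:
  assumes W: "normalised W" "norm W \<le> R" and Y: "normalised Y" "norm Y \<le> R"
  shows "norm (val W - val Y) \<le> val_lip R * tv_dist W Y"
proof -
  let ?f = "cost + \<tau> *\<^sub>R W + \<gamma> *\<^sub>R transition (val Y)" and ?g = "cost + \<tau> *\<^sub>R Y + \<gamma> *\<^sub>R transition (val Y)"
  let ?D = "tv_dist W Y" and ?K = "(norm cost + \<tau> * R) / (1 - \<gamma>)"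
  have D: "0 \<le> ?D" by (simp add: tv_dist_def)
  have R: "0 \<le> R" using W(2) norm_ge_zero order_trans by blast
  have f: "norm ?f \<le> ?K"
  proof -
    have "norm ?f \<le> norm cost + \<tau> * norm W + \<gamma> * norm (val Y)"
      using norm_triangle_ineq[of "cost + \<tau> *\<^sub>R W" "\<gamma> *\<^sub>R transition (val Y)"]
        norm_triangle_ineq[of cost "\<tau> *\<^sub>R W"] tau_pos gamma_nonneg
        mult_left_mono[OF norm_transition_le[of "val Y"] gamma_nonneg] by simp
    also have "\<dots> \<le> norm cost + \<tau> * R + \<gamma> * ?K"
    proof -
      have "norm (val Y) \<le> (norm cost + \<tau> * norm Y) / (1 - \<gamma>)" by (rule norm_val_le[OF Y(1)])
      also have "\<dots> \<le> ?K" using Y(2) tau_pos gamma_less_1 by (intro divide_right_mono) auto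
      finally show ?thesis using W(2) tau_pos gamma_nonneg by (intro add_mono mult_left_mono) auto
    qed
    \<comment> \<open>\<open>?K\<close> is the solution of K = norm cost + \<tau> R + \<gamma> K, so
      the same number bounds the value function and the integrand of the Bellman operator.\<close>
    also have "\<dots> = ?K" using gamma_less_1 by (simp add: field_simps)
    finally show ?thesis .
  qed
  have b: "norm (bellman W (val Y) - bellman Y (val Y)) \<le> (?K + \<tau> * exp (2 * R)) * ?D"
  proof (rule norm_bmeas_le)
    fix s
    let ?d = "\<lambda>a. \<bar>exp (apply_bmeas W (s, a)) - exp (apply_bmeas Y (s, a))\<bar>"
    let ?w = "\<lambda>a. \<bar>apply_bmeas W (s, a) - apply_bmeas Y (s, a)\<bar>"
    have int: "integrable \<mu> ?d" "integrable \<mu> ?w" by (auto intro!: integrable_abs)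
    define F where "F a = exp (apply_bmeas W (s, a)) * apply_bmeas ?f (s, a) - exp (apply_bmeas Y (s, a)) * apply_bmeas ?g (s, a)" for a
    have F: "apply_bmeas (bellman W (val Y) - bellman Y (val Y)) s = (\<integral>a. F a \<partial>\<mu>)"
      unfolding F_def bellman_def minus_bmeas.rep_eq apply_avg
      by (rule Bochner_Integration.integral_diff[OF integrable_exp_mult integrable_exp_mult, symmetric])
    have "\<bar>apply_bmeas (bellman W (val Y) - bellman Y (val Y)) s\<bar> \<le> (\<integral>a. \<bar>F a\<bar> \<partial>\<mu>)"
      unfolding F by (rule integral_abs_bound)
    also have "\<dots> \<le> (\<integral>a. ?K * ?d a + \<tau> * exp R * ?w a \<partial>\<mu>)"
    proof (rule integral_mono)
      fix a :: 'a
      let ?x = "(s, a)"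
      have F_eq: "F a = (exp (apply_bmeas W ?x) - exp (apply_bmeas Y ?x)) * apply_bmeas ?f ?x
            + exp (apply_bmeas Y ?x) * (\<tau> * (apply_bmeas W ?x - apply_bmeas Y ?x))"
        by (simp add: F_def algebra_simps)
      have "\<bar>F a\<bar> \<le> ?d a * \<bar>apply_bmeas ?f ?x\<bar> + exp (apply_bmeas Y ?x) * (\<tau> * ?w a)"
        unfolding F_eq by (rule order_trans[OF abs_triangle_ineq]) (use tau_pos in \<open>simp add: abs_mult\<close>)
      also have "\<dots> \<le> ?d a * ?K + exp R * (\<tau> * ?w a)"
      proof (intro add_mono mult_left_mono mult_right_mono)
        show "\<bar>apply_bmeas ?f ?x\<bar> \<le> ?K" using abs_apply_bmeas_le_norm f by (rule order_trans)
        show "exp (apply_bmeas Y ?x) \<le> exp R" using abs_apply_bmeas_le_norm[of Y ?x] Y(2) by simp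
      qed (use tau_pos in auto)
      finally show "\<bar>F a\<bar> \<le> ?K * ?d a + \<tau> * exp R * ?w a" by (simp only: mult_ac)
    next
      show "integrable \<mu> (\<lambda>a. \<bar>F a\<bar>)"
        unfolding F_def by (intro integrable_abs Bochner_Integration.integrable_diff integrable_exp_mult)
    qed (intro Bochner_Integration.integrable_add integrable_mult_right int)
    also have "\<dots> = ?K * (\<integral>a. ?d a \<partial>\<mu>) + \<tau> * exp R * (\<integral>a. ?w a \<partial>\<mu>)"
      using int by simp
    also have "\<dots> \<le> ?K * ?D + \<tau> * exp R * (exp R * ?D)"
    proof (intro add_mono mult_left_mono)
      show "(\<integral>a. ?d a \<partial>\<mu>) \<le> ?D" by (rule integral_abs_exp_diff_le)
      show "(\<integral>a. ?w a \<partial>\<mu>) \<le> exp R * ?D" by (rule integral_abs_diff_le[OF W(2) Y(2)])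
    qed (use tau_pos gamma_less_1 R in auto)
    also have "\<dots> = (?K + \<tau> * exp (2 * R)) * ?D"
      by (simp add: algebra_simps mult_exp_exp)
    finally show "\<bar>apply_bmeas (bellman W (val Y) - bellman Y (val Y)) s\<bar> \<le> (?K + \<tau> * exp (2 * R)) * ?D" .
  qed
  have "val W - val Y = (bellman W (val W) - bellman W (val Y)) + (bellman W (val Y) - bellman Y (val Y))"
    by (simp add: bellman_val W Y)
  also have "norm \<dots> \<le> \<gamma> * norm (val W - val Y) + (?K + \<tau> * exp (2 * R)) * ?D"
    by (rule norm_triangle_le) (intro add_mono bellman_contraction[OF W(1)] b)
  finally have "(1 - \<gamma>) * norm (val W - val Y) \<le> (?K + \<tau> * exp (2 * R)) * ?D" by (simp add: algebra_simps)
  then have "norm (val W - val Y) \<le> (?K + \<tau> * exp (2 * R)) * ?D / (1 - \<gamma>)"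
    using gamma_less_1 by (simp add: pos_le_divide_eq mult.commute)
  then show ?thesis by (simp add: val_lip_def)
qed

definition drift :: "('s \<times> 'a) bmeas \<Rightarrow> ('s \<times> 'a) bmeas" where
  "drift W = - (cost + \<gamma> *\<^sub>R transition (val W) + \<tau> *\<^sub>R W - lift_fst (val W))"

lemma norm_drift_le:
  assumes "normalised W"
  shows "norm (drift W) \<le> 2 * (norm cost + \<tau> * norm W) / (1 - \<gamma>)"
proof -
  let ?K = "(norm cost + \<tau> * norm W) / (1 - \<gamma>)"
  have l: "norm (lift_fst (val W) :: ('s \<times> 'a) bmeas) \<le> norm (val W)" by (rule norm_lift_fst_le)
  have "norm (drift W) \<le> norm cost + \<gamma> * norm (val W) + \<tau> * norm W + norm (val W)"
    unfolding drift_def norm_minus_cancel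
    using norm_triangle_ineq4[of "cost + \<gamma> *\<^sub>R transition (val W) + \<tau> *\<^sub>R W" "lift_fst (val W)"]
      norm_triangle_ineq[of "cost + \<gamma> *\<^sub>R transition (val W)" "\<tau> *\<^sub>R W"]
      norm_triangle_ineq[of cost "\<gamma> *\<^sub>R transition (val W)"] tau_pos gamma_nonneg
      mult_left_mono[OF norm_transition_le[of "val W"] gamma_nonneg] l
    by simp
  also have "\<dots> \<le> norm cost + \<gamma> * ?K + \<tau> * norm W + ?K"
    using norm_val_le[OF assms] gamma_nonneg by (intro add_mono mult_left_mono order_refl)
  also have "\<dots> = 2 * ?K"
  proof -
    have "norm cost + \<tau> * norm W = (1 - \<gamma>) * ?K" using gamma_less_1 by simp
    then show ?thesis by (simp only: left_diff_distrib)
  qed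
  finally show ?thesis by simp
qed

lemma drift_diff: "drift W - drift Y = lift_fst (val W - val Y) - \<gamma> *\<^sub>R transition (val W - val Y) - \<tau> *\<^sub>R (W - Y)"
  by (simp add: drift_def lift_fst_diff transition_diff algebra_simps)

lemma norm_drift_diff_le:
  assumes "normalised W" "norm W \<le> R" "normalised Y" "norm Y \<le> R"
  shows "norm (drift W - drift Y) \<le> (2 * val_lip R * exp R + \<tau>) * norm (W - Y)"
proof -
  let ?v = "val W - val Y"
  have R: "0 \<le> R" using assms(2) norm_ge_zero order_trans by blast
  have l: "norm (lift_fst ?v :: ('s \<times> 'a) bmeas) \<le> norm ?v" by (rule norm_lift_fst_le)
  have "norm (drift W - drift Y) \<le> norm ?v + \<gamma> * norm ?v + \<tau> * norm (W - Y)"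
    unfolding drift_diff
    using norm_triangle_ineq4[of "lift_fst ?v - \<gamma> *\<^sub>R transition ?v" "\<tau> *\<^sub>R (W - Y)"]
      norm_triangle_ineq4[of "lift_fst ?v" "\<gamma> *\<^sub>R transition ?v"] tau_pos gamma_nonneg
      mult_left_mono[OF norm_transition_le[of ?v] gamma_nonneg] l
    by simp
  also have "\<dots> \<le> 2 * norm ?v + \<tau> * norm (W - Y)"
    using gamma_less_1 mult_right_mono[of \<gamma> 1 "norm ?v"] by simp
  also have "\<dots> \<le> 2 * (val_lip R * (exp R * norm (W - Y))) + \<tau> * norm (W - Y)"
  proof -
    have "0 \<le> val_lip R" using R tau_pos gamma_less_1 by (simp add: val_lip_def)
    then show ?thesis
      using norm_val_diff_le[OF assms] mult_left_mono[OF tv_dist_le[OF assms(2,4)], of "val_lip R"] by linarith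
  qed
  also have "\<dots> = (2 * val_lip R * exp R + \<tau>) * norm (W - Y)" by (simp add: algebra_simps)
  finally show ?thesis .
qed

lemma drift_normalise_locally_lipschitz:
  "\<exists>L. \<forall>Z Y. norm Z \<le> R \<longrightarrow> norm Y \<le> R \<longrightarrow>
    norm (drift (normalise Z) - drift (normalise Y)) \<le> L * norm (Z - Y)"
proof (cases "0 \<le> R")
  case True
  let ?K = "2 * val_lip (2 * R) * exp (2 * R) + \<tau>"
  have K: "0 \<le> ?K" using True tau_pos gamma_less_1 by (simp add: val_lip_def)
  have "norm (drift (normalise Z) - drift (normalise Y)) \<le> (2 * ?K) * norm (Z - Y)"
    if "norm Z \<le> R" "norm Y \<le> R" for Z Y :: "('s \<times> 'a) bmeas"
  proof -
    have "norm (normalise Z) \<le> 2 * R" "norm (normalise Y) \<le> 2 * R"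
      using norm_normalise_le[of Z] norm_normalise_le[of Y] that by linarith+
    then have "norm (drift (normalise Z) - drift (normalise Y)) \<le> ?K * norm (normalise Z - normalise Y)"
      by (intro norm_drift_diff_le) auto
    also have "\<dots> \<le> ?K * (2 * norm (Z - Y))"
      by (intro mult_left_mono norm_normalise_diff_le K)
    also have "\<dots> = (2 * ?K) * norm (Z - Y)" by simp
    finally show ?thesis .
  qed
  then show ?thesis by blast
next
  case False
  then show ?thesis using norm_ge_zero order_trans by blast
qed

lemma norm_drift_normalise_le:
  "norm (drift (normalise Z)) \<le> (2 * norm cost + 4 * \<tau>) / (1 - \<gamma>) * (1 + norm Z)"
proof -
  have "norm (drift (normalise Z)) \<le> 2 * (norm cost + \<tau> * norm (normalise Z)) / (1 - \<gamma>)"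
    by (rule norm_drift_le) simp
  also have "\<dots> \<le> 2 * (norm cost + \<tau> * (2 * norm Z)) / (1 - \<gamma>)"
    using norm_normalise_le[of Z] tau_pos gamma_less_1 by (intro divide_right_mono mult_left_mono add_mono) auto
  also have "\<dots> \<le> (2 * norm cost + 4 * \<tau>) * (1 + norm Z) / (1 - \<gamma>)"
    using gamma_less_1 tau_pos by (intro divide_right_mono) (auto simp: algebra_simps)
  finally show ?thesis by simp
qed

subsection \<open>The flow of log-densities\<close>

text \<open>The policy depends on Z only through \<open>normalise Z\<close>, while the equation
  contains \<tau> Z. Since Z = normalise Z + log_partition Z, the part of this term missing from
  \<open>drift\<close> is the one subtracted here.\<close>

definition log_flow :: "('s \<times> 'a) bmeas \<Rightarrow> ('s \<times> 'a) bmeas" where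
  "log_flow Z = drift (normalise Z) - \<tau> *\<^sub>R log_partition Z"

lemma apply_log_flow:
  "apply_bmeas (log_flow Z) (s, a) =
    - (Q P c \<gamma> \<mu> \<tau> (softmax \<mu> Z) s a + \<tau> * apply_bmeas Z (s, a) - V P c \<gamma> \<mu> \<tau> (softmax \<mu> Z) s)"
proof -
  have "softmax \<mu> Z = softmax \<mu> (normalise Z)" by (rule softmax_normalise[symmetric])
  then show ?thesis
    by (simp add: Q_eq V_eq_val log_flow_def drift_def del: apply_transition apply_log_partition)
       (simp add: normalise_def algebra_simps)
qed

theorem ex1_log_flow:
  "\<exists>!Z. Z \<in> C1 {0..} UNIV \<and> Z 0 = Z0 \<and>
    (\<forall>t\<ge>0. \<forall>s a. apply_bmeas (vector_derivative Z (at t within {0..})) (s, a) =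
      - (Q P c \<gamma> \<mu> \<tau> (softmax \<mu> (Z t)) s a + \<tau> * apply_bmeas (Z t) (s, a)
         - V P c \<gamma> \<mu> \<tau> (softmax \<mu> (Z t)) s))"
proof -
  let ?C = "(2 * norm cost + 4 * \<tau>) / (1 - \<gamma>) + \<tau>"
  have lip: "\<exists>L. \<forall>x y. norm x \<le> R \<longrightarrow> norm y \<le> R \<longrightarrow> norm (log_flow x - log_flow y) \<le> L * norm (x - y)" for R
  proof -
    obtain L where L: "\<And>Z Y. norm Z \<le> R \<Longrightarrow> norm Y \<le> R \<Longrightarrow>
        norm (drift (normalise Z) - drift (normalise Y)) \<le> L * norm (Z - Y)"
      using drift_normalise_locally_lipschitz[of R] by blast
    have "norm (log_flow x - log_flow y) \<le> (L + \<tau>) * norm (x - y)" if "norm x \<le> R" "norm y \<le> R" for x y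
    proof -
      have "log_flow x - log_flow y = (drift (normalise x) - drift (normalise y))
          - \<tau> *\<^sub>R (log_partition x - log_partition y)"
        by (simp add: log_flow_def algebra_simps)
      also have "norm \<dots> \<le> norm (drift (normalise x) - drift (normalise y)) + \<tau> * norm (log_partition x - log_partition y)"
        using norm_triangle_ineq4 tau_pos by (metis abs_of_pos norm_scaleR)
      also have "\<dots> \<le> L * norm (x - y) + \<tau> * norm (x - y)"
        using L[OF that] norm_log_partition_diff_le[of x y] tau_pos by (intro add_mono mult_left_mono) auto
      finally show ?thesis by (simp add: algebra_simps)
    qed
    then show ?thesis by blast
  qed
  have growth: "norm (log_flow Z) \<le> ?C * (1 + norm Z)" for Z
  proof -
    have "norm (log_flow Z) \<le> norm (drift (normalise Z)) + \<tau> * norm (log_partition Z)"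
      unfolding log_flow_def using norm_triangle_ineq4 tau_pos by (metis abs_of_pos norm_scaleR)
    also have "\<dots> \<le> (2 * norm cost + 4 * \<tau>) / (1 - \<gamma>) * (1 + norm Z) + \<tau> * (1 + norm Z)"
      using norm_log_partition_le[of Z] tau_pos
      by (intro add_mono norm_drift_normalise_le mult_left_mono) auto
    finally show ?thesis by (simp add: algebra_simps)
  qed
  have C: "0 < ?C" using tau_pos gamma_less_1 by (intro add_nonneg_pos divide_nonneg_pos) auto
  have eq: "x = log_flow Z \<longleftrightarrow> (\<forall>s a. apply_bmeas x (s, a) =
      - (Q P c \<gamma> \<mu> \<tau> (softmax \<mu> Z) s a + \<tau> * apply_bmeas Z (s, a) - V P c \<gamma> \<mu> \<tau> (softmax \<mu> Z) s))" for x Z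
    unfolding apply_log_flow[symmetric] by (auto intro!: bmeas_eqI)
  show ?thesis using ode_ex1_C1[OF lip growth C, of Z0] unfolding eq .
qed

end

subsection \<open>The flow of policies\<close>

context action_space
begin

lemma kernel_of_add: "kernel_of (g + h) = kernel_of g + kernel_of h"
  by (rule bounded_linear.linear[OF bounded_linear_kernel_of, THEN linear_add])

lemma kernel_of_scaleR: "kernel_of (r *\<^sub>R g) = r *\<^sub>R kernel_of g"
  by (rule bounded_linear.linear[OF bounded_linear_kernel_of, THEN linear_scale])

lemma normalise_normalised: "normalised W \<Longrightarrow> normalise W = W"
  by (rule bmeas_eqI) (simp add: normalise_def normalised_def)

end

context mdp
begin

text \<open>The right-hand side of the policy equation as a kernel, with \<mu>-density e^W times the
  drift.\<close>

definition policy_flow :: "('s \<times> 'a) bmeas \<Rightarrow> ('s, 'a) bkernel" where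
  "policy_flow W = kernel_of (bmult (bexp W) (drift W))"

text \<open>The Radon-Nikodym density agrees with e^W only \<mu>-almost everywhere; this is enough
  under an integral against the policy, which is absolutely continuous.\<close>

lemma policy_flow_eq:
  assumes W: "normalised W" and B: "B \<in> sets borel"
  shows "(\<integral>a\<in>B. - (Q P c \<gamma> \<mu> \<tau> (softmax \<mu> W) s a + \<tau> * ln (policy_density \<mu> (softmax \<mu> W) s a)
            - V P c \<gamma> \<mu> \<tau> (softmax \<mu> W) s) \<partial>kernel_measure (softmax \<mu> W) s) =
    apply_bkernel (policy_flow W) s B"
proof -
  let ?N = "density \<mu> (\<lambda>a. ennreal (exp (apply_bmeas W (s, a))))"
  let ?p = "policy_density \<mu> (softmax \<mu> W) s"
  have [measurable]: "B \<in> sets \<mu>" using B by (simp add: sets_mu)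
  have p [measurable]: "?p \<in> borel_measurable \<mu>"
    unfolding policy_density_def[abs_def] by measurable
  have cost_s [measurable]: "(\<lambda>a. c (s, a)) \<in> borel_measurable \<mu>"
    using measurable_section[of cost s] by simp
  have "AE a in ?N. ?p a = exp (apply_bmeas W (s, a))"
    using policy_density_normalised[OF W, of s] by (subst AE_density) (auto elim: eventually_mono)
  then have "(\<integral>a. indicator B a *\<^sub>R - (c (s, a) + \<gamma> * apply_bmeas (transition (val W)) (s, a) + \<tau> * ln (?p a)
      - apply_bmeas (val W) s) \<partial>?N) = (\<integral>a. indicator B a * apply_bmeas (drift W) (s, a) \<partial>?N)"
    by (intro integral_cong_AE)
       (auto simp: drift_def simp del: apply_transition elim!: eventually_mono)
  also have "\<dots> = (\<integral>a. exp (apply_bmeas W (s, a)) * (indicator B a * apply_bmeas (drift W) (s, a)) \<partial>\<mu>)"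
    by (subst integral_density) auto
  also have "\<dots> = apply_bkernel (policy_flow W) s B"
    by (simp add: policy_flow_def apply_kernel_of B mult.left_commute)
  finally show ?thesis
    by (simp add: set_lebesgue_integral_def kernel_measure_normalised[OF W] Q_eq[OF W] V_eq_val[OF W]
        del: apply_transition)
qed

lemma eq_policy_flow_iff:
  assumes W: "normalised W"
  shows "(\<forall>s. \<forall>B\<in>sets borel. apply_bkernel k s B =
      (\<integral>a\<in>B. - (Q P c \<gamma> \<mu> \<tau> (softmax \<mu> W) s a + \<tau> * ln (policy_density \<mu> (softmax \<mu> W) s a)
         - V P c \<gamma> \<mu> \<tau> (softmax \<mu> W) s) \<partial>kernel_measure (softmax \<mu> W) s)) \<longleftrightarrow> k = policy_flow W"
proof -
  have "k = policy_flow W \<longleftrightarrow> (\<forall>s. \<forall>B\<in>sets borel. apply_bkernel k s B = apply_bkernel (policy_flow W) s B)"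
    by (blast intro: bkernel_eqI)
  then show ?thesis by (simp only: policy_flow_eq[OF W] cong: ball_cong)
qed

text \<open>A policy determines W only up to null sets, but the original equation refers to the
  policy alone. This permits replacing W by a bounded version in the uniqueness proof.\<close>

lemma policy_flow_cong:
  assumes "normalised W" "normalised Y" "softmax \<mu> W = softmax \<mu> Y"
  shows "policy_flow W = policy_flow Y"
  using eq_policy_flow_iff[OF assms(1)] eq_policy_flow_iff[OF assms(2)] unfolding assms(3) by blast

lemma avg_drift:
  assumes "normalised W"
  shows "avg W (drift W) = 0"
proof -
  have "drift W = lift_fst (val W) - (cost + \<tau> *\<^sub>R W + \<gamma> *\<^sub>R transition (val W))"
    by (simp add: drift_def algebra_simps)
  then have "avg W (drift W) = val W - bellman W (val W)"
    by (simp only: avg_diff avg_lift_fst[OF assms] bellman_def)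
  then show ?thesis by (simp add: bellman_val[OF assms])
qed

lemma bounded_linear_integral_section: "bounded_linear (\<lambda>g :: ('s \<times> 'a) bmeas. \<integral>a. apply_bmeas g (s, a) \<partial>\<mu>)"
  by (rule bounded_linear_intro[where K=1]) (auto simp: abs_integral_section_le)

lemma ex_policy_flow:
  assumes "\<pi>0 \<in> policies \<mu>"
  shows "\<exists>\<pi>. \<pi> \<in> C1 {0..} (policies \<mu>) \<and> \<pi> 0 = \<pi>0 \<and>
    (\<forall>t\<ge>0. \<exists>W. normalised W \<and> \<pi> t = softmax \<mu> W \<and>
       vector_derivative \<pi> (at t within {0..}) = policy_flow W)"
proof -
  obtain W0 where W0: "normalised W0" "\<pi>0 = softmax \<mu> W0" using policiesE[OF assms] .
  have C: "0 < (2 * norm cost + 4 * \<tau>) / (1 - \<gamma>)"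
    using tau_pos gamma_less_1 by (intro divide_pos_pos add_nonneg_pos) auto
  \<comment> \<open>The estimates for \<open>drift\<close> hold at normalised arguments, so the
    field is first composed with \<open>normalise\<close> to make it locally Lipschitz everywhere.
    Once the solution is seen to stay normalised, the composition changes nothing.\<close>
  obtain z where z0: "z 0 = W0"
    and z: "\<And>t. 0 \<le> t \<Longrightarrow> (z has_vector_derivative drift (normalise (z t))) (at t within {0..})"
    using ode_global_existence[OF drift_normalise_locally_lipschitz norm_drift_normalise_le C] by blast
  have normalised: "normalised (z T)" if T: "0 \<le> T" for T
    unfolding normalised_def
  proof
    fix s
    define y where "y t = (\<integral>a. apply_bmeas (bexp (z t)) (s, a) \<partial>\<mu>)" for t
    have y': "(y has_vector_derivative 0) (at t within {0..T})" if t: "t \<in> {0..T}" for t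
    proof -
      have "(z has_vector_derivative drift (normalise (z t))) (at t within {0..T})"
        by (rule has_vector_derivative_within_subset[OF z]) (use t in auto)
      from bounded_linear.has_vector_derivative[OF bounded_linear_integral_section has_vector_derivative_bexp[OF this]]
      have "(y has_vector_derivative (\<integral>a. apply_bmeas (bmult (bexp (z t)) (drift (normalise (z t)))) (s, a) \<partial>\<mu>)) (at t within {0..T})"
        unfolding y_def .
      \<comment> \<open>As normalisation is still open here, e^z is written as y times the density
        of \<open>normalise z\<close>; then y' is y times a policy average of the drift, which is
        zero.\<close>
      moreover have "(\<integral>a. apply_bmeas (bmult (bexp (z t)) (drift (normalise (z t)))) (s, a) \<partial>\<mu>) =
          (\<integral>a. y t * (exp (apply_bmeas (normalise (z t)) (s, a)) * apply_bmeas (drift (normalise (z t))) (s, a)) \<partial>\<mu>)"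
        using integral_exp_section_pos[of "z t" s] by (simp add: exp_normalise y_def)
      moreover have "\<dots> = y t * apply_bmeas (avg (normalise (z t)) (drift (normalise (z t)))) s"
        by simp
      ultimately show ?thesis
        by (simp only: avg_drift[OF normalised_normalise] zero_bmeas.rep_eq mult_zero_right)
    qed
    have "y T - 1 = 0"
    proof (rule has_vector_derivative_zeroI[where f="\<lambda>t. y t - 1" and f'="\<lambda>_. 0" and L=0 and a=0 and b=T])
      show "((\<lambda>t. y t - 1) has_vector_derivative 0) (at t within {0..T})" if "t \<in> {0..T}" for t
        using has_vector_derivative_diff[OF y'[OF that] has_vector_derivative_const[of 1]] by simp
      show "y 0 - 1 = 0" using W0(1) by (simp add: y_def z0 normalised_def)
    qed (use T in auto)
    then show "(\<integral>a. exp (apply_bmeas (z T) (s, a)) \<partial>\<mu>) = 1" by (simp add: y_def)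
  qed
  define \<pi> where "\<pi> = restrict (\<lambda>t. softmax \<mu> (z t)) {0..}"
  have flow: "policy_flow (z t) = kernel_of (bmult (bexp (z t)) (drift (normalise (z t))))" if "0 \<le> t" for t
    by (simp add: policy_flow_def normalise_normalised normalised that)
  have der: "(\<pi> has_vector_derivative policy_flow (z t)) (at t within {0..})" if t: "0 \<le> t" for t
  proof (rule has_vector_derivative_transform)
    show "((\<lambda>t. kernel_of (bexp (z t))) has_vector_derivative policy_flow (z t)) (at t within {0..})"
      unfolding flow[OF t]
      by (intro bounded_linear.has_vector_derivative[OF bounded_linear_kernel_of] has_vector_derivative_bexp z t)
  qed (use t in \<open>auto simp: \<pi>_def softmax_normalised normalised\<close>)
  have contz: "continuous_on {0..} z" by (rule continuous_on_vector_derivative) (use z in auto)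
  have "continuous_on {0..} (\<lambda>t. drift (normalise (z t)))"
    by (rule continuous_on_compose2[OF locally_lipschitz_imp_continuous_on[OF drift_normalise_locally_lipschitz, of UNIV] contz]) auto
  then have "continuous_on {0..} (\<lambda>t. kernel_of (bmult (bexp (z t)) (drift (normalise (z t)))))"
    by (intro bounded_linear.continuous_on[OF bounded_linear_kernel_of]
        bounded_bilinear.continuous_on[OF bounded_bilinear_bmult] continuous_on_bexp contz)
  then have "continuous_on {0..} (\<lambda>t. policy_flow (z t))"
    by (rule continuous_on_eq) (simp add: flow)
  then have "\<pi> \<in> C1 {0..} (policies \<mu>)"
    using der by (auto simp: C1_def \<pi>_def intro!: exI[of _ "\<lambda>t. policy_flow (z t)"])
  moreover have "vector_derivative \<pi> (at t within {0..}) = policy_flow (z t)" if "0 \<le> t" for t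
    by (rule vector_derivative_within_Ici[OF der[OF that] that])
  ultimately show ?thesis
    using normalised W0(2) z0 by (intro exI[of _ \<pi>]) (auto simp: \<pi>_def)
qed

text \<open>Total variation, rather than the sup norm of W - Y, must stand on the right, as policy
  curves are compared in that norm. The part \<tau> (W - Y) of the drift difference is not small
  pointwise, but its integral is controlled by \<open>integral_abs_diff_le\<close>.\<close>

lemma norm_policy_flow_diff_le:
  assumes W: "normalised W" "norm W \<le> R" and Y: "normalised Y" "norm Y \<le> R"
  shows "norm (policy_flow W - policy_flow Y) \<le>
    (2 * (norm cost + \<tau> * R) / (1 - \<gamma>) + exp R * (2 * val_lip R + \<tau> * exp R)) * tv_dist W Y"
proof -
  let ?D = "tv_dist W Y" and ?K = "2 * (norm cost + \<tau> * R) / (1 - \<gamma>)" and ?v = "val W - val Y"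
  have D: "0 \<le> ?D" by (simp add: tv_dist_def)
  have R: "0 \<le> R" using W(2) norm_ge_zero order_trans by blast
  have K: "0 \<le> ?K" using R tau_pos gamma_less_1 by (intro divide_nonneg_pos) auto
  have lip: "0 \<le> val_lip R" using R tau_pos gamma_less_1 by (simp add: val_lip_def)
  have d: "norm (drift W) \<le> ?K"
    using order_trans[OF norm_drift_le[OF W(1)] divide_right_mono[of _ "2 * (norm cost + \<tau> * R)" "1 - \<gamma>"]]
      W(2) tau_pos gamma_less_1 by simp
  have eq: "policy_flow W - policy_flow Y = kernel_of (bmult (bexp W) (drift W) - bmult (bexp Y) (drift Y))"
    by (simp add: policy_flow_def kernel_of_diff)
  show ?thesis unfolding eq
  proof (rule norm_kernel_of_le)
    fix s
    let ?d = "\<lambda>a. \<bar>exp (apply_bmeas W (s, a)) - exp (apply_bmeas Y (s, a))\<bar>"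
    let ?w = "\<lambda>a. \<bar>apply_bmeas W (s, a) - apply_bmeas Y (s, a)\<bar>"
    have int: "integrable \<mu> ?d" "integrable \<mu> ?w" by (auto intro!: integrable_abs)
    define F where "F a = apply_bmeas (bmult (bexp W) (drift W) - bmult (bexp Y) (drift Y)) (s, a)" for a
    have "(\<integral>a. \<bar>F a\<bar> \<partial>\<mu>) \<le> (\<integral>a. ?K * ?d a + exp R * (2 * norm ?v + \<tau> * ?w a) \<partial>\<mu>)"
    proof (rule integral_mono)
      fix a :: 'a
      let ?x = "(s, a)"
      have v: "\<bar>apply_bmeas ?v s\<bar> \<le> norm ?v" "\<bar>apply_bmeas (transition ?v) ?x\<bar> \<le> norm ?v"
        using abs_apply_bmeas_le_norm[of ?v s]
          order_trans[OF abs_apply_bmeas_le_norm[of "transition ?v" ?x] norm_transition_le] by auto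
      have dd: "\<bar>apply_bmeas (drift W - drift Y) ?x\<bar> \<le> 2 * norm ?v + \<tau> * ?w a"
      proof -
        have d_eq: "apply_bmeas (drift W - drift Y) ?x = apply_bmeas ?v s - \<gamma> * apply_bmeas (transition ?v) ?x
            - \<tau> * (apply_bmeas W ?x - apply_bmeas Y ?x)"
          unfolding drift_diff by (simp del: apply_transition)
        have "\<bar>apply_bmeas (drift W - drift Y) ?x\<bar> \<le> \<bar>apply_bmeas ?v s\<bar> + \<gamma> * \<bar>apply_bmeas (transition ?v) ?x\<bar> + \<tau> * ?w a"
          using abs_triangle_ineq4[of "apply_bmeas ?v s - \<gamma> * apply_bmeas (transition ?v) ?x" "\<tau> * (apply_bmeas W ?x - apply_bmeas Y ?x)"]
            abs_triangle_ineq4[of "apply_bmeas ?v s" "\<gamma> * apply_bmeas (transition ?v) ?x"] gamma_nonneg tau_pos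
          unfolding abs_mult d_eq by simp
        also have "\<dots> \<le> norm ?v + 1 * norm ?v + \<tau> * ?w a"
          using v gamma_nonneg gamma_less_1 by (intro add_mono mult_mono order_refl) auto
        finally show ?thesis by simp
      qed
      have F_eq: "F a = (exp (apply_bmeas W ?x) - exp (apply_bmeas Y ?x)) * apply_bmeas (drift W) ?x
            + exp (apply_bmeas Y ?x) * apply_bmeas (drift W - drift Y) ?x"
        unfolding F_def by (simp add: algebra_simps)
      have "\<bar>F a\<bar> \<le> ?d a * \<bar>apply_bmeas (drift W) ?x\<bar> + exp (apply_bmeas Y ?x) * \<bar>apply_bmeas (drift W - drift Y) ?x\<bar>"
        unfolding F_eq by (rule order_trans[OF abs_triangle_ineq]) (simp only: abs_mult abs_exp_cancel order_refl)
      also have "\<dots> \<le> ?d a * ?K + exp R * (2 * norm ?v + \<tau> * ?w a)"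
      proof (intro add_mono mult_mono dd order_refl)
        show "\<bar>apply_bmeas (drift W) ?x\<bar> \<le> ?K" using abs_apply_bmeas_le_norm d by (rule order_trans)
        show "exp (apply_bmeas Y ?x) \<le> exp R" using abs_apply_bmeas_le_norm[of Y ?x] Y(2) by simp
      qed (use tau_pos in auto)
      finally show "\<bar>F a\<bar> \<le> ?K * ?d a + exp R * (2 * norm ?v + \<tau> * ?w a)" by (simp only: mult_ac)
    next
      show "integrable \<mu> (\<lambda>a. \<bar>F a\<bar>)"
        unfolding F_def by (intro integrable_abs integrable_section)
    qed (intro Bochner_Integration.integrable_add integrable_mult_right int integrable_const)
    also have "\<dots> = ?K * (\<integral>a. ?d a \<partial>\<mu>) + exp R * (2 * norm ?v + \<tau> * (\<integral>a. ?w a \<partial>\<mu>))"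
      using int by simp
    also have "\<dots> \<le> ?K * ?D + exp R * (2 * (val_lip R * ?D) + \<tau> * (exp R * ?D))"
    proof (intro add_mono mult_left_mono)
      show "(\<integral>a. ?d a \<partial>\<mu>) \<le> ?D" by (rule integral_abs_exp_diff_le)
      show "(\<integral>a. ?w a \<partial>\<mu>) \<le> exp R * ?D" by (rule integral_abs_diff_le[OF W(2) Y(2)])
      show "norm ?v \<le> val_lip R * ?D" by (rule norm_val_diff_le[OF W Y])
    qed (use tau_pos K in auto)
    also have "\<dots> = (?K + exp R * (2 * val_lip R + \<tau> * exp R)) * ?D" by (simp only: algebra_simps)
    finally show "(\<integral>a. \<bar>apply_bmeas (bmult (bexp W) (drift W) - bmult (bexp Y) (drift Y)) (s, a)\<bar> \<partial>\<mu>)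
        \<le> (?K + exp R * (2 * val_lip R + \<tau> * exp R)) * ?D" unfolding F_def .
  qed (use K lip D tau_pos in \<open>auto intro!: mult_nonneg_nonneg add_nonneg_nonneg\<close>)
qed

end

subsection \<open>Uniqueness of the flow of policies\<close>

text \<open>After the last time with y \<le> K the function would stay above K, where its derivative
  is nonpositive; the mean value theorem then forbids a larger end value.\<close>

lemma has_real_derivative_upper_barrier:
  fixes y :: "real \<Rightarrow> real"
  assumes y': "\<And>t. t \<in> {a..b} \<Longrightarrow> (y has_vector_derivative y' t) (at t within {a..b})"
    and start: "y a \<le> K" and barrier: "\<And>t. t \<in> {a..b} \<Longrightarrow> K < y t \<Longrightarrow> y' t \<le> 0"
    and t: "t \<in> {a..b}"
  shows "y t \<le> K"
proof (rule ccontr)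
  assume "\<not> y t \<le> K"
  then have yt: "K < y t" by simp
  have cont: "continuous_on {a..b} y" by (rule continuous_on_vector_derivative[OF y'])
  define S where "S = {x \<in> {a..t}. y x \<le> K}"
  have "compact S"
  proof -
    have "continuous_on {a..t} y" by (rule continuous_on_subset[OF cont]) (use t in auto)
    then have "closedin (top_of_set {a..t}) ({a..t} \<inter> y -` {..K})"
      by (rule continuous_closedin_preimage) simp
    moreover have "{a..t} \<inter> y -` {..K} = S" by (auto simp: S_def)
    ultimately show ?thesis by (auto intro: closedin_compact)
  qed
  moreover have "a \<in> S" using start t by (auto simp: S_def)
  ultimately obtain t0 where t0: "t0 \<in> S" "\<And>x. x \<in> S \<Longrightarrow> x \<le> t0"
    using compact_attains_sup[of S] by auto
  have lt: "a \<le> t0" "t0 < t" "y t0 \<le> K" using t0(1) yt by (auto simp: S_def less_le)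
  have "continuous_on {t0..t} y" by (rule continuous_on_subset[OF cont]) (use lt t in auto)
  moreover have "(y has_derivative (\<lambda>h. h *\<^sub>R y' x)) (at x)" if "t0 < x" "x < t" for x
    using y'[of x] that lt t by (simp add: at_within_Icc_at has_vector_derivative_def)
  ultimately obtain x where x: "t0 < x" "x < t" "y t - y t0 = (t - t0) *\<^sub>R y' x"
    using mvt[OF lt(2), of y "\<lambda>x h. h *\<^sub>R y' x"] by blast
  have "x \<notin> S" using t0(2) x(1) by force
  then have "K < y x" using x lt by (auto simp: S_def)
  then have "y' x \<le> 0" using barrier[of x] x lt t by auto
  then have "y t - y t0 \<le> 0" using x lt by (simp add: mult_nonneg_nonpos)
  then show False using yt lt by linarith
qed

text \<open>With the integrating factor exp (k (t - a)) the product becomes nondecreasing; its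
  negative is an instance of the upper barrier.\<close>

lemma exponential_lower_bound:
  fixes y :: "real \<Rightarrow> real"
  assumes y': "\<And>t. t \<in> {a..b} \<Longrightarrow> (y has_vector_derivative y' t) (at t within {a..b})"
    and lower: "\<And>t. t \<in> {a..b} \<Longrightarrow> - k * y t \<le> y' t"
    and t: "t \<in> {a..b}"
  shows "y a * exp (- k * (t - a)) \<le> y t"
proof -
  have "- (y t * exp (k * (t - a))) \<le> - (y a * exp (k * (a - a)))"
  proof (rule has_real_derivative_upper_barrier[where y="\<lambda>t. - (y t * exp (k * (t - a)))"
        and y'="\<lambda>t. - ((y' t + k * y t) * exp (k * (t - a)))" and a=a and b=b])
    show "((\<lambda>t. - (y t * exp (k * (t - a)))) has_vector_derivative - ((y' t + k * y t) * exp (k * (t - a))))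
        (at t within {a..b})" if "t \<in> {a..b}" for t
      using y'[OF that] unfolding has_real_derivative_iff_has_vector_derivative[symmetric]
      by (auto intro!: derivative_eq_intros simp: algebra_simps)
    show "- ((y' t + k * y t) * exp (k * (t - a))) \<le> 0" if "t \<in> {a..b}" for t
      using lower[OF that] by simp
  qed (use t in auto)
  then have "y a \<le> y t * exp (k * (t - a))" by simp
  then have "y a * exp (- k * (t - a)) \<le> (y t * exp (k * (t - a))) * exp (- k * (t - a))"
    by (intro mult_right_mono) auto
  also have "\<dots> = y t" by (simp add: mult.assoc mult_exp_exp)
  finally show ?thesis .
qed

section \<open>From masses of sets to almost sure bounds on densities\<close>

context action_space
begin

lemma kernel_of_mono_AE:
  fixes g h :: "('s::polish_space \<times> 'a) bmeas"
  assumes B: "B \<in> sets borel" and "AE a in \<mu>. a \<in> B \<longrightarrow> apply_bmeas g (s, a) \<le> apply_bmeas h (s, a)"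
  shows "apply_bkernel (kernel_of g) s B \<le> apply_bkernel (kernel_of h) s B"
  unfolding apply_kernel_of[OF B]
  by (rule integral_mono_AE[OF integrable_section_indicator[OF B] integrable_section_indicator[OF B]])
     (use assms(2) in \<open>auto simp: indicator_def elim!: eventually_mono\<close>)

text \<open>Test on the set {h < g}: there g - h is positive, yet its integral is at most 0, so the
  set is null.\<close>

lemma AE_le_of_kernel_of_le:
  fixes g h :: "('s::polish_space \<times> 'a) bmeas"
  assumes "\<And>B. B \<in> sets borel \<Longrightarrow> apply_bkernel (kernel_of g) s B \<le> apply_bkernel (kernel_of h) s B"
  shows "AE a in \<mu>. apply_bmeas g (s, a) \<le> apply_bmeas h (s, a)"
proof -
  define B where "B = {a. apply_bmeas h (s, a) < apply_bmeas g (s, a)}"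
  have "B = {a \<in> space \<mu>. apply_bmeas h (s, a) < apply_bmeas g (s, a)}" by (simp add: B_def)
  also have "\<dots> \<in> sets \<mu>" by measurable
  finally have B: "B \<in> sets borel" by (simp add: sets_mu)
  let ?f = "\<lambda>a. indicator B a * apply_bmeas (g - h) (s, a)"
  have int: "integrable \<mu> ?f" using B by (rule integrable_section_indicator)
  have nonneg: "AE a in \<mu>. 0 \<le> ?f a" by (auto simp: B_def indicator_def)
  have "(\<integral>a. ?f a \<partial>\<mu>) \<le> 0"
    using assms[OF B] by (simp add: apply_kernel_of[OF B, symmetric] kernel_of_diff del: minus_bmeas.rep_eq)
  then have "(\<integral>a. ?f a \<partial>\<mu>) = 0" using integral_nonneg_AE[OF nonneg] by linarith
  then have "AE a in \<mu>. ?f a = 0" using integral_nonneg_eq_0_iff_AE[OF int nonneg] by simp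
  then show ?thesis by eventually_elim (auto simp: B_def indicator_def split: if_splits)
qed

lemma kernel_of_one: "B \<in> sets borel \<Longrightarrow> apply_bkernel (kernel_of (bexp 0)) s B = prob B"
  by (simp add: apply_kernel_of sets_mu)

lemma kernel_of_bexp_UNIV: "normalised W \<Longrightarrow> apply_bkernel (kernel_of (bexp W)) s UNIV = 1"
  by (simp add: apply_kernel_of normalised_def)

lemma kernel_of_Compl:
  fixes g :: "('s::polish_space \<times> 'a) bmeas"
  assumes B: "B \<in> sets borel"
  shows "apply_bkernel (kernel_of g) s B + apply_bkernel (kernel_of g) s (- B) = apply_bkernel (kernel_of g) s UNIV"
proof -
  have B': "- B \<in> sets borel" using B by simp
  have "apply_bkernel (kernel_of g) s B + apply_bkernel (kernel_of g) s (- B) =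
      (\<integral>a. indicator B a * apply_bmeas g (s, a) + indicator (- B) a * apply_bmeas g (s, a) \<partial>\<mu>)"
    using B B' by (simp add: apply_kernel_of)
  also have "\<dots> = (\<integral>a. apply_bmeas g (s, a) \<partial>\<mu>)"
    by (rule Bochner_Integration.integral_cong) (auto simp: indicator_def)
  finally show ?thesis by (simp add: apply_kernel_of)
qed

text \<open>Log-densities get bounded only \<mu>-almost everywhere, whereas the norm is a true
  supremum. Under such a bound, clamping alters W on a null set for each state and so keeps the
  policy.\<close>

definition clamp :: "real \<Rightarrow> ('s::polish_space \<times> 'a) bmeas \<Rightarrow> ('s \<times> 'a) bmeas" where
  "clamp R W = Bmeas (\<lambda>x. max (- R) (min R (apply_bmeas W x)))"

lemma apply_clamp [simp]:
  assumes "0 \<le> R"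
  shows "apply_bmeas (clamp R W) x = max (- R) (min R (apply_bmeas W x))"
  unfolding clamp_def by (subst apply_Bmeas[of _ R]) (use assms in \<open>auto simp: abs_le_iff\<close>)

lemma norm_clamp_le: "0 \<le> R \<Longrightarrow> norm (clamp R W) \<le> R"
  by (rule norm_bmeas_le) (auto simp: abs_le_iff)

lemma
  fixes W :: "('s::polish_space \<times> 'a) bmeas"
  assumes W: "normalised W" and R: "0 \<le> R"
    and bounds: "\<And>s. AE a in \<mu>. - R \<le> apply_bmeas W (s, a) \<and> apply_bmeas W (s, a) \<le> R"
  shows normalised_clamp: "normalised (clamp R W)"
    and softmax_clamp: "softmax \<mu> (clamp R W) = softmax \<mu> W"
proof -
  have eq: "AE a in \<mu>. apply_bmeas (clamp R W) (s, a) = apply_bmeas W (s, a)" for s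
    using bounds[of s] by eventually_elim (use R in auto)
  have int: "(\<integral>a. exp (apply_bmeas (clamp R W) (s, a)) \<partial>\<mu>) = (\<integral>a. exp (apply_bmeas W (s, a)) \<partial>\<mu>)" for s
    by (rule integral_cong_AE) (use eq[of s] in \<open>auto simp del: apply_clamp elim!: eventually_mono\<close>)
  show n: "normalised (clamp R W)" using W unfolding normalised_def int .
  show "softmax \<mu> (clamp R W) = softmax \<mu> W"
    unfolding softmax_normalised[OF n] softmax_normalised[OF W]
  proof (rule bkernel_eqI)
    fix s and B :: "'a set" assume B: "B \<in> sets borel"
    show "apply_bkernel (kernel_of (bexp (clamp R W))) s B = apply_bkernel (kernel_of (bexp W)) s B"
      by (rule antisym; rule kernel_of_mono_AE[OF B])
         (use eq[of s] in \<open>auto simp del: apply_clamp elim!: eventually_mono\<close>)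
  qed
qed

end

section \<open>A priori bounds for solutions in total variation\<close>

context mdp
begin

text \<open>Relative entropy is nonnegative, by x - 1 \<le> x ln x with x = e^W. Hence the infimum l
  of the value satisfies l \<ge> - norm cost + \<gamma> l.\<close>

lemma val_lower_bound:
  assumes W: "normalised W"
  shows "- norm cost / (1 - \<gamma>) \<le> apply_bmeas (val W) s"
proof -
  define l where "l = (INF s. apply_bmeas (val W) s)"
  have bdd: "bdd_below (range (apply_bmeas (val W)))"
    using bounded_apply_bmeas[of "val W"] by (rule bounded_imp_bdd_below)
  have l: "l \<le> apply_bmeas (val W) s" for s unfolding l_def by (rule cINF_lower[OF bdd]) simp
  have "- norm cost + \<gamma> * l \<le> apply_bmeas (val W) s" for s
  proof -
    have entropy: "0 \<le> (\<integral>a. exp (apply_bmeas W (s, a)) * apply_bmeas W (s, a) \<partial>\<mu>)"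
    proof -
      have "(\<integral>a. exp (apply_bmeas W (s, a)) - 1 \<partial>\<mu>) \<le> (\<integral>a. exp (apply_bmeas W (s, a)) * apply_bmeas W (s, a) \<partial>\<mu>)"
      proof (rule integral_mono)
        fix a :: 'a
        have "exp (apply_bmeas W (s, a)) * (1 + - apply_bmeas W (s, a)) \<le> exp (apply_bmeas W (s, a)) * exp (- apply_bmeas W (s, a))"
          by (intro mult_left_mono exp_ge_add_one_self) simp
        then show "exp (apply_bmeas W (s, a)) - 1 \<le> exp (apply_bmeas W (s, a)) * apply_bmeas W (s, a)"
          by (simp add: mult_exp_exp algebra_simps)
      qed auto
      then show ?thesis using W by (simp add: normalised_def)
    qed
    let ?k = "- norm cost + \<gamma> * l"
    have "?k = apply_bmeas (avg W (lift_fst (Bmeas (\<lambda>_. ?k)))) s"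
      unfolding avg_lift_fst[OF W] by (subst apply_Bmeas[of _ "\<bar>?k\<bar>"]) auto
    also have "\<dots> \<le> apply_bmeas (avg W (cost + \<gamma> *\<^sub>R transition (val W))) s"
    proof (rule avg_mono[OF W])
      fix a
      have "- norm cost \<le> apply_bmeas cost (s, a)" using abs_apply_bmeas_le_norm[of cost "(s, a)"] by linarith
      moreover have "\<gamma> * l \<le> \<gamma> * apply_bmeas (transition (val W)) (s, a)"
        by (intro mult_left_mono transition_ge l gamma_nonneg)
      ultimately have "?k \<le> apply_bmeas (cost + \<gamma> *\<^sub>R transition (val W)) (s, a)"
        by (simp del: apply_transition apply_cost)
      moreover have "apply_bmeas (lift_fst (Bmeas (\<lambda>_. ?k))) (s, a) = ?k"
        by (simp, subst apply_Bmeas[of _ "\<bar>?k\<bar>"], auto)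
      ultimately show "apply_bmeas (lift_fst (Bmeas (\<lambda>_. ?k))) (s, a) \<le> apply_bmeas (cost + \<gamma> *\<^sub>R transition (val W)) (s, a)"
        by linarith
    qed
    also have "\<dots> \<le> apply_bmeas (avg W (cost + \<gamma> *\<^sub>R transition (val W))) s + \<tau> * apply_bmeas (avg W W) s"
      using entropy tau_pos by simp
    also have "\<dots> = apply_bmeas (bellman W (val W)) s"
      unfolding bellman_def avg_add avg_scaleR by (simp del: apply_avg)
    finally show ?thesis by (simp only: bellman_val[OF W])
  qed
  then have "- norm cost + \<gamma> * l \<le> l" unfolding l_def by (intro cINF_greatest) auto
  then have "- norm cost / (1 - \<gamma>) \<le> l" using gamma_less_1 by (subst pos_divide_le_eq) (auto simp: algebra_simps)
  then show ?thesis using l order_trans by blast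
qed

text \<open>
  A large value at some state would make the drift large on a set carrying at least half of the
  policy's mass, against the bound \<open>M\<close> on the total variation of the flow.
\<close>

lemma val_upper_bound:
  assumes W: "normalised W" and K: "0 < K" and M: "norm (policy_flow W) \<le> M"
    and dens: "\<And>s B. B \<in> sets borel \<Longrightarrow> apply_bkernel (kernel_of (bexp W)) s B \<le> K * prob B + 1 / 4"
  shows "apply_bmeas (val W) s \<le> (2 * M + norm cost + \<tau> * ln (4 * K)) / (1 - \<gamma>)"
proof -
  define u where "u = (SUP s. apply_bmeas (val W) s)"
  have bdd: "bdd_above (range (apply_bmeas (val W)))"
    using bounded_apply_bmeas[of "val W"] by (rule bounded_imp_bdd_above)
  have u: "apply_bmeas (val W) s \<le> u" for s unfolding u_def by (rule cSUP_upper[OF _ bdd]) simp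
  have M0: "0 \<le> M" using M norm_ge_zero order_trans by blast
  let ?X = "norm cost + \<gamma> * u + \<tau> * ln (4 * K)"
  have "apply_bmeas (val W) s \<le> 2 * M + ?X" for s
  proof (rule ccontr)
    assume "\<not> apply_bmeas (val W) s \<le> 2 * M + ?X"
    then have big: "2 * M < apply_bmeas (val W) s - ?X" by simp
    \<comment> \<open>Off \<open>B\<close> the density exceeds 4K, so the mass q of the complement
      satisfies 4 K \<mu>(-B) \<le> q \<le> K \<mu>(-B) + 1/4, which forces q \<le> 1/3.\<close>
    define B where "B = {a. apply_bmeas W (s, a) \<le> ln (4 * K)}"
    have "B = {a \<in> space \<mu>. apply_bmeas W (s, a) \<le> ln (4 * K)}" by (simp add: B_def)
    also have "\<dots> \<in> sets \<mu>" by measurable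
    finally have B: "B \<in> sets borel" by (simp add: sets_mu)
    then have B': "- B \<in> sets borel" by simp
    let ?p = "apply_bkernel (kernel_of (bexp W)) s"
    have "apply_bkernel (kernel_of ((4 * K) *\<^sub>R bexp 0)) s (- B) \<le> ?p (- B)"
    proof (rule kernel_of_mono_AE[OF B'], rule AE_I2, rule impI)
      fix a assume "a \<in> - B"
      then have "exp (ln (4 * K)) \<le> exp (apply_bmeas W (s, a))" by (simp only: exp_le_cancel_iff) (simp add: B_def)
      then show "apply_bmeas ((4 * K) *\<^sub>R bexp 0) (s, a) \<le> apply_bmeas (bexp W) (s, a)" using K by simp
    qed
    then have "4 * K * prob (- B) \<le> ?p (- B)"
      using B' by (simp add: kernel_of_scaleR kernel_of_one)
    moreover have "?p B + ?p (- B) = 1" using kernel_of_Compl[OF B, of "bexp W" s] kernel_of_bexp_UNIV[OF W, of s] by simp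
    moreover have "0 \<le> ?p B" by (rule kernel_of_bexp_nonneg)
    moreover have "?p (- B) \<le> K * prob (- B) + 1 / 4" by (rule dens[OF B'])
    ultimately have half: "1 / 2 \<le> ?p B" by linarith
    \<comment> \<open>On \<open>B\<close> the term \<tau> W is at most \<tau> ln (4K), so the drift
      is at least v(s) - X. Integrated over at least half of the mass, this stays below M, whence
      v(s) \<le> 2 M + X; the \<gamma> u inside X is absorbed after passing to the supremum.\<close>
    have "apply_bkernel (kernel_of ((apply_bmeas (val W) s - ?X) *\<^sub>R bexp W)) s B \<le> apply_bkernel (policy_flow W) s B"
      unfolding policy_flow_def
    proof (rule kernel_of_mono_AE[OF B], rule AE_I2, rule impI)
      fix a assume a: "a \<in> B"
      have "apply_bmeas cost (s, a) \<le> norm cost" using abs_apply_bmeas_le_norm[of cost "(s, a)"] by linarith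
      moreover have "\<gamma> * apply_bmeas (transition (val W)) (s, a) \<le> \<gamma> * u"
        by (intro mult_left_mono transition_le u gamma_nonneg)
      moreover have "\<tau> * apply_bmeas W (s, a) \<le> \<tau> * ln (4 * K)"
        using a tau_pos by (intro mult_left_mono) (auto simp: B_def)
      ultimately have "apply_bmeas (val W) s - ?X \<le> apply_bmeas (drift W) (s, a)"
        by (simp add: drift_def del: apply_transition apply_cost)
      then have "exp (apply_bmeas W (s, a)) * (apply_bmeas (val W) s - ?X) \<le> exp (apply_bmeas W (s, a)) * apply_bmeas (drift W) (s, a)"
        by (rule mult_left_mono) simp
      then show "apply_bmeas ((apply_bmeas (val W) s - ?X) *\<^sub>R bexp W) (s, a) \<le> apply_bmeas (bmult (bexp W) (drift W)) (s, a)"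
        by (simp add: mult.commute)
    qed
    then have "(apply_bmeas (val W) s - ?X) * ?p B \<le> M"
      using M abs_apply_bkernel_le_norm[of "policy_flow W" s B] by (simp only: kernel_of_scaleR apply_bkernel_simps)
    moreover have "(apply_bmeas (val W) s - ?X) * (1 / 2) \<le> (apply_bmeas (val W) s - ?X) * ?p B"
      using half big M0 by (intro mult_left_mono) auto
    ultimately have "(apply_bmeas (val W) s - ?X) * (1 / 2) \<le> M" by (rule order_trans[rotated])
    then show False using big by simp
  qed
  then have "u \<le> 2 * M + ?X" unfolding u_def by (intro cSUP_least) auto
  then have "u \<le> (2 * M + norm cost + \<tau> * ln (4 * K)) / (1 - \<gamma>)"
    using gamma_less_1 by (simp add: le_divide_eq algebra_simps)
  then show ?thesis using u order_trans by blast
qed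

text \<open>Adding \<tau> W cancels the only part of the drift that a bound on the value does not
  control.\<close>

lemma drift_bounds:
  assumes "norm (val W) \<le> b"
  shows "\<bar>apply_bmeas (drift W) x + \<tau> * apply_bmeas W x\<bar> \<le> norm cost + 2 * b"
proof -
  have "apply_bmeas (drift W) x + \<tau> * apply_bmeas W x =
      apply_bmeas (val W) (fst x) - apply_bmeas cost x - \<gamma> * apply_bmeas (transition (val W)) x"
    by (simp add: drift_def del: apply_transition apply_cost)
  moreover have "\<bar>apply_bmeas (val W) (fst x)\<bar> \<le> b" "\<bar>apply_bmeas cost x\<bar> \<le> norm cost"
    using abs_apply_bmeas_le_norm[of "val W" "fst x"] abs_apply_bmeas_le_norm[of cost x] assms by linarith+
  moreover have "\<bar>\<gamma> * apply_bmeas (transition (val W)) x\<bar> \<le> b"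
  proof -
    have "\<bar>\<gamma> * apply_bmeas (transition (val W)) x\<bar> \<le> 1 * norm (val W)"
      unfolding abs_mult using gamma_nonneg gamma_less_1
        order_trans[OF abs_apply_bmeas_le_norm[of "transition (val W)" x] norm_transition_le]
      by (intro mult_mono) auto
    then show ?thesis using assms by simp
  qed
  ultimately show ?thesis by linarith
qed

text \<open>The concave function -x ln x lies below its tangent at x = e^\<kappa>, which is
  e^\<kappa> - (1 + \<kappa>) x. The result is affine in the density, so integrating over B gives an
  inequality in the masses of B alone.\<close>

lemma bexp_drift_le:
  assumes "\<bar>apply_bmeas (drift W) x + \<tau> * apply_bmeas W x\<bar> \<le> H"
  shows "apply_bmeas (bmult (bexp W) (drift W)) x \<le> (H - \<tau> * (1 + \<kappa>)) * exp (apply_bmeas W x) + \<tau> * exp \<kappa>"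
proof -
  let ?w = "apply_bmeas W x"
  have "exp ?w * (1 + (\<kappa> - ?w)) \<le> exp ?w * exp (\<kappa> - ?w)"
    by (intro mult_left_mono exp_ge_add_one_self) simp
  then have "\<tau> * (exp ?w * (1 + (\<kappa> - ?w))) \<le> \<tau> * exp \<kappa>"
    using tau_pos by (simp add: mult_exp_exp)
  moreover have "exp ?w * apply_bmeas (drift W) x \<le> exp ?w * (H - \<tau> * ?w)"
    using assms by (intro mult_left_mono) (auto simp: abs_le_iff)
  ultimately show ?thesis by (simp add: algebra_simps)
qed

text \<open>\<open>W\<close> selects some normalised log-density at each time, without any
  regularity in t; only \<pi> is a differentiable curve.\<close>

definition flow_on :: "real \<Rightarrow> real \<Rightarrow> real \<Rightarrow> (real \<Rightarrow> ('s, 'a) bkernel) \<Rightarrow> (real \<Rightarrow> ('s \<times> 'a) bmeas) \<Rightarrow> bool" where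
  "flow_on t0 t1 M \<pi> W \<longleftrightarrow> (\<forall>t\<in>{t0..t1}. normalised (W t) \<and> \<pi> t = softmax \<mu> (W t) \<and>
     (\<pi> has_vector_derivative policy_flow (W t)) (at t within {t0..t1}) \<and> norm (policy_flow (W t)) \<le> M)"

lemma flow_on_dist_le:
  assumes flow: "flow_on t0 t1 M \<pi> W" and t: "t \<in> {t0..t1}"
  shows "norm (\<pi> t - \<pi> t0) \<le> M * (t1 - t0)"
proof -
  have "norm (\<pi> t - \<pi> t0) \<le> M * norm (t - t0)"
  proof (rule differentiable_bound[where S="{t0..t1}"])
    show "(\<pi> has_derivative (\<lambda>h. h *\<^sub>R policy_flow (W x))) (at x within {t0..t1})" if "x \<in> {t0..t1}" for x
      using flow that by (simp add: flow_on_def has_vector_derivative_def)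
    show "onorm (\<lambda>h. h *\<^sub>R policy_flow (W x)) \<le> M" if "x \<in> {t0..t1}" for x
    proof (rule onorm_bound)
      have le: "norm (policy_flow (W x)) \<le> M" using flow that by (simp add: flow_on_def)
      then show "0 \<le> M" using norm_ge_zero order_trans by blast
      show "norm (h *\<^sub>R policy_flow (W x)) \<le> M * norm h" for h
        using mult_right_mono[OF le, of "\<bar>h\<bar>"] by (simp add: mult.commute)
    qed
  qed (use t in auto)
  also have "\<dots> \<le> M * (t1 - t0)"
  proof (rule mult_left_mono)
    show "0 \<le> M" using flow t norm_ge_zero order_trans unfolding flow_on_def by blast
  qed (use t in auto)
  finally show ?thesis .
qed

text \<open>
  For a fixed state and a fixed set \<open>B\<close>, the mass \<open>\<pi>\<^sub>t(B|s)\<close> satisfies scalar differential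
  inequalities, by convexity of \<open>x ln x\<close>; comparing it with \<open>\<mu>(B)\<close> bounds the density from
  above and from below.
\<close>

lemma locally_bounded_log_density:
  assumes flow: "flow_on t0 t1 M \<pi> W" and t01: "t0 \<le> t1" and small: "M * (t1 - t0) \<le> 1 / 4"
  shows "\<exists>R. \<forall>t\<in>{t0..t1}. \<exists>Y. normalised Y \<and> norm Y \<le> R \<and> softmax \<mu> Y = softmax \<mu> (W t)"
proof -
  have W: "normalised (W t)" and \<pi>: "\<pi> t = softmax \<mu> (W t)"
    and der: "(\<pi> has_vector_derivative policy_flow (W t)) (at t within {t0..t1})"
    and M: "norm (policy_flow (W t)) \<le> M" if "t \<in> {t0..t1}" for t
    using flow that by (auto simp: flow_on_def)
  have t0: "t0 \<in> {t0..t1}" using t01 by simp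
  have \<pi>': "\<pi> t = kernel_of (bexp (W t))" if "t \<in> {t0..t1}" for t
    using \<pi>[OF that] softmax_normalised[OF W[OF that]] by simp
  define R0 where "R0 = norm (W t0)"
  have R0: "- R0 \<le> apply_bmeas (W t0) x" "apply_bmeas (W t0) x \<le> R0" for x
    using abs_apply_bmeas_le_norm[of "W t0" x] by (auto simp: R0_def)
  have R0_nonneg: "0 \<le> R0" by (simp add: R0_def)
  have init: "exp (- R0) * prob B \<le> apply_bkernel (\<pi> t0) s B" "apply_bkernel (\<pi> t0) s B \<le> exp R0 * prob B"
    if B: "B \<in> sets borel" for s B
  proof -
    have "apply_bkernel (kernel_of (exp (- R0) *\<^sub>R bexp 0)) s B \<le> apply_bkernel (kernel_of (bexp (W t0))) s B"
      "apply_bkernel (kernel_of (bexp (W t0))) s B \<le> apply_bkernel (kernel_of (exp R0 *\<^sub>R bexp 0)) s B"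
      using R0 by (auto intro!: kernel_of_mono_AE[OF B] AE_I2)
    then show "exp (- R0) * prob B \<le> apply_bkernel (\<pi> t0) s B" "apply_bkernel (\<pi> t0) s B \<le> exp R0 * prob B"
      using B by (simp_all add: \<pi>'[OF t0] kernel_of_scaleR kernel_of_one)
  qed
  \<comment> \<open>The initial density is at most exp R0 and total variation moves by at most 1/4:
    the hypothesis of \<open>val_upper_bound\<close> with K = exp R0.\<close>
  have dens: "apply_bkernel (kernel_of (bexp (W t))) s B \<le> exp R0 * prob B + 1 / 4"
    if "t \<in> {t0..t1}" "B \<in> sets borel" for t s B
    using abs_apply_bkernel_le_norm[of "\<pi> t - \<pi> t0" s B] flow_on_dist_le[OF flow that(1)] small
      init(2)[OF that(2), of s] by (simp add: \<pi>'[OF that(1)] abs_le_iff)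
  define b where "b = max ((2 * M + norm cost + \<tau> * ln (4 * exp R0)) / (1 - \<gamma>)) (norm cost / (1 - \<gamma>))"
  have val: "norm (val (W t)) \<le> b" if t: "t \<in> {t0..t1}" for t
  proof (rule norm_bmeas_le)
    fix s
    have "apply_bmeas (val (W t)) s \<le> (2 * M + norm cost + \<tau> * ln (4 * exp R0)) / (1 - \<gamma>)"
      by (rule val_upper_bound[OF W[OF t] _ M[OF t] dens[OF t]]) auto
    moreover have "- norm cost / (1 - \<gamma>) \<le> apply_bmeas (val (W t)) s"
      by (rule val_lower_bound[OF W[OF t]])
    ultimately show "\<bar>apply_bmeas (val (W t)) s\<bar> \<le> b"
      unfolding b_def by (simp add: abs_le_iff) linarith
  qed
  define H where "H = norm cost + 2 * b"
  have H: "\<bar>apply_bmeas (drift (W t)) x + \<tau> * apply_bmeas (W t) x\<bar> \<le> H" if "t \<in> {t0..t1}" for t x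
    unfolding H_def by (rule drift_bounds[OF val[OF that]])
  have H_nonneg: "0 \<le> H" using H[OF t0] abs_ge_zero order_trans by blast
  \<comment> \<open>\<kappa> \<ge> R0 places the start below the barrier e^\<kappa> \<mu>(B);
    \<kappa> \<ge> H / \<tau> makes the linear term (H - \<tau> \<kappa>) y nonpositive, so the mass
    cannot grow above the barrier.\<close>
  define \<kappa> where "\<kappa> = max R0 (H / \<tau>)"
  have \<kappa>: "R0 \<le> \<kappa>" "H \<le> \<tau> * \<kappa>" "0 \<le> \<kappa>"
  proof -
    show "R0 \<le> \<kappa>" by (simp add: \<kappa>_def)
    then show "0 \<le> \<kappa>" using R0_nonneg by linarith
    have "H / \<tau> \<le> \<kappa>" by (simp add: \<kappa>_def)
    then show "H \<le> \<tau> * \<kappa>" using tau_pos by (simp add: pos_divide_le_eq mult.commute)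
  qed
  have y': "((\<lambda>t. apply_bkernel (\<pi> t) s B) has_vector_derivative apply_bkernel (policy_flow (W t)) s B)
      (at t within {t0..t1})" if "t \<in> {t0..t1}" for s B t
    by (rule bounded_linear.has_vector_derivative[OF bounded_linear_apply_bkernel der[OF that]])
  have upper: "apply_bkernel (\<pi> t) s B \<le> exp \<kappa> * prob B" if t: "t \<in> {t0..t1}" and B: "B \<in> sets borel" for t s B
  proof (rule has_real_derivative_upper_barrier[OF y' _ _ t])
    have "exp R0 * prob B \<le> exp \<kappa> * prob B" using \<kappa> by (intro mult_right_mono) auto
    then show "apply_bkernel (\<pi> t0) s B \<le> exp \<kappa> * prob B" using init(2)[OF B] order_trans by blast
  next
    fix t assume t: "t \<in> {t0..t1}" and big: "exp \<kappa> * prob B < apply_bkernel (\<pi> t) s B"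
    let ?y = "apply_bkernel (\<pi> t) s B"
    have "apply_bkernel (policy_flow (W t)) s B \<le>
        apply_bkernel (kernel_of ((H - \<tau> * (1 + \<kappa>)) *\<^sub>R bexp (W t) + (\<tau> * exp \<kappa>) *\<^sub>R bexp 0)) s B"
      unfolding policy_flow_def
      by (rule kernel_of_mono_AE[OF B], rule AE_I2, rule impI)
         (use bexp_drift_le[OF H[OF t]] in \<open>simp del: apply_bmult\<close>)
    also have "\<dots> = (H - \<tau> * \<kappa>) * ?y - \<tau> * (?y - exp \<kappa> * prob B)"
      by (simp add: kernel_of_add kernel_of_scaleR kernel_of_one[OF B] \<pi>'[OF t]) (simp add: algebra_simps)
    also have "\<dots> \<le> 0"
    proof -
      have "0 \<le> ?y" unfolding \<pi>'[OF t] by (rule kernel_of_bexp_nonneg)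
      then have "(H - \<tau> * \<kappa>) * ?y \<le> 0" using \<kappa>(2) by (intro mult_nonpos_nonneg) auto
      moreover have "0 \<le> \<tau> * (?y - exp \<kappa> * prob B)" using big tau_pos by (intro mult_nonneg_nonneg) auto
      ultimately show ?thesis by linarith
    qed
    finally show "apply_bkernel (policy_flow (W t)) s B \<le> 0" .
  qed
  have log_upper: "AE a in \<mu>. apply_bmeas (W t) (s, a) \<le> \<kappa>" if t: "t \<in> {t0..t1}" for t s
  proof -
    have "AE a in \<mu>. apply_bmeas (bexp (W t)) (s, a) \<le> apply_bmeas (exp \<kappa> *\<^sub>R bexp 0) (s, a)"
      by (rule AE_le_of_kernel_of_le)
         (use upper[OF t] in \<open>simp add: \<pi>'[OF t] kernel_of_scaleR kernel_of_one\<close>)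
    then show ?thesis by simp
  qed
  \<comment> \<open>Given W \<le> \<kappa> almost everywhere, the drift is at least -H - \<tau>
    \<kappa>, so masses decay at rate at most k. The lower bound thus depends on the upper
    one.\<close>
  define k where "k = H + \<tau> * \<kappa>"
  have k: "0 \<le> k" using H_nonneg \<kappa>(3) tau_pos by (simp add: k_def)
  have lower: "exp (- (R0 + k * (t1 - t0))) * prob B \<le> apply_bkernel (\<pi> t) s B"
    if t: "t \<in> {t0..t1}" and B: "B \<in> sets borel" for t s B
  proof -
    have "apply_bkernel (\<pi> t0) s B * exp (- k * (t - t0)) \<le> apply_bkernel (\<pi> t) s B"
    proof (rule exponential_lower_bound[OF y' _ t])
      fix t assume t: "t \<in> {t0..t1}"
      have "apply_bkernel (kernel_of ((- k) *\<^sub>R bexp (W t))) s B \<le> apply_bkernel (policy_flow (W t)) s B"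
        unfolding policy_flow_def
      proof (rule kernel_of_mono_AE[OF B])
        show "AE a in \<mu>. a \<in> B \<longrightarrow> apply_bmeas ((- k) *\<^sub>R bexp (W t)) (s, a) \<le> apply_bmeas (bmult (bexp (W t)) (drift (W t))) (s, a)"
          using log_upper[OF t, of s]
        proof eventually_elim
          case (elim a)
          have "\<tau> * apply_bmeas (W t) (s, a) \<le> \<tau> * \<kappa>" using elim tau_pos by simp
          then have "- k \<le> apply_bmeas (drift (W t)) (s, a)"
            using H[OF t, of "(s, a)"] by (simp add: k_def abs_le_iff)
          then have "exp (apply_bmeas (W t) (s, a)) * - k \<le> exp (apply_bmeas (W t) (s, a)) * apply_bmeas (drift (W t)) (s, a)"
            by (intro mult_left_mono) auto
          then show ?case by (simp add: mult.commute)
        qed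
      qed
      then show "- k * apply_bkernel (\<pi> t) s B \<le> apply_bkernel (policy_flow (W t)) s B"
        by (simp only: kernel_of_scaleR apply_bkernel_simps \<pi>'[OF t])
    qed
    moreover have "exp (- (R0 + k * (t1 - t0))) * prob B \<le> apply_bkernel (\<pi> t0) s B * exp (- k * (t - t0))"
    proof -
      have "exp (- (R0 + k * (t1 - t0))) * prob B \<le> exp (- (R0 + k * (t - t0))) * prob B"
        using k t by (intro mult_right_mono) (auto intro!: mult_left_mono)
      also have "\<dots> = (exp (- R0) * prob B) * exp (- k * (t - t0))"
      proof -
        have "exp (- (R0 + k * (t - t0))) = exp (- R0) * exp (- k * (t - t0))" by (simp add: mult_exp_exp)
        then show ?thesis by simp
      qed
      also have "\<dots> \<le> apply_bkernel (\<pi> t0) s B * exp (- k * (t - t0))"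
        by (intro mult_right_mono init(1) B) simp
      finally show ?thesis .
    qed
    ultimately show ?thesis by linarith
  qed
  define R where "R = max \<kappa> (R0 + k * (t1 - t0))"
  have R: "0 \<le> R" using \<kappa>(3) by (simp add: R_def le_max_iff_disj)
  show ?thesis
  proof (intro exI ballI conjI)
    fix t assume t: "t \<in> {t0..t1}"
    have bounds: "AE a in \<mu>. - R \<le> apply_bmeas (W t) (s, a) \<and> apply_bmeas (W t) (s, a) \<le> R" for s
    proof -
      have "AE a in \<mu>. apply_bmeas (exp (- (R0 + k * (t1 - t0))) *\<^sub>R bexp 0) (s, a) \<le> apply_bmeas (bexp (W t)) (s, a)"
        by (rule AE_le_of_kernel_of_le)
           (use lower[OF t] in \<open>simp add: \<pi>'[OF t] kernel_of_scaleR kernel_of_one\<close>)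
      with log_upper[OF t, of s] show ?thesis
        by eventually_elim (auto simp: R_def)
    qed
    show "normalised (clamp R (W t))" by (rule normalised_clamp[OF W[OF t] R bounds])
    show "norm (clamp R (W t)) \<le> R" by (rule norm_clamp_le[OF R])
    show "softmax \<mu> (clamp R (W t)) = softmax \<mu> (W t)" by (rule softmax_clamp[OF W[OF t] R bounds])
  qed
qed

text \<open>At each time both log-densities are exchanged for versions bounded by one R, which
  changes neither policies nor flows; the total variation Lipschitz estimate then holds with one
  constant on the interval.\<close>

lemma flow_on_unique:
  assumes flow1: "flow_on t0 t1 M \<pi>1 W1" and flow2: "flow_on t0 t1 M \<pi>2 W2"
    and small: "M * (t1 - t0) \<le> 1 / 4" and init: "\<pi>1 t0 = \<pi>2 t0" and t: "t \<in> {t0..t1}"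
  shows "\<pi>1 t = \<pi>2 t"
proof -
  have t01: "t0 \<le> t1" using t by simp
  obtain R1 R2 where
    R1: "\<And>t. t \<in> {t0..t1} \<Longrightarrow> \<exists>Y. normalised Y \<and> norm Y \<le> R1 \<and> softmax \<mu> Y = softmax \<mu> (W1 t)" and
    R2: "\<And>t. t \<in> {t0..t1} \<Longrightarrow> \<exists>Y. normalised Y \<and> norm Y \<le> R2 \<and> softmax \<mu> Y = softmax \<mu> (W2 t)"
    using locally_bounded_log_density[OF flow1 t01 small] locally_bounded_log_density[OF flow2 t01 small] by blast
  define R where "R = max R1 R2"
  let ?L = "2 * (norm cost + \<tau> * R) / (1 - \<gamma>) + exp R * (2 * val_lip R + \<tau> * exp R)"
  have "\<pi>1 t - \<pi>2 t = 0"
  proof (rule has_vector_derivative_zeroI[where f="\<lambda>t. \<pi>1 t - \<pi>2 t"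
        and f'="\<lambda>t. policy_flow (W1 t) - policy_flow (W2 t)" and L="?L" and a=t0 and b=t1])
    fix t assume t: "t \<in> {t0..t1}"
    show "((\<lambda>t. \<pi>1 t - \<pi>2 t) has_vector_derivative policy_flow (W1 t) - policy_flow (W2 t)) (at t within {t0..t1})"
      using flow1 flow2 t by (intro has_vector_derivative_diff) (auto simp: flow_on_def)
    obtain Y1 where Y1: "normalised Y1" "norm Y1 \<le> R1" "softmax \<mu> Y1 = softmax \<mu> (W1 t)" using R1[OF t] by blast
    obtain Y2 where Y2: "normalised Y2" "norm Y2 \<le> R2" "softmax \<mu> Y2 = softmax \<mu> (W2 t)" using R2[OF t] by blast
    have W: "normalised (W1 t)" "normalised (W2 t)" "\<pi>1 t = softmax \<mu> (W1 t)" "\<pi>2 t = softmax \<mu> (W2 t)"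
      using flow1 flow2 t by (auto simp: flow_on_def)
    have "policy_flow (W1 t) - policy_flow (W2 t) = policy_flow Y1 - policy_flow Y2"
      using policy_flow_cong[OF Y1(1) W(1) Y1(3)] policy_flow_cong[OF Y2(1) W(2) Y2(3)] by simp
    moreover have "norm (policy_flow Y1 - policy_flow Y2) \<le> ?L * tv_dist Y1 Y2"
      by (rule norm_policy_flow_diff_le) (use Y1 Y2 in \<open>auto simp: R_def\<close>)
    moreover have "tv_dist Y1 Y2 = norm (\<pi>1 t - \<pi>2 t)"
      unfolding tv_dist_def W(3,4) Y1(3)[symmetric] Y2(3)[symmetric]
      by (simp add: softmax_normalised Y1(1) Y2(1))
    ultimately show "norm (policy_flow (W1 t) - policy_flow (W2 t)) \<le> ?L * norm (\<pi>1 t - \<pi>2 t)" by simp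
  qed (use init t in auto)
  then show ?thesis by simp
qed

lemma policy_flow_unique:
  assumes \<pi>: "\<pi> \<in> C1 {0..} (policies \<mu>)" and \<rho>: "\<rho> \<in> C1 {0..} (policies \<mu>)" and init: "\<pi> 0 = \<rho> 0"
    and \<pi>': "\<And>t. 0 \<le> t \<Longrightarrow> \<exists>W. normalised W \<and> \<pi> t = softmax \<mu> W \<and> vector_derivative \<pi> (at t within {0..}) = policy_flow W"
    and \<rho>': "\<And>t. 0 \<le> t \<Longrightarrow> \<exists>W. normalised W \<and> \<rho> t = softmax \<mu> W \<and> vector_derivative \<rho> (at t within {0..}) = policy_flow W"
  shows "\<pi> = \<rho>"
proof -
  have eq: "\<pi> T = \<rho> T" if T: "0 \<le> T" for T
  proof -
    have "\<exists>M. \<forall>t\<in>{0..T}. norm (vector_derivative f (at t within {0..})) \<le> M" if "f \<in> C1 {0..} (policies \<mu>)"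
      for f :: "real \<Rightarrow> ('s, 'a) bkernel"
    proof -
      have "continuous_on {0..T} (\<lambda>t. vector_derivative f (at t within {0..}))"
        using that unfolding C1_Ici_iff by (auto intro: continuous_on_subset)
      then have "bounded ((\<lambda>t. vector_derivative f (at t within {0..})) ` {0..T})"
        by (intro compact_imp_bounded compact_continuous_image) auto
      then show ?thesis by (auto simp: bounded_iff)
    qed
    from this[OF \<pi>] this[OF \<rho>] obtain M1 M2 where
      M12: "\<And>t. t \<in> {0..T} \<Longrightarrow> norm (vector_derivative \<pi> (at t within {0..})) \<le> M1"
        "\<And>t. t \<in> {0..T} \<Longrightarrow> norm (vector_derivative \<rho> (at t within {0..})) \<le> M2" by blast
    define M where "M = max 0 (max M1 M2)"
    have "\<exists>W. \<forall>t0 t1. 0 \<le> t0 \<longrightarrow> t1 \<le> T \<longrightarrow> flow_on t0 t1 M f W"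
      if f: "f \<in> {\<pi>, \<rho>}" for f
    proof -
      have fC1: "f \<in> C1 {0..} (policies \<mu>)"
        and f': "\<And>t. 0 \<le> t \<Longrightarrow> \<exists>W. normalised W \<and> f t = softmax \<mu> W \<and> vector_derivative f (at t within {0..}) = policy_flow W"
        using f \<pi> \<rho> \<pi>' \<rho>' by auto
      obtain W where W: "\<And>t. 0 \<le> t \<Longrightarrow> normalised (W t) \<and> f t = softmax \<mu> (W t) \<and>
          vector_derivative f (at t within {0..}) = policy_flow (W t)"
        using f' by metis
      have "flow_on t0 t1 M f W" if "0 \<le> t0" "t1 \<le> T" for t0 t1
        unfolding flow_on_def
      proof (intro ballI conjI)
        fix t assume "t \<in> {t0..t1}"
        then have t: "0 \<le> t" "t \<in> {0..T}" using that by auto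
        show "normalised (W t)" "f t = softmax \<mu> (W t)" using W[OF t(1)] by auto
        have "(f has_vector_derivative policy_flow (W t)) (at t within {0..})"
          using fC1 W[OF t(1)] t(1) unfolding C1_Ici_iff by metis
        then show "(f has_vector_derivative policy_flow (W t)) (at t within {t0..t1})"
          by (rule has_vector_derivative_within_subset) (use that in auto)
        show "norm (policy_flow (W t)) \<le> M"
          using M12[OF t(2)] W[OF t(1)] f by (auto simp: M_def)
      qed
      then show ?thesis by blast
    qed
    then obtain W1 W2 where
      flow: "\<And>t0 t1. 0 \<le> t0 \<Longrightarrow> t1 \<le> T \<Longrightarrow> flow_on t0 t1 M \<pi> W1" "\<And>t0 t1. 0 \<le> t0 \<Longrightarrow> t1 \<le> T \<Longrightarrow> flow_on t0 t1 M \<rho> W2"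
      by (metis insertI1 insertI2 singletonI)
    \<comment> \<open>Chosen so that M \<delta> \<le> 1/4, with M + 1 guarding against M = 0. As M
      bounds both derivatives on all of [0,T], the argument restarts with the same step length at
      every multiple of \<delta>.\<close>
    define \<delta> where "\<delta> = 1 / (4 * (M + 1))"
    have M: "0 \<le> M" by (simp add: M_def)
    then have \<delta>: "0 < \<delta>" "M * \<delta> \<le> 1 / 4" by (auto simp: \<delta>_def field_simps)
    have "\<forall>t\<in>{0..min T (real n * \<delta>)}. \<pi> t = \<rho> t" for n
    proof (induction n)
      case 0
      then show ?case using init by auto
    next
      case (Suc n)
      show ?case
      proof
        fix t assume t: "t \<in> {0..min T (real (Suc n) * \<delta>)}"
        show "\<pi> t = \<rho> t"
        proof (cases "t \<le> real n * \<delta>")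
          case True
          then show ?thesis using Suc t by auto
        next
          case False
          let ?t0 = "real n * \<delta>"
          have t0: "0 \<le> ?t0" "?t0 \<le> T" using \<delta> False t by auto
          have "M * (t - ?t0) \<le> M * \<delta>"
            using M t by (intro mult_left_mono) (auto simp: algebra_simps)
          then have "M * (t - ?t0) \<le> 1 / 4" using \<delta>(2) by linarith
          then show ?thesis
            using flow_on_unique[OF flow(1)[OF t0(1), of t] flow(2)[OF t0(1), of t]] Suc t0 t False by auto
        qed
      qed
    qed
    moreover obtain n where "T / \<delta> < real n" using reals_Archimedean2 by blast
    then have "T \<le> real n * \<delta>" using \<delta>(1) by (simp add: pos_divide_less_eq)
    ultimately show ?thesis using T by (metis atLeastAtMost_iff min.absorb1 order_refl)
  qed
  moreover have "\<pi> T = \<rho> T" if "\<not> 0 \<le> T" for T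
    using that \<pi> \<rho> PiE_arb[of \<pi> "{0..}" "\<lambda>_. policies \<mu>" T] PiE_arb[of \<rho> "{0..}" "\<lambda>_. policies \<mu>" T]
    by (simp add: C1_def)
  ultimately show ?thesis by blast
qed

theorem ex1_policy_flow:
  assumes \<pi>0: "\<pi>0 \<in> policies \<mu>"
  shows "\<exists>!\<pi>. \<pi> \<in> C1 {0..} (policies \<mu>) \<and> \<pi> 0 = \<pi>0 \<and>
    (\<forall>t\<ge>0. \<forall>s. \<forall>B \<in> sets borel. apply_bkernel (vector_derivative \<pi> (at t within {0..})) s B =
       (\<integral>a\<in>B. - (Q P c \<gamma> \<mu> \<tau> (\<pi> t) s a + \<tau> * ln (policy_density \<mu> (\<pi> t) s a) - V P c \<gamma> \<mu> \<tau> (\<pi> t) s)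
         \<partial>kernel_measure (\<pi> t) s))"
proof -
  \<comment> \<open>Passes between the equation, which refers only to the policy, and its form with
    a log-density. From left to right one normalised W is chosen; from right to left any W
    representing the policy will do.\<close>
  have eq: "(\<forall>s. \<forall>B \<in> sets borel. apply_bkernel k s B =
       (\<integral>a\<in>B. - (Q P c \<gamma> \<mu> \<tau> \<rho> s a + \<tau> * ln (policy_density \<mu> \<rho> s a) - V P c \<gamma> \<mu> \<tau> \<rho> s)
         \<partial>kernel_measure \<rho> s)) \<longleftrightarrow> (\<exists>W. normalised W \<and> \<rho> = softmax \<mu> W \<and> k = policy_flow W)"
    (is "?l \<longleftrightarrow> ?r") if \<rho>: "\<rho> \<in> policies \<mu>" for k \<rho>
  proof
    assume ?l
    obtain W where "normalised W" "\<rho> = softmax \<mu> W" by (rule policiesE[OF \<rho>])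
    with \<open>?l\<close> show ?r using eq_policy_flow_iff[of W k] by blast
  next
    assume ?r
    then show ?l using eq_policy_flow_iff by blast
  qed
  have pol: "\<pi> t \<in> policies \<mu>" if "\<pi> \<in> C1 {0..} (policies \<mu>)" "0 \<le> t" for \<pi> :: "real \<Rightarrow> ('s, 'a) bkernel" and t
    using that by (auto simp: C1_def PiE_iff)
  show ?thesis
  proof (rule ex_ex1I)
    obtain \<pi> where \<pi>: "\<pi> \<in> C1 {0..} (policies \<mu>)" "\<pi> 0 = \<pi>0" and
      flow: "\<And>t. 0 \<le> t \<Longrightarrow> \<exists>W. normalised W \<and> \<pi> t = softmax \<mu> W \<and> vector_derivative \<pi> (at t within {0..}) = policy_flow W"
      using ex_policy_flow[OF \<pi>0] by blast
    have "\<forall>t\<ge>0. \<forall>s. \<forall>B \<in> sets borel. apply_bkernel (vector_derivative \<pi> (at t within {0..})) s B =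
           (\<integral>a\<in>B. - (Q P c \<gamma> \<mu> \<tau> (\<pi> t) s a + \<tau> * ln (policy_density \<mu> (\<pi> t) s a) - V P c \<gamma> \<mu> \<tau> (\<pi> t) s)
             \<partial>kernel_measure (\<pi> t) s)"
    proof (rule allI, rule impI)
      fix t :: real assume "0 \<le> t"
      then show "\<forall>s. \<forall>B \<in> sets borel. apply_bkernel (vector_derivative \<pi> (at t within {0..})) s B =
           (\<integral>a\<in>B. - (Q P c \<gamma> \<mu> \<tau> (\<pi> t) s a + \<tau> * ln (policy_density \<mu> (\<pi> t) s a) - V P c \<gamma> \<mu> \<tau> (\<pi> t) s)
             \<partial>kernel_measure (\<pi> t) s)"
        by (intro eq[OF pol[OF \<pi>(1)], THEN iffD2] flow)
    qed
    then show "\<exists>\<pi>. \<pi> \<in> C1 {0..} (policies \<mu>) \<and> \<pi> 0 = \<pi>0 \<and>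
        (\<forall>t\<ge>0. \<forall>s. \<forall>B \<in> sets borel. apply_bkernel (vector_derivative \<pi> (at t within {0..})) s B =
           (\<integral>a\<in>B. - (Q P c \<gamma> \<mu> \<tau> (\<pi> t) s a + \<tau> * ln (policy_density \<mu> (\<pi> t) s a) - V P c \<gamma> \<mu> \<tau> (\<pi> t) s)
             \<partial>kernel_measure (\<pi> t) s))"
      using \<pi> by (intro exI[of _ \<pi>] conjI)
  next
    fix \<pi> \<rho> :: "real \<Rightarrow> ('s, 'a) bkernel"
    assume \<pi>: "\<pi> \<in> C1 {0..} (policies \<mu>) \<and> \<pi> 0 = \<pi>0 \<and>
        (\<forall>t\<ge>0. \<forall>s. \<forall>B \<in> sets borel. apply_bkernel (vector_derivative \<pi> (at t within {0..})) s B =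
           (\<integral>a\<in>B. - (Q P c \<gamma> \<mu> \<tau> (\<pi> t) s a + \<tau> * ln (policy_density \<mu> (\<pi> t) s a) - V P c \<gamma> \<mu> \<tau> (\<pi> t) s)
             \<partial>kernel_measure (\<pi> t) s))"
      and \<rho>: "\<rho> \<in> C1 {0..} (policies \<mu>) \<and> \<rho> 0 = \<pi>0 \<and>
        (\<forall>t\<ge>0. \<forall>s. \<forall>B \<in> sets borel. apply_bkernel (vector_derivative \<rho> (at t within {0..})) s B =
           (\<integral>a\<in>B. - (Q P c \<gamma> \<mu> \<tau> (\<rho> t) s a + \<tau> * ln (policy_density \<mu> (\<rho> t) s a) - V P c \<gamma> \<mu> \<tau> (\<rho> t) s)
             \<partial>kernel_measure (\<rho> t) s))"
    show "\<pi> = \<rho>"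
    proof (rule policy_flow_unique)
      fix t :: real assume t: "0 \<le> t"
      show "\<exists>W. normalised W \<and> \<pi> t = softmax \<mu> W \<and> vector_derivative \<pi> (at t within {0..}) = policy_flow W"
        using \<pi> t by (intro eq[OF pol, THEN iffD1]) auto
      show "\<exists>W. normalised W \<and> \<rho> t = softmax \<mu> W \<and> vector_derivative \<rho> (at t within {0..}) = policy_flow W"
        using \<rho> t by (intro eq[OF pol, THEN iffD1]) auto
    qed (use \<pi> \<rho> in auto)
  qed
qed

end

theorem theorem2p7:
  fixes P :: "'s::polish_space \<times> 'a::polish_space \<Rightarrow> 's measure"
    and c :: "'s \<times> 'a \<Rightarrow> real"
    and \<gamma> :: real
    and \<mu> :: "'a measure"
    and \<tau> :: real
  assumes "P \<in> borel \<rightarrow>\<^sub>M prob_algebra borel"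
    and "c \<in> borel_measurable borel" and "bounded (range c)"
    and "0 \<le> \<gamma>" and "\<gamma> < 1"
    and "prob_space \<mu>" and "sets \<mu> = sets borel"
    and "0 < \<tau>"
  shows
    "(\<forall>Z\<^sub>0 :: ('s \<times> 'a) bmeas. \<exists>!Z. Z \<in> C1 {0..} UNIV \<and> Z 0 = Z\<^sub>0 \<and>
        (\<forall>t\<ge>0. \<forall>s a.
           apply_bmeas (vector_derivative Z (at t within {0..})) (s, a) =
           - (Q P c \<gamma> \<mu> \<tau> (softmax \<mu> (Z t)) s a + \<tau> * apply_bmeas (Z t) (s, a)
              - V P c \<gamma> \<mu> \<tau> (softmax \<mu> (Z t)) s))) \<and>
     (\<forall>\<pi>\<^sub>0 \<in> (policies \<mu> :: ('s, 'a) bkernel set). \<exists>!\<pi>. \<pi> \<in> C1 {0..} (policies \<mu>) \<and> \<pi> 0 = \<pi>\<^sub>0 \<and>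
        (\<forall>t\<ge>0. \<forall>s. \<forall>B \<in> sets borel.
           apply_bkernel (vector_derivative \<pi> (at t within {0..})) s B =
           (\<integral>a\<in>B. - (Q P c \<gamma> \<mu> \<tau> (\<pi> t) s a + \<tau> * ln (policy_density \<mu> (\<pi> t) s a)
                     - V P c \<gamma> \<mu> \<tau> (\<pi> t) s) \<partial>kernel_measure (\<pi> t) s)))"
proof -
  interpret mdp \<mu> P c \<gamma> \<tau>
    using assms by (intro mdp.intro action_space.intro action_space_axioms.intro mdp_axioms.intro)
  show ?thesis
    using ex1_log_flow ex1_policy_flow by blast
qed

end
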